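(* Let $A$ be a commutative ring, let $R=A[\xi_i]_{i\ge1}$, and let $\mathfrak{p}$ be a finitary $\mathfrak{S}$-prime of $R$. Then $\mathfrak{p}=\mathfrak{P}(\lambda,e;Z)$ for some data $(\lambda,e;Z)$ consisting of an $\infty$-composition $\lambda$ on an index set $\mathcal{I}$, a $\lambda$-reduced weighting $e$ on $\mathcal{I}$, and an irreducible closed subset $Z$ of $\mathbf{U}^{\mathcal{I}}$. Moreover, the data $(\lambda,e;Z)$ is unique up to isomorphism.
   Context: $[\infty]=\{1,2,\ldots\}$; $\mathfrak{S}=\bigcup_{n\ge1}\mathfrak{S}_n$ is the group of permutations of $[\infty]$ moving finitely many elements, acting on $R$ by $A$-algebra automorphisms permuting the $\xi_i$. An $\mathfrak{S}$-ideal is an $\mathfrak{S}$-stable ideal; an $\mathfrak{S}$-ideal $\mathfrak{p}\ne R$ is $\mathfrak{S}$-prime if $\mathfrak{a}\mathfrak{b}\subset\mathfrak{p}$ implies $\mathfrak{a}\subset\mathfrak{p}$ or $\mathfrak{b}\subset\mathfrak{p}$ for all $\mathfrak{S}$-ideals $\mathfrak{a},\mathfrak{b}$. An $\infty$-composition on a finite index set $\mathcal{I}$ is a function $\lambda\colon\mathcal{I}\to\mathbf{Z}_{\ge1}\cup\{\infty\}$ taking the value $\infty$ at least once. A weighting on $\mathcal{I}$ is a function $e\colon\mathcal{I}\to\mathbf{Z}_{\ge1}$; it is $\lambda$-reduced if $e_\alpha=1$ whenever $\lambda_\alpha<\infty$. A partition of $[\infty]$ of type $\lambda$ is a family $\mathcal{U}=\{U_\alpha\}_{\alpha\in\mathcal{I}}$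 of disjoint non-empty subsets covering $[\infty]$ with $\#U_\alpha=\lambda_\alpha$; $\pi\colon[\infty]\to\mathcal{I}$ is given by $i\in U_{\pi(i)}$. Let $\tilde{S}_{\mathcal{U},0}=A[t_\alpha]_{\alpha\in\mathcal{I}}[(t_\alpha-t_\beta)^{-1}]_{\alpha\ne\beta}$, $\mathbf{U}^{\mathcal{I}}=\operatorname{Spec}(\tilde{S}_{\mathcal{U},0})$, $\tilde{S}_{\mathcal{U}}=\tilde{S}_{\mathcal{U},0}[\epsilon_i]_{i\ge1}$. For a subset $Z\subset\mathbf{U}^{\mathcal{I}}$ (set of scheme-theoretic points) let $\mathfrak{I}_0(Z)\subset\tilde{S}_{\mathcal{U},0}$ be its radical ideal (the intersection of the primes in $Z$), and let $\mathfrak{Q}_{\mathcal{U}}(\lambda,e;Z)$ be the ideal of $\tilde{S}_{\mathcal{U}}$ generated by $\mathfrak{I}_0(Z)$ and all $\epsilon_i^{e(\pi(i))}$, $i\ge1$. Let $\iota\colon R\to\tilde{S}_{\mathcal{U}}$ be the $A$-algebra map $\xi_i\mapsto t_{\pi(i)}+\epsilon_i$. Then $\mathfrak{P}(\lambda,e;Z)=\{f\in R:\iota(\sigma f)\in\mathfrak{Q}_{\mathcal{U}}(\lambda,e;Z)\text{ for all }\sigma\in\mathfrak{S}\}$; this $\mathfrak{S}$-ideal does not depend on the choice of $\mathcal{U}$ of type $\lambda$. Write $\mathfrak{P}(\lambda;Z)$ when $e=1$ identically. An $\mathfrak{S}$-prime $\mathfrak{p}$ is finitary if its ordinary radical $\operatorname{rad}(\mathfrak{p})$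 equals $\mathfrak{P}(\lambda;Z)$ for some $\infty$-composition $\lambda$ on some $\mathcal{I}$ and some irreducible closed $Z\subset\mathbf{U}^{\mathcal{I}}$. Two triples $(\lambda,e;Z)$ and $(\lambda',e';Z')$ on index sets $\mathcal{I},\mathcal{I}'$ are isomorphic if there is a bijection $\mathcal{I}\to\mathcal{I}'$ under which $\lambda,e,Z$ correspond to $\lambda',e',Z'$. *)

theory Defs
  imports
    "HOL-Algebra.Algebraic_Closure_Type"
    "HOL-Algebra.Ideal_Product"
    "HOL-Algebra.Subrings"
    "HOL-Library.Poly_Mapping"
    "HOL-Library.Extended_Nat"
    "HOL-Library.Disjoint_Sets"
    "HOL-Combinatorics.Permutations"
begin

section \<open>Polynomials in arbitrarily many variables\<close>

type_synonym ('x, 'a) mpoly = "('x \<Rightarrow>\<^sub>0 nat) \<Rightarrow>\<^sub>0 'a"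

definition Const :: "'a::comm_ring_1 \<Rightarrow> ('x, 'a) mpoly" where
  "Const a = Poly_Mapping.single 0 a"

definition Var :: "'x \<Rightarrow> ('x, 'a::comm_ring_1) mpoly" where
  "Var x = Poly_Mapping.single (Poly_Mapping.single x 1) 1"

text \<open>For a ring homomorphism \<open>c\<close>, this is the ring homomorphism that restricts to \<open>c\<close> on
  constants and sends the variable \<open>x\<close> to \<open>v x\<close>.\<close>

definition eval_mpoly ::
    "('a \<Rightarrow> 'b) \<Rightarrow> ('x \<Rightarrow> 'b) \<Rightarrow> ('x, 'a::comm_ring_1) mpoly \<Rightarrow> 'b::comm_ring_1" where
  "eval_mpoly c v f =
     (\<Sum>m \<in> Poly_Mapping.keys f. c (Poly_Mapping.lookup f m) *
        (\<Prod>x \<in> Poly_Mapping.keys m. v x ^ Poly_Mapping.lookup m x))"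

definition mpolys_in :: "'x set \<Rightarrow> ('x, 'a::comm_ring_1) mpoly set" where
  "mpolys_in I = {f. \<forall>m \<in> Poly_Mapping.keys f. Poly_Mapping.keys m \<subseteq> I}"


section \<open>The total ring of fractions\<close>

definition nonzerodiv :: "'b::comm_ring_1 \<Rightarrow> bool" where
  "nonzerodiv s \<longleftrightarrow> (\<forall>x. s * x = 0 \<longrightarrow> x = 0)"

lemma nonzerodiv_1 [simp]: "nonzerodiv 1"
  by (simp add: nonzerodiv_def)

lemma nonzerodiv_mult [simp]: "nonzerodiv s \<Longrightarrow> nonzerodiv t \<Longrightarrow> nonzerodiv (s * t)"
  unfolding nonzerodiv_def by (metis mult.assoc)

lemma nonzerodiv_cancel: "nonzerodiv s \<Longrightarrow> s * x = s * y \<Longrightarrow> x = y"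
  unfolding nonzerodiv_def by (metis eq_iff_diff_eq_0 right_diff_distrib)

definition tfracrel :: "'b::comm_ring_1 \<times> 'b \<Rightarrow> 'b \<times> 'b \<Rightarrow> bool" where
  "tfracrel x y \<longleftrightarrow> nonzerodiv (snd x) \<and> nonzerodiv (snd y) \<and> fst x * snd y = fst y * snd x"

lemma part_equivp_tfracrel: "part_equivp tfracrel"
proof (rule part_equivpI)
  show "\<exists>x. tfracrel x x"
    by (rule exI[of _ "(0, 1)"]) (simp add: tfracrel_def)
  show "symp tfracrel"
    by (auto simp: symp_def tfracrel_def)
  show "transp tfracrel"
  proof (rule transpI)
    fix x y z :: "'b \<times> 'b"
    assume xy: "tfracrel x y" and yz: "tfracrel y z"
    have "snd y * (fst x * snd z) = snd z * (fst x * snd y)" by (simp add: ac_simps)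
    also have "\<dots> = snd x * (fst y * snd z)" using xy by (simp add: tfracrel_def ac_simps)
    also have "\<dots> = snd y * (fst z * snd x)" using yz by (simp add: tfracrel_def ac_simps)
    finally have eq: "snd y * (fst x * snd z) = snd y * (fst z * snd x)" .
    have "nonzerodiv (snd y)" using xy by (simp add: tfracrel_def)
    from nonzerodiv_cancel[OF this eq] have "fst x * snd z = fst z * snd x" .
    then show "tfracrel x z" using xy yz by (simp add: tfracrel_def)
  qed
qed

quotient_type (overloaded) 'b tfrac = "'b::comm_ring_1 \<times> 'b" / partial: tfracrel
  by (rule part_equivp_tfracrel)

text \<open>The fraction \<open>a / s\<close>; a junk value unless \<open>s\<close> is a nonzerodivisor.\<close>

lift_definition TFrac :: "'b::comm_ring_1 \<Rightarrow> 'b \<Rightarrow> 'b tfrac"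
  is "\<lambda>a s. if nonzerodiv s then (a, s) else (0, 1)"
  by (simp add: tfracrel_def)

lemma TFrac_cases [cases type: tfrac]:
  obtains (TFrac) a s where "q = TFrac a s" "nonzerodiv s"
  by transfer (auto simp: tfracrel_def)

lemma TFrac_eq_iff:
  "nonzerodiv s \<Longrightarrow> nonzerodiv t \<Longrightarrow> TFrac a s = TFrac b t \<longleftrightarrow> a * t = b * s"
  by transfer (simp add: tfracrel_def)

instantiation tfrac :: (comm_ring_1) comm_ring_1
begin

lift_definition zero_tfrac :: "'a tfrac" is "(0, 1)" by (simp add: tfracrel_def)

lift_definition one_tfrac :: "'a tfrac" is "(1, 1)" by (simp add: tfracrel_def)

lift_definition plus_tfrac :: "'a tfrac \<Rightarrow> 'a tfrac \<Rightarrow> 'a tfrac"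
  is "\<lambda>q r. (fst q * snd r + fst r * snd q, snd q * snd r)"
proof -
  fix q q' r r' :: "'a \<times> 'a"
  assume q: "tfracrel q q'" and r: "tfracrel r r'"
  have "(fst q * snd r + fst r * snd q) * (snd q' * snd r') =
      (fst q * snd q') * (snd r * snd r') + (fst r * snd r') * (snd q * snd q')"
    by (simp add: algebra_simps)
  also have "\<dots> = (fst q' * snd q) * (snd r * snd r') + (fst r' * snd r) * (snd q * snd q')"
    using q r by (simp add: tfracrel_def)
  also have "\<dots> = (fst q' * snd r' + fst r' * snd q') * (snd q * snd r)"
    by (simp add: algebra_simps)
  finally show "tfracrel (fst q * snd r + fst r * snd q, snd q * snd r)
      (fst q' * snd r' + fst r' * snd q', snd q' * snd r')"
    using q r by (simp add: tfracrel_def)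
qed

lift_definition uminus_tfrac :: "'a tfrac \<Rightarrow> 'a tfrac" is "\<lambda>q. (- fst q, snd q)"
  by (simp add: tfracrel_def)

definition minus_tfrac :: "'a tfrac \<Rightarrow> 'a tfrac \<Rightarrow> 'a tfrac" where
  "minus_tfrac q r = q + - r"

lift_definition times_tfrac :: "'a tfrac \<Rightarrow> 'a tfrac \<Rightarrow> 'a tfrac"
  is "\<lambda>q r. (fst q * fst r, snd q * snd r)"
proof -
  fix q q' r r' :: "'a \<times> 'a"
  assume q: "tfracrel q q'" and r: "tfracrel r r'"
  have "fst q * fst r * (snd q' * snd r') = (fst q * snd q') * (fst r * snd r')"
    by (simp add: ac_simps)
  also have "\<dots> = (fst q' * snd q) * (fst r' * snd r)"
    using q r by (simp add: tfracrel_def)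
  also have "\<dots> = fst q' * fst r' * (snd q * snd r)"
    by (simp add: ac_simps)
  finally show "tfracrel (fst q * fst r, snd q * snd r) (fst q' * fst r', snd q' * snd r')"
    using q r by (simp add: tfracrel_def)
qed

lemma TFrac_0: "0 = TFrac 0 1"
  by transfer (simp add: tfracrel_def)

lemma TFrac_1: "1 = TFrac 1 1"
  by transfer (simp add: tfracrel_def)

lemma TFrac_add:
  "nonzerodiv s \<Longrightarrow> nonzerodiv t \<Longrightarrow> TFrac a s + TFrac b t = TFrac (a * t + b * s) (s * t)"
  by transfer (simp add: tfracrel_def)

lemma TFrac_minus: "nonzerodiv s \<Longrightarrow> - TFrac a s = TFrac (- a) s"
  by transfer (simp add: tfracrel_def)

lemma TFrac_mult:
  "nonzerodiv s \<Longrightarrow> nonzerodiv t \<Longrightarrow> TFrac a s * TFrac b t = TFrac (a * b) (s * t)"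
  by transfer (simp add: tfracrel_def)

instance
proof
  fix q r s :: "'a tfrac"
  note simps = TFrac_0 TFrac_1 TFrac_add TFrac_minus TFrac_mult TFrac_eq_iff algebra_simps
  show "q * r * s = q * (r * s)" by (cases q; cases r; cases s) (simp add: simps)
  show "q * r = r * q" by (cases q; cases r) (simp add: simps)
  show "1 * q = q" by (cases q) (simp add: simps)
  show "q + r + s = q + (r + s)" by (cases q; cases r; cases s) (simp add: simps)
  show "q + r = r + q" by (cases q; cases r) (simp add: simps)
  show "0 + q = q" by (cases q) (simp add: simps)
  show "- q + q = 0" by (cases q) (simp add: simps)
  show "q - r = q + - r" by (simp add: minus_tfrac_def)
  show "(q + r) * s = q * s + r * s" by (cases q; cases r; cases s) (simp add: simps)
  show "(0 :: 'a tfrac) \<noteq> 1" by (simp add: TFrac_0 TFrac_1 TFrac_eq_iff)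
qed

end


section \<open>The rings attached to a finite index set\<close>

inductive_set var_diffs :: "'i set \<Rightarrow> ('i, 'a::comm_ring_1) mpoly set" for I where
  one: "1 \<in> var_diffs I"
| mult: "s \<in> var_diffs I \<Longrightarrow> \<alpha> \<in> I \<Longrightarrow> \<beta> \<in> I \<Longrightarrow> \<alpha> \<noteq> \<beta> \<Longrightarrow>
    s * (Var \<alpha> - Var \<beta>) \<in> var_diffs I"

text \<open>The localization of \<open>A[t\<^sub>\<alpha> : \<alpha> \<in> I]\<close> at the differences \<open>t\<^sub>\<alpha> - t\<^sub>\<beta>\<close>. The index set is
  not a type, so it is realized inside the total ring of fractions of the polynomial ring on
  the whole type \<open>'i\<close>; nothing is lost because the differences are nonzerodivisors
  (\<open>nonzerodiv_var_diffs\<close> below).\<close>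

definition conf_ring :: "'i set \<Rightarrow> ('i, 'a::comm_ring_1) mpoly tfrac ring" where
  "conf_ring I = ring_of_type_algebra
     \<lparr>carrier := {TFrac f s | f s. f \<in> mpolys_in I \<and> s \<in> var_diffs I}\<rparr>"

definition tconst :: "'a::comm_ring_1 \<Rightarrow> ('i, 'a) mpoly tfrac" where
  "tconst a = TFrac (Const a) 1"

definition tvar :: "'i \<Rightarrow> ('i, 'a::comm_ring_1) mpoly tfrac" where
  "tvar \<alpha> = TFrac (Var \<alpha>) 1"

text \<open>The polynomial ring over \<open>conf_ring I\<close> in the variables \<open>\<epsilon>\<^sub>i\<close>.\<close>

definition eps_ring :: "'i set \<Rightarrow> (nat, ('i, 'a::comm_ring_1) mpoly tfrac) mpoly ring" where
  "eps_ring I = ring_of_type_algebra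
     \<lparr>carrier := {g. \<forall>m. Poly_Mapping.lookup g m \<in> carrier (conf_ring I)}\<rparr>"

subsection \<open>Well-definedness of these rings\<close>

lemma lookup_Var_mult:
  "Poly_Mapping.lookup (Var x * f) (Poly_Mapping.single x 1 + m) = Poly_Mapping.lookup f m"
proof -
  have "Poly_Mapping.lookup (Var x * f) (Poly_Mapping.single x 1 + m) =
      (\<Sum>l. ((\<Sum>q. Poly_Mapping.lookup f q when Poly_Mapping.single x 1 + m = l + q)
        when Poly_Mapping.single x 1 = l))"
    unfolding lookup_mult
    by (intro Sum_any.cong) (simp add: Var_def lookup_single when_def)
  then show ?thesis by simp
qed

lemma lookup_Var_mult_eq_0:
  fixes f :: "('x, 'a::comm_ring_1) mpoly"
  assumes "\<And>q. n = Poly_Mapping.single x 1 + q \<Longrightarrow> Poly_Mapping.lookup f q = 0"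
  shows "Poly_Mapping.lookup (Var x * f) n = 0"
proof -
  have "Poly_Mapping.lookup (Var x * f) n =
      (\<Sum>l. ((\<Sum>q. Poly_Mapping.lookup f q when n = l + q) when Poly_Mapping.single x 1 = l))"
    unfolding lookup_mult
    by (intro Sum_any.cong) (simp add: Var_def lookup_single when_def)
  also have "\<dots> = (\<Sum>q. Poly_Mapping.lookup f q when n = Poly_Mapping.single x 1 + q)"
    by simp
  also have "\<dots> = (\<Sum>q :: 'x \<Rightarrow>\<^sub>0 nat. 0)"
    by (intro Sum_any.cong) (auto simp: when_def assms)
  finally show ?thesis by simp
qed

lemma nonzerodiv_Var_diff:
  assumes "\<alpha> \<noteq> \<beta>"
  shows "nonzerodiv (Var \<alpha> - Var \<beta> :: ('i, 'a::comm_ring_1) mpoly)"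
  unfolding nonzerodiv_def
proof (intro allI impI, rule ccontr)
  fix f :: "('i, 'a) mpoly"
  assume 0: "(Var \<alpha> - Var \<beta>) * f = 0" and "f \<noteq> 0"
  define d where "d = (\<lambda>m :: 'i \<Rightarrow>\<^sub>0 nat. Poly_Mapping.lookup m \<alpha>)"
  have ne: "Poly_Mapping.keys f \<noteq> {}" using \<open>f \<noteq> 0\<close> by simp
  then have "Max (d ` Poly_Mapping.keys f) \<in> d ` Poly_Mapping.keys f" by (intro Max_in) auto
  then obtain m where m: "m \<in> Poly_Mapping.keys f" "d m = Max (d ` Poly_Mapping.keys f)" by auto
  have "Poly_Mapping.lookup (Var \<beta> * f) (Poly_Mapping.single \<alpha> 1 + m) = 0"
  proof (rule lookup_Var_mult_eq_0)
    fix q assume "Poly_Mapping.single \<alpha> 1 + m = Poly_Mapping.single \<beta> 1 + q"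
    then have "d (Poly_Mapping.single \<alpha> 1 + m) = d (Poly_Mapping.single \<beta> 1 + q)" by simp
    then have "d q = Suc (d m)"
      using assms by (simp add: d_def lookup_add lookup_single when_def)
    moreover have "d q \<le> d m" if "q \<in> Poly_Mapping.keys f"
      unfolding m(2) using that by (intro Max_ge) auto
    ultimately show "Poly_Mapping.lookup f q = 0" by (auto simp: in_keys_iff)
  qed
  moreover have "Var \<alpha> * f = Var \<beta> * f" using 0 by (simp add: left_diff_distrib)
  ultimately have "Poly_Mapping.lookup f m = 0" by (metis lookup_Var_mult)
  with m show False by (simp add: in_keys_iff)
qed

lemma nonzerodiv_var_diffs: "s \<in> var_diffs I \<Longrightarrow> nonzerodiv s"
  proof (induction rule: var_diffs.induct)
  case one
  show ?case by (rule nonzerodiv_1)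
next
  case (mult s \<alpha> \<beta>)
  from mult.IH nonzerodiv_Var_diff[OF \<open>\<alpha> \<noteq> \<beta>\<close>] show ?case by (rule nonzerodiv_mult)
qed

lemma var_diffs_mult:
  assumes "s \<in> var_diffs I" "t \<in> var_diffs I"
  shows "s * t \<in> var_diffs I"
  using assms(2,1)
  by (induction rule: var_diffs.induct) (auto simp: mult.assoc[symmetric] intro: var_diffs.intros)

lemma mpolys_in_closed:
  shows "Const a \<in> mpolys_in I" "0 \<in> mpolys_in I" "1 \<in> mpolys_in I"
    and "\<alpha> \<in> I \<Longrightarrow> Var \<alpha> \<in> mpolys_in I"
    and "f \<in> mpolys_in I \<Longrightarrow> - f \<in> mpolys_in I"
    and "f \<in> mpolys_in I \<Longrightarrow> g \<in> mpolys_in I \<Longrightarrow> f + g \<in> mpolys_in I"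
    and "f \<in> mpolys_in I \<Longrightarrow> g \<in> mpolys_in I \<Longrightarrow> f * g \<in> mpolys_in I"
proof -
  show "Const a \<in> mpolys_in I" "0 \<in> mpolys_in I" "1 \<in> mpolys_in I"
    "\<alpha> \<in> I \<Longrightarrow> Var \<alpha> \<in> mpolys_in I"
    by (auto simp: mpolys_in_def Const_def Var_def)
  show "- f \<in> mpolys_in I" if "f \<in> mpolys_in I"
    using that by (auto simp: mpolys_in_def in_keys_iff)
  show "f + g \<in> mpolys_in I" if "f \<in> mpolys_in I" "g \<in> mpolys_in I"
    using that keys_add[of f g] by (fastforce simp: mpolys_in_def)
  show "f * g \<in> mpolys_in I" if fg: "f \<in> mpolys_in I" "g \<in> mpolys_in I"
    unfolding mpolys_in_def
  proof safe
    fix m x assume "m \<in> Poly_Mapping.keys (f * g)" and x: "x \<in> Poly_Mapping.keys m"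
    then obtain a b where ab: "m = a + b" "a \<in> Poly_Mapping.keys f" "b \<in> Poly_Mapping.keys g"
      using keys_mult[of f g] by blast
    have "x \<in> Poly_Mapping.keys a \<union> Poly_Mapping.keys b"
      using x keys_add[of a b] ab(1) by blast
    with ab fg show "x \<in> I" unfolding mpolys_in_def by blast
  qed
qed

lemma var_diffs_subset: "s \<in> var_diffs I \<Longrightarrow> s \<in> mpolys_in I"
  by (induction rule: var_diffs.induct)
    (auto intro!: mpolys_in_closed simp: diff_conv_add_uminus simp del: add_uminus_conv_diff)

lemma cring_conf_ring: "cring (conf_ring I :: ('i, 'a::comm_ring_1) mpoly tfrac ring)"
proof -
  let ?T = "ring_of_type_algebra :: ('i, 'a) mpoly tfrac ring"
  let ?K = "{TFrac f s :: ('i, 'a) mpoly tfrac | f s. f \<in> mpolys_in I \<and> s \<in> var_diffs I}"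
  interpret T: cring ?T by (rule cring_from_type_algebra)
  have T_minus: "\<ominus>\<^bsub>?T\<^esub> x = - x" for x
    by (rule T.minus_equality) (simp_all add: ring_of_type_algebra_def)
  have "subring ?K ?T"
  proof (rule T.subringI)
    show "\<one>\<^bsub>?T\<^esub> \<in> ?K"
      using mpolys_in_closed(3) var_diffs.one TFrac_1
      by (auto simp: ring_of_type_algebra_def intro!: exI[of _ 1])
    show "\<ominus>\<^bsub>?T\<^esub> h \<in> ?K" if "h \<in> ?K" for h
    proof -
      from that obtain f s where "h = TFrac f s" "f \<in> mpolys_in I" "s \<in> var_diffs I" by blast
      then have "- h = TFrac (- f) s" "- f \<in> mpolys_in I" "s \<in> var_diffs I"
        by (simp_all add: TFrac_minus nonzerodiv_var_diffs mpolys_in_closed)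
      then show ?thesis unfolding T_minus by blast
    qed
    fix h k assume "h \<in> ?K" "k \<in> ?K"
    then obtain f s g t where *: "h = TFrac f s" "f \<in> mpolys_in I" "s \<in> var_diffs I"
      "k = TFrac g t" "g \<in> mpolys_in I" "t \<in> var_diffs I" by blast
    have "f * g \<in> mpolys_in I" "f * t + g * s \<in> mpolys_in I" "s * t \<in> var_diffs I"
      using * by (simp_all add: mpolys_in_closed var_diffs_mult var_diffs_subset)
    moreover have "h * k = TFrac (f * g) (s * t)" "h + k = TFrac (f * t + g * s) (s * t)"
      using * by (simp_all add: TFrac_mult TFrac_add nonzerodiv_var_diffs)
    ultimately have "h * k \<in> ?K" "h + k \<in> ?K" by blast+
    then show "h \<otimes>\<^bsub>?T\<^esub> k \<in> ?K" "h \<oplus>\<^bsub>?T\<^esub> k \<in> ?K"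
      by (simp_all only: ring_of_type_algebra_def ring.simps monoid.simps)
  qed (simp add: ring_of_type_algebra_def)
  then show ?thesis
    unfolding conf_ring_def
    by (subst T.subcring_iff[symmetric]) (rule subringE(1) T.subcringI', assumption)+
qed

lemma conf_ringI:
  "f \<in> mpolys_in I \<Longrightarrow> s \<in> var_diffs I \<Longrightarrow> TFrac f s \<in> carrier (conf_ring I)"
  by (auto simp: conf_ring_def)

lemma conf_ring_elements:
  shows "tconst a \<in> carrier (conf_ring I)"
    and "\<alpha> \<in> I \<Longrightarrow> tvar \<alpha> \<in> carrier (conf_ring I)"
    and "\<alpha> \<in> I \<Longrightarrow> \<beta> \<in> I \<Longrightarrow> \<alpha> \<noteq> \<beta> \<Longrightarrow>
      \<exists>u \<in> carrier (conf_ring I). (tvar \<alpha> - tvar \<beta>) * u = 1"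
proof -
  show "tconst a \<in> carrier (conf_ring I)"
    unfolding tconst_def by (rule conf_ringI[OF mpolys_in_closed(1) var_diffs.one])
  show "tvar \<alpha> \<in> carrier (conf_ring I)" if "\<alpha> \<in> I"
    unfolding tvar_def by (rule conf_ringI[OF mpolys_in_closed(4)[OF that] var_diffs.one])
  assume *: "\<alpha> \<in> I" "\<beta> \<in> I" "\<alpha> \<noteq> \<beta>"
  let ?u = "TFrac 1 (Var \<alpha> - Var \<beta>)"
  have "Var \<alpha> - Var \<beta> \<in> var_diffs I" using var_diffs.mult[OF var_diffs.one *] by simp
  then have "?u \<in> carrier (conf_ring I)"
    by (rule conf_ringI[OF mpolys_in_closed(3)])
  moreover have "(tvar \<alpha> - tvar \<beta>) * ?u = 1"
    by (simp add: nonzerodiv_Var_diff[OF *(3)] tvar_def minus_tfrac_def TFrac_minus TFrac_add TFrac_mult TFrac_1 TFrac_eq_iff)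
  ultimately show "\<exists>u \<in> carrier (conf_ring I). (tvar \<alpha> - tvar \<beta>) * u = 1" by blast
qed

lemma cring_eps_ring: "cring (eps_ring I :: (nat, ('i, 'a::comm_ring_1) mpoly tfrac) mpoly ring)"
proof -
  let ?T = "ring_of_type_algebra :: (nat, ('i, 'a) mpoly tfrac) mpoly ring"
  let ?S = "conf_ring I :: ('i, 'a) mpoly tfrac ring"
  let ?K = "{g :: (nat, ('i, 'a) mpoly tfrac) mpoly. \<forall>m. Poly_Mapping.lookup g m \<in> carrier ?S}"
  interpret T: cring ?T by (rule cring_from_type_algebra)
  interpret S: cring ?S by (rule cring_conf_ring)
  have T_minus: "\<ominus>\<^bsub>?T\<^esub> x = - x" for x
    by (rule T.minus_equality) (simp_all add: ring_of_type_algebra_def)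
  have ops: "\<zero>\<^bsub>?S\<^esub> = 0" "\<one>\<^bsub>?S\<^esub> = 1" "x \<oplus>\<^bsub>?S\<^esub> y = x + y" "x \<otimes>\<^bsub>?S\<^esub> y = x * y" for x y
    by (simp_all add: conf_ring_def ring_of_type_algebra_def)
  have zero: "0 \<in> carrier ?S" and one: "1 \<in> carrier ?S"
    using S.zero_closed S.one_closed by (simp_all only: ops)
  have add: "x + y \<in> carrier ?S" and mult: "x * y \<in> carrier ?S"
    if "x \<in> carrier ?S" "y \<in> carrier ?S" for x y
    using S.a_closed[OF that] S.m_closed[OF that] by (simp_all only: ops)
  have minus: "- x \<in> carrier ?S" if "x \<in> carrier ?S" for x
  proof -
    have "\<ominus>\<^bsub>?S\<^esub> x + x = 0"
      using S.l_neg[OF that] by (simp only: ops)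
    then have "\<ominus>\<^bsub>?S\<^esub> x = - x" by (simp only: eq_neg_iff_add_eq_0)
    then show ?thesis using S.a_inv_closed[OF that] by simp
  qed
  have sum: "sum h A \<in> carrier ?S" if "\<And>x. h x \<in> carrier ?S" for h :: "(nat \<Rightarrow>\<^sub>0 nat) \<Rightarrow> _" and A
    using that by (induction A rule: infinite_finite_induct) (auto intro: zero add)
  have Sum_any: "Sum_any h \<in> carrier ?S" if "\<And>x. h x \<in> carrier ?S"
    for h :: "(nat \<Rightarrow>\<^sub>0 nat) \<Rightarrow> _"
    using sum[OF that] by (simp add: Sum_any.expand_set)
  have "subring ?K ?T"
  proof (rule T.subringI)
    show "\<one>\<^bsub>?T\<^esub> \<in> ?K"
      using zero one by (simp add: ring_of_type_algebra_def lookup_one when_def)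
    show "\<ominus>\<^bsub>?T\<^esub> h \<in> ?K" if "h \<in> ?K" for h
      using that by (simp add: T_minus minus)
    fix h k assume "h \<in> ?K" "k \<in> ?K"
    then have hk: "\<And>m. Poly_Mapping.lookup h m \<in> carrier ?S"
      "\<And>m. Poly_Mapping.lookup k m \<in> carrier ?S" by blast+
    have "Poly_Mapping.lookup (h * k) m \<in> carrier ?S" for m
      unfolding lookup_mult by (intro Sum_any mult hk) (simp add: when_def hk zero)
    then show "h \<otimes>\<^bsub>?T\<^esub> k \<in> ?K" by (simp add: ring_of_type_algebra_def)
    have "Poly_Mapping.lookup (h + k) m \<in> carrier ?S" for m
      unfolding lookup_add by (intro add hk)
    then show "h \<oplus>\<^bsub>?T\<^esub> k \<in> ?K" by (simp add: ring_of_type_algebra_def)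
  qed (simp add: ring_of_type_algebra_def)
  then show ?thesis
    unfolding eps_ring_def
    by (subst T.subcring_iff[symmetric]) (rule subringE(1) T.subcringI', assumption)+
qed


section \<open>The Zariski topology\<close>

definition Spec :: "('r, 'm) ring_scheme \<Rightarrow> 'r set set" where
  "Spec S = {P. primeideal P S}"

definition zariski_closed :: "('r, 'm) ring_scheme \<Rightarrow> 'r set set \<Rightarrow> bool" where
  "zariski_closed S Z \<longleftrightarrow> (\<exists>J \<subseteq> carrier S. Z = {P \<in> Spec S. J \<subseteq> P})"

definition irreducible_closed :: "('r, 'm) ring_scheme \<Rightarrow> 'r set set \<Rightarrow> bool" where
  "irreducible_closed S Z \<longleftrightarrow> zariski_closed S Z \<and> Z \<noteq> {} \<and>
     (\<forall>Z1 Z2. zariski_closed S Z1 \<longrightarrow> zariski_closed S Z2 \<longrightarrow> Z \<subseteq> Z1 \<union> Z2 \<longrightarrow>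
        Z \<subseteq> Z1 \<or> Z \<subseteq> Z2)"

definition radical_ideal_of :: "('r, 'm) ring_scheme \<Rightarrow> 'r set set \<Rightarrow> 'r set" where
  "radical_ideal_of S Z = carrier S \<inter> \<Inter>Z"

definition ideal_radical :: "('r, 'm) ring_scheme \<Rightarrow> 'r set \<Rightarrow> 'r set" where
  "ideal_radical S J = {x \<in> carrier S. \<exists>n::nat. x [^]\<^bsub>S\<^esub> n \<in> J}"


section \<open>The infinite polynomial ring and its symmetric ideals\<close>

text \<open>The ring \<open>R\<close> is the type \<open>(nat, 'a) mpoly\<close>, where \<open>Var i\<close> for \<open>i = 0, 1, \<dots>\<close> stands for
  \<open>\<xi>\<^bsub>i+1\<^esub>\<close>; thus \<open>[\<infinity>]\<close> is \<open>nat\<close>.\<close>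

abbreviation poly_ring :: "(nat, 'a::comm_ring_1) mpoly ring" where
  "poly_ring \<equiv> ring_of_type_algebra"

definition finitary_perms :: "(nat \<Rightarrow> nat) set" where
  "finitary_perms = (\<Union>n. {\<sigma>. \<sigma> permutes {..<n}})"

definition perm_act :: "(nat \<Rightarrow> nat) \<Rightarrow> (nat, 'a::comm_ring_1) mpoly \<Rightarrow> (nat, 'a) mpoly" where
  "perm_act \<sigma> = eval_mpoly Const (\<lambda>i. Var (\<sigma> i))"

definition sym_ideal :: "(nat, 'a::comm_ring_1) mpoly set \<Rightarrow> bool" where
  "sym_ideal \<aa> \<longleftrightarrow> ideal \<aa> poly_ring \<and> (\<forall>\<sigma> \<in> finitary_perms. perm_act \<sigma> ` \<aa> \<subseteq> \<aa>)"

definition sym_prime :: "(nat, 'a::comm_ring_1) mpoly set \<Rightarrow> bool" where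
  "sym_prime \<pp> \<longleftrightarrow> sym_ideal \<pp> \<and> \<pp> \<noteq> UNIV \<and>
     (\<forall>\<aa> \<bb>. sym_ideal \<aa> \<longrightarrow> sym_ideal \<bb> \<longrightarrow> ideal_prod poly_ring \<aa> \<bb> \<subseteq> \<pp> \<longrightarrow> \<aa> \<subseteq> \<pp> \<or> \<bb> \<subseteq> \<pp>)"


section \<open>Compositions, weightings and partitions\<close>

definition inf_composition :: "'i set \<Rightarrow> ('i \<Rightarrow> enat) \<Rightarrow> bool" where
  "inf_composition I lam \<longleftrightarrow> finite I \<and> (\<forall>\<alpha> \<in> I. 1 \<le> lam \<alpha>) \<and> (\<exists>\<alpha> \<in> I. lam \<alpha> = \<infinity>)"

definition weighting :: "'i set \<Rightarrow> ('i \<Rightarrow> nat) \<Rightarrow> bool" where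
  "weighting I e \<longleftrightarrow> (\<forall>\<alpha> \<in> I. 1 \<le> e \<alpha>)"

definition reduced_weighting :: "'i set \<Rightarrow> ('i \<Rightarrow> enat) \<Rightarrow> ('i \<Rightarrow> nat) \<Rightarrow> bool" where
  "reduced_weighting I lam e \<longleftrightarrow> weighting I e \<and> (\<forall>\<alpha> \<in> I. lam \<alpha> < \<infinity> \<longrightarrow> e \<alpha> = 1)"

definition ecard :: "'b set \<Rightarrow> enat" where
  "ecard B = (if finite B then enat (card B) else \<infinity>)"

definition partition_of_type :: "'i set \<Rightarrow> ('i \<Rightarrow> enat) \<Rightarrow> ('i \<Rightarrow> nat set) \<Rightarrow> bool" where
  "partition_of_type I lam U \<longleftrightarrow> disjoint_family_on U I \<and> (\<Union>\<alpha> \<in> I. U \<alpha>) = UNIV \<and>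
     (\<forall>\<alpha> \<in> I. U \<alpha> \<noteq> {} \<and> ecard (U \<alpha>) = lam \<alpha>)"

definition block_index :: "'i set \<Rightarrow> ('i \<Rightarrow> nat set) \<Rightarrow> nat \<Rightarrow> 'i" where
  "block_index I U i = (THE \<alpha>. \<alpha> \<in> I \<and> i \<in> U \<alpha>)"


section \<open>The ideals attached to a triple\<close>

definition iota :: "'i set \<Rightarrow> ('i \<Rightarrow> nat set) \<Rightarrow>
    (nat, 'a::comm_ring_1) mpoly \<Rightarrow> (nat, ('i, 'a) mpoly tfrac) mpoly" where
  "iota I U = eval_mpoly (\<lambda>a. Const (tconst a)) (\<lambda>i. Const (tvar (block_index I U i)) + Var i)"

definition Q_ideal :: "'i set \<Rightarrow> ('i \<Rightarrow> nat set) \<Rightarrow> ('i \<Rightarrow> nat) \<Rightarrow>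
    ('i, 'a::comm_ring_1) mpoly tfrac set set \<Rightarrow> (nat, ('i, 'a) mpoly tfrac) mpoly set" where
  "Q_ideal I U e Z = genideal (eps_ring I)
     (Const ` radical_ideal_of (conf_ring I) Z \<union> range (\<lambda>i. Var i ^ e (block_index I U i)))"

definition P_ideal_part :: "'i set \<Rightarrow> ('i \<Rightarrow> nat set) \<Rightarrow> ('i \<Rightarrow> nat) \<Rightarrow>
    ('i, 'a::comm_ring_1) mpoly tfrac set set \<Rightarrow> (nat, 'a) mpoly set" where
  "P_ideal_part I U e Z = {f. \<forall>\<sigma> \<in> finitary_perms. iota I U (perm_act \<sigma> f) \<in> Q_ideal I U e Z}"

text \<open>The result does not depend on the partition of type \<open>lam\<close> that is chosen.\<close>

definition P_ideal :: "'i set \<Rightarrow> ('i \<Rightarrow> enat) \<Rightarrow> ('i \<Rightarrow> nat) \<Rightarrow>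
    ('i, 'a::comm_ring_1) mpoly tfrac set set \<Rightarrow> (nat, 'a) mpoly set" where
  "P_ideal I lam e Z = P_ideal_part I (SOME U. partition_of_type I lam U) e Z"

text \<open>Index sets are finite, so finite subsets of \<open>nat\<close> represent all of them.\<close>

definition finitary :: "(nat, 'a::comm_ring_1) mpoly set \<Rightarrow> bool" where
  "finitary \<pp> \<longleftrightarrow> (\<exists>(I :: nat set) lam Z. inf_composition I lam \<and>
     irreducible_closed (conf_ring I) Z \<and>
     ideal_radical poly_ring \<pp> = P_ideal I lam (\<lambda>_. 1) Z)"

definition reduced_triple :: "'i set \<Rightarrow> ('i \<Rightarrow> enat) \<Rightarrow> ('i \<Rightarrow> nat) \<Rightarrow>
    ('i, 'a::comm_ring_1) mpoly tfrac set set \<Rightarrow> bool" where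
  "reduced_triple I lam e Z \<longleftrightarrow> inf_composition I lam \<and> reduced_weighting I lam e \<and>
     irreducible_closed (conf_ring I) Z"

text \<open>\<open>\<psi>\<close> is the isomorphism of \<open>A\<close>-algebras \<open>t\<^sub>\<alpha> \<mapsto> t\<^bsub>\<phi> \<alpha>\<^esub>\<close> induced by the bijection \<open>\<phi>\<close>; these
  conditions determine it on the carrier.\<close>

definition triple_iso ::
    "'i set \<Rightarrow> ('i \<Rightarrow> enat) \<Rightarrow> ('i \<Rightarrow> nat) \<Rightarrow> ('i, 'a::comm_ring_1) mpoly tfrac set set \<Rightarrow>
     'j set \<Rightarrow> ('j \<Rightarrow> enat) \<Rightarrow> ('j \<Rightarrow> nat) \<Rightarrow> ('j, 'a) mpoly tfrac set set \<Rightarrow> bool" where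
  "triple_iso I lam e Z I' lam' e' Z' \<longleftrightarrow>
     (\<exists>\<phi> \<psi>. bij_betw \<phi> I I' \<and> (\<forall>\<alpha> \<in> I. lam' (\<phi> \<alpha>) = lam \<alpha> \<and> e' (\<phi> \<alpha>) = e \<alpha>) \<and>
        \<psi> \<in> ring_iso (conf_ring I) (conf_ring I') \<and>
        (\<forall>a. \<psi> (tconst a) = tconst a) \<and> (\<forall>\<alpha> \<in> I. \<psi> (tvar \<alpha>) = tvar (\<phi> \<alpha>)) \<and>
        Z' = (\<lambda>P. \<psi> ` P) ` Z)"

end

theory Submission
  imports Defs
begin


text \<open>
  Let \<open>q\<close> be the prime of polynomials in the \<open>t\<^sub>\<alpha>\<close> that vanish on \<open>Z\<close>, and let \<open>\<pi>\<close> send a variable to its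
  block. A polynomial \<open>f\<close> lies in the ideal attached to \<open>(\<lambda>, e; Z)\<close> iff, for every translate of \<open>f\<close>, the
  coefficients of the expansion of \<open>f(t\<^bsub>\<pi> i\<^esub> + \<epsilon>\<^sub>i)\<close> at all monomials \<open>\<epsilon>\<^sup>m\<close> with \<open>m\<^sub>i < e\<^bsub>\<pi> i\<^esub>\<close> lie
  in \<open>q\<close> (\<open>P_ideal_eq\<close>). The proof only uses this description. The generic point of \<open>Z\<close> is the prime
  \<open>point\<close> of all \<open>f\<close> with \<open>f(t\<^sub>\<pi>) \<in> q\<close>; the radical of the given \<open>\<SS>\<close>-prime \<open>p\<close> is the intersection
  of the translates of \<open>point\<close>, and every element of \<open>point\<close> is nilpotent in \<open>R / p\<close> localized at
  \<open>point\<close> (\<open>rigidifying_element\<close>, \<open>pm_nilpotent\<close>).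

  For existence, note that the localization need not contain a coefficient field over which its elements
  could be expanded. Instead let it act on an element \<open>w\<close> that is nonzero in it, but is killed by the differences
  \<open>\<xi>\<^sub>i - \<xi>\<^sub>j\<close> of any two variables of the same block that occur in \<open>w\<close> (\<open>adapted\<close>). One variable of each
  block that occurs in \<open>w\<close> plays the role of \<open>t\<^sub>\<alpha>\<close>, and the Taylor formula at these variables computes
  \<open>w * f\<close> in terms of the coefficients above; only finitely many coefficients that lie in \<open>q\<close> occur, and
  a multiple of \<open>w\<close> is killed by them. Let \<open>e\<^sub>\<alpha>\<close> be the least \<open>k\<close> such that \<open>w\<close> is killed by the
  \<open>k\<close>-th powers of the differences in the block \<open>\<alpha>\<close>, and choose \<open>w\<close> with \<open>\<Sum>\<^sub>\<alpha> e\<^sub>\<alpha>\<close> minimal. Multiplying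
  \<open>w\<close> by \<open>\<epsilon>\<^sub>j\<^bsup>e-1\<^esup>\<close> for a new variable \<open>j\<close> gives an element of the same kind, which by minimality has the
  same exponents. Hence the product of these powers over any finite set of new variables still does not
  kill \<open>w\<close> (\<open>minimal_top\<close>), so an element of \<open>p\<close> cannot have a coefficient outside \<open>q\<close> at a monomial
  below \<open>e\<close> (\<open>taylor_of_pm\<close>).

  Conversely, let the coefficients below \<open>e\<close> of all translates of \<open>f\<close> lie in \<open>q\<close>. Then \<open>w\<close> kills all
  translates of \<open>f\<close> at the generic point. More is true: for a suitable finite set \<open>E\<close> of variables a
  denominator in the variables from \<open>E\<close> suffices. Otherwise \<open>w * \<tau> f\<close> has a nonzero component at which
  every other variable of \<open>\<tau> f\<close> is infinitely near to a variable from \<open>E\<close> of an infinite block, and after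
  a permutation fixing \<open>E\<close> this component is the one at the generic point. As only finitely many translates
  of \<open>f\<close> have to be distinguished, one denominator \<open>u\<close> works for all of them; so \<open>u * w\<close>, which is not
  in \<open>p\<close>, multiplies all translates of \<open>f\<close> into \<open>p\<close>, and \<open>f \<in> p\<close> since \<open>p\<close> is an \<open>\<SS>\<close>-prime
  (\<open>in_p_if_taylor\<close>).

  For uniqueness, let \<open>w\<close> be minimal for one triple and let \<open>p\<close> also be given by a second triple. Multiply
  \<open>w\<close> by suitable powers of differences of variables and by a denominator. The result is not in \<open>p\<close>, so a
  translate of it has a nonzero image for the second triple, and the relations that it satisfies force the
  translation to induce an injection of index sets which does not decrease block sizes, maps the first
  prime into the second and carries the exponents of \<open>w\<close> to the second weighting (\<open>comparison_map\<close>). Such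
  injections exist in both directions and from a triple to itself; as index sets are finite, they are
  isomorphisms (\<open>presentation_unique\<close>).
\<close>

abbreviation (input) "lookup \<equiv> Poly_Mapping.lookup"
abbreviation (input) "keys \<equiv> Poly_Mapping.keys"
abbreviation (input) "single \<equiv> Poly_Mapping.single"

section \<open>Homomorphisms of polynomial rings\<close>

text \<open>Unital homomorphisms of commutative rings, the rings being types.\<close>

definition ring_morphism :: "('a::comm_ring_1 \<Rightarrow> 'b::comm_ring_1) \<Rightarrow> bool" where
  "ring_morphism h \<longleftrightarrow> h 1 = 1 \<and> (\<forall>x y. h (x + y) = h x + h y) \<and> (\<forall>x y. h (x * y) = h x * h y)"

lemma ring_morphismI:
  "h 1 = 1 \<Longrightarrow> (\<And>x y. h (x + y) = h x + h y) \<Longrightarrow> (\<And>x y. h (x * y) = h x * h y) \<Longrightarrow> ring_morphism h"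
  by (simp add: ring_morphism_def)

lemma
  assumes "ring_morphism h"
  shows morphism_1: "h 1 = 1" and morphism_add: "h (x + y) = h x + h y"
    and morphism_mult: "h (x * y) = h x * h y"
  using assms by (auto simp: ring_morphism_def)

lemma morphism_0: "ring_morphism h \<Longrightarrow> h 0 = 0"
  by (metis add_cancel_right_right morphism_add)

lemma morphism_minus: "ring_morphism h \<Longrightarrow> h (- x) = - h x"
  using morphism_add[of h "- x" x] by (simp add: morphism_0 eq_neg_iff_add_eq_0)

lemma morphism_diff: "ring_morphism h \<Longrightarrow> h (x - y) = h x - h y"
  by (metis diff_conv_add_uminus morphism_add morphism_minus)

lemma morphism_sum: "ring_morphism h \<Longrightarrow> h (sum f S) = (\<Sum>x\<in>S. h (f x))"
  by (induction S rule: infinite_finite_induct) (auto simp: morphism_0 morphism_add)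

lemma morphism_prod: "ring_morphism h \<Longrightarrow> h (prod f S) = (\<Prod>x\<in>S. h (f x))"
  by (induction S rule: infinite_finite_induct) (auto simp: morphism_1 morphism_mult)

lemma morphism_power: "ring_morphism h \<Longrightarrow> h (x ^ n) = h x ^ n"
  by (induction n) (auto simp: morphism_1 morphism_mult)

lemma morphism_comp: "ring_morphism h \<Longrightarrow> ring_morphism k \<Longrightarrow> ring_morphism (\<lambda>x. h (k x))"
  by (simp add: ring_morphism_def)

lemmas morphism_simps = morphism_0 morphism_1 morphism_add morphism_mult morphism_minus
  morphism_diff morphism_sum morphism_prod morphism_power

lemma Const_morphism: "ring_morphism Const"
  by (rule ring_morphismI) (simp_all add: Const_def single_add mult_single)

lemma Const_0 [simp]: "Const 0 = 0" and Const_1 [simp]: "Const 1 = 1"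
  by (simp_all add: Const_def)

text \<open>The total degree of a monomial.\<close>

definition mdeg :: "('x \<Rightarrow>\<^sub>0 nat) \<Rightarrow> nat" where
  "mdeg m = (\<Sum>x \<in> keys m. lookup m x)"

lemma mdeg_superset:
  "finite S \<Longrightarrow> keys m \<subseteq> S \<Longrightarrow> mdeg m = (\<Sum>x\<in>S. lookup m x)"
  unfolding mdeg_def by (rule sum.mono_neutral_left) (auto simp: in_keys_iff)

lemma mdeg_add: "mdeg (m + n) = mdeg m + mdeg n"
proof -
  let ?S = "keys m \<union> keys n"
  have "mdeg (m + n) = (\<Sum>x\<in>?S. lookup (m + n) x)"
    by (rule mdeg_superset) (auto dest: subsetD[OF keys_add])
  also have "\<dots> = (\<Sum>x\<in>?S. lookup m x) + (\<Sum>x\<in>?S. lookup n x)"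
    by (simp add: lookup_add sum.distrib)
  also have "\<dots> = mdeg m + mdeg n"
    by (simp add: mdeg_superset[symmetric])
  finally show ?thesis .
qed

lemma mdeg_0 [simp]: "mdeg 0 = 0"
  by (simp add: mdeg_def)

lemma mdeg_eq_0: "mdeg m = 0 \<longleftrightarrow> m = 0"
  by (auto simp: mdeg_def in_keys_iff intro!: poly_mapping_eqI)

lemma monomial_split:
  assumes "x \<in> keys (m :: 'x \<Rightarrow>\<^sub>0 nat)"
  shows "m = (m - single x 1) + single x 1"
  using assms by (intro poly_mapping_eqI) (auto simp: lookup_add lookup_minus lookup_single when_def in_keys_iff)

lemma mpoly_eq_sum: "f = (\<Sum>m \<in> keys f. single m (lookup f m))"
proof (rule poly_mapping_eqI)
  fix k
  have "(\<Sum>m \<in> keys f. lookup f m when m = k) = lookup f k"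
    by (auto simp: when_def in_keys_iff sum.delta)
  then show "lookup f k =
      lookup (\<Sum>m \<in> keys f. single m (lookup f m)) k"
    by (simp add: lookup_sum lookup_single)
qed

lemma mpoly_induct [consumes 1, case_names Const add mult]:
  assumes f: "f \<in> mpolys_in D"
    and C: "\<And>a. P (Const a)"
    and add: "\<And>f g. P f \<Longrightarrow> P g \<Longrightarrow> P (f + g)"
    and mult: "\<And>f x. P f \<Longrightarrow> x \<in> D \<Longrightarrow> P (f * Var x)"
  shows "P f"
proof -
  have mono: "keys m \<subseteq> D \<Longrightarrow> P (single m a)" for m a
  proof (induction "mdeg m" arbitrary: m)
    case 0
    then have "m = 0" by (simp add: mdeg_eq_0)
    then show ?case using C[of a] by (simp add: Const_def)
  next
    case (Suc n)
    then have "keys m \<noteq> {}" by auto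
    then obtain x where x: "x \<in> keys m" by blast
    let ?m = "m - single x 1"
    have m: "m = ?m + single x 1" by (rule monomial_split[OF x])
    have "mdeg m = mdeg ?m + 1" by (subst m, subst mdeg_add) (simp add: mdeg_def)
    then have "n = mdeg ?m" using Suc.hyps(2) by simp
    moreover have "keys ?m \<subseteq> D"
      using Suc.prems by (force simp: in_keys_iff lookup_minus)
    ultimately have "P (single ?m a)" by (rule Suc.hyps(1))
    moreover have "x \<in> D" using x Suc.prems by blast
    ultimately have "P (single ?m a * Var x)" by (rule mult)
    then show ?case by (subst m) (simp add: Var_def mult_single)
  qed
  have "P (\<Sum>m \<in> S. single m (lookup f m))"
    if "finite S" "S \<subseteq> keys f" for S
    using that
  proof (induction S rule: finite_induct)
    case empty
    then show ?case using C[of 0] by simp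
  next
    case (insert m S)
    have "P (single m (lookup f m))"
      using insert.prems f by (intro mono) (auto simp: mpolys_in_def)
    then show ?case using insert by (auto intro: add)
  qed
  from this[of "keys f"] show ?thesis
    by (simp add: mpoly_eq_sum[of f, symmetric])
qed

lemma mpolys_in_UNIV [simp]: "f \<in> mpolys_in UNIV"
  by (simp add: mpolys_in_def)

lemma mpolys_in_mono: "f \<in> mpolys_in D \<Longrightarrow> D \<subseteq> E \<Longrightarrow> f \<in> mpolys_in E"
  by (auto simp: mpolys_in_def)

lemma mpolys_in_prod: "(\<And>x. x \<in> S \<Longrightarrow> f x \<in> mpolys_in D) \<Longrightarrow> prod f S \<in> mpolys_in D"
  by (induction S rule: infinite_finite_induct) (auto intro: mpolys_in_closed)

lemma mpolys_in_power: "f \<in> mpolys_in D \<Longrightarrow> f ^ n \<in> mpolys_in D"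
  by (induction n) (auto intro: mpolys_in_closed)

lemma mpolys_in_diff: "f \<in> mpolys_in D \<Longrightarrow> g \<in> mpolys_in D \<Longrightarrow> f - g \<in> mpolys_in D"
  unfolding diff_conv_add_uminus by (intro mpolys_in_closed)

lemma finite_support: "\<exists>D. finite D \<and> f \<in> mpolys_in D"
  by (rule exI[of _ "\<Union>m \<in> keys f. keys m"]) (auto simp: mpolys_in_def)

text \<open>Homomorphisms out of a polynomial ring are determined by their values on constants and
  variables.\<close>

lemma morphism_ext:
  assumes "ring_morphism h" "ring_morphism k" "f \<in> mpolys_in D"
    and "\<And>a. h (Const a) = k (Const a)" "\<And>x. x \<in> D \<Longrightarrow> h (Var x) = k (Var x)"
  shows "h f = k f"
  using assms(3)
  by (induction rule: mpoly_induct)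
    (auto simp: assms(4,5) morphism_add[OF assms(1)] morphism_add[OF assms(2)]
      morphism_mult[OF assms(1)] morphism_mult[OF assms(2)])

lemma eval_mpoly_morphism:
  fixes c :: "'a::comm_ring_1 \<Rightarrow> 'b::comm_ring_1" and v :: "'x \<Rightarrow> 'b"
  assumes c: "ring_morphism c"
  shows "ring_morphism (eval_mpoly c v)"
proof -
  define M where "M m = (\<Prod>x \<in> keys m. v x ^ lookup m x)" for m
  have M_sup: "M m = (\<Prod>x \<in> S. v x ^ lookup m x)"
    if "finite S" "keys m \<subseteq> S" for m S
    unfolding M_def using that by (intro prod.mono_neutral_left) (auto simp: in_keys_iff)
  have M_add: "M (m + n) = M m * M n" for m n
  proof -
    let ?S = "keys m \<union> keys n"
    have "M (m + n) = (\<Prod>x \<in> ?S. v x ^ lookup (m + n) x)"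
      by (rule M_sup) (auto dest: subsetD[OF keys_add])
    also have "\<dots> = M m * M n"
      by (simp add: lookup_add power_add prod.distrib M_sup[of ?S m] M_sup[of ?S n])
    finally show ?thesis .
  qed
  have ev: "eval_mpoly c v f = (\<Sum>m \<in> S. c (lookup f m) * M m)"
    if "finite S" "keys f \<subseteq> S" for f S
    unfolding eval_mpoly_def M_def[symmetric] using that
    by (intro sum.mono_neutral_left) (auto simp: in_keys_iff morphism_0[OF c])
  have add: "eval_mpoly c v (f + g) = eval_mpoly c v f + eval_mpoly c v g" for f g
  proof -
    let ?S = "keys f \<union> keys g"
    have "eval_mpoly c v (f + g) = (\<Sum>m \<in> ?S. c (lookup (f + g) m) * M m)"
      by (rule ev) (auto dest: subsetD[OF keys_add])
    also have "\<dots> = eval_mpoly c v f + eval_mpoly c v g"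
      by (simp add: lookup_add morphism_add[OF c] algebra_simps sum.distrib ev[of ?S f] ev[of ?S g])
    finally show ?thesis .
  qed
  have zero: "eval_mpoly c v 0 = 0" by (simp add: eval_mpoly_def)
  have sum: "eval_mpoly c v (sum F S) = (\<Sum>x\<in>S. eval_mpoly c v (F x))" for F :: "('x \<Rightarrow>\<^sub>0 nat) \<Rightarrow> _" and S
    by (induction S rule: infinite_finite_induct) (auto simp: zero add)
  have single: "eval_mpoly c v (single m a) = c a * M m" for m a
    by (subst ev[of "{m}"]) auto
  have mult: "eval_mpoly c v (f * g) = eval_mpoly c v f * eval_mpoly c v g" for f g
  proof -
    have "f * g = (\<Sum>m \<in> keys f. \<Sum>n \<in> keys g.
        single (m + n) (lookup f m * lookup g n))"
      by (subst (1) mpoly_eq_sum[of f], subst (1) mpoly_eq_sum[of g])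
        (simp add: sum_product mult_single)
    then have "eval_mpoly c v (f * g) = (\<Sum>m \<in> keys f. \<Sum>n \<in> keys g.
        (c (lookup f m) * M m) * (c (lookup g n) * M n))"
      by (simp add: sum single M_add morphism_mult[OF c] ac_simps)
    also have "\<dots> = eval_mpoly c v f * eval_mpoly c v g"
      by (simp add: sum_product[symmetric] eval_mpoly_def M_def)
    finally show ?thesis .
  qed
  have "eval_mpoly c v 1 = 1"
    using single[of 0 1] by (simp add: morphism_1[OF c] M_def)
  with add mult show ?thesis by (intro ring_morphismI)
qed

lemma eval_mpoly_Const: "ring_morphism c \<Longrightarrow> eval_mpoly c v (Const a) = c a"
  by (cases "a = 0") (simp_all add: eval_mpoly_def Const_def morphism_0)

lemma eval_mpoly_Var: "ring_morphism c \<Longrightarrow> eval_mpoly c v (Var x) = v x"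
  by (simp add: eval_mpoly_def Var_def morphism_1)

lemma ident_morphism: "ring_morphism (\<lambda>x. x)"
  by (simp add: ring_morphism_def)

lemma eval_mpoly_id: "eval_mpoly Const Var f = f"
  by (rule morphism_ext[where h = "eval_mpoly Const Var" and k = "\<lambda>x. x" and D = UNIV])
    (simp_all add: eval_mpoly_morphism Const_morphism eval_mpoly_Const eval_mpoly_Var ident_morphism)


subsection \<open>Renaming variables\<close>

text \<open>The substitution \<open>\<xi>\<^sub>x \<mapsto> \<xi>\<^bsub>\<theta> x\<^esub>\<close>. It covers the action of permutations, the restriction to the
  generic point along \<open>\<pi>\<close>, and the relabelling of the \<open>t\<^sub>\<alpha>\<close>.\<close>

definition rename :: "('x \<Rightarrow> 'y) \<Rightarrow> ('x, 'a::comm_ring_1) mpoly \<Rightarrow> ('y, 'a) mpoly" where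
  "rename \<theta> = eval_mpoly Const (\<lambda>x. Var (\<theta> x))"

lemma perm_act_eq_rename: "perm_act = rename"
  by (simp add: perm_act_def rename_def fun_eq_iff)

lemma rename_morphism [simp]: "ring_morphism (rename \<theta>)"
  unfolding rename_def by (rule eval_mpoly_morphism[OF Const_morphism])

lemma rename_Const [simp]: "rename \<theta> (Const a) = Const a"
  by (simp add: rename_def eval_mpoly_Const Const_morphism)

lemma rename_Var [simp]: "rename \<theta> (Var x) = Var (\<theta> x)"
  by (simp add: rename_def eval_mpoly_Var Const_morphism)

lemmas rename_simps [simp] = morphism_simps[OF rename_morphism]

lemma rename_cong:
  "f \<in> mpolys_in D \<Longrightarrow> (\<And>x. x \<in> D \<Longrightarrow> \<theta> x = \<eta> x) \<Longrightarrow> rename \<theta> f = rename \<eta> f"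
  by (rule morphism_ext[where D = D]) auto

lemma rename_rename: "rename \<theta> (rename \<eta> f) = rename (\<lambda>x. \<theta> (\<eta> x)) f"
  by (rule morphism_ext[where D = UNIV and h = "\<lambda>f. rename \<theta> (rename \<eta> f)"])
    (auto intro: morphism_comp)

lemma rename_ident [simp]: "rename (\<lambda>x. x) f = f"
  unfolding rename_def by (rule eval_mpoly_id)

lemma rename_eq_self: "f \<in> mpolys_in D \<Longrightarrow> (\<And>x. x \<in> D \<Longrightarrow> \<theta> x = x) \<Longrightarrow> rename \<theta> f = f"
  using rename_cong[of f D \<theta> "\<lambda>x. x"] by simp

lemma rename_in: "f \<in> mpolys_in D \<Longrightarrow> rename \<theta> f \<in> mpolys_in (\<theta> ` D)"
  by (induction rule: mpoly_induct) (auto intro: mpolys_in_closed)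

lemma rename_in': "f \<in> mpolys_in D \<Longrightarrow> \<theta> ` D \<subseteq> E \<Longrightarrow> rename \<theta> f \<in> mpolys_in E"
  using rename_in mpolys_in_mono by blast

section \<open>Taylor expansion and the ideal of a weighting\<close>

text \<open>Ideals and prime ideals of a ring that is a type.\<close>

definition ideal_set :: "'b::comm_ring_1 set \<Rightarrow> bool" where
  "ideal_set J \<longleftrightarrow> 0 \<in> J \<and> (\<forall>x\<in>J. \<forall>y\<in>J. x + y \<in> J) \<and> (\<forall>r. \<forall>x\<in>J. r * x \<in> J)"

definition prime_set :: "'b::comm_ring_1 set \<Rightarrow> bool" where
  "prime_set J \<longleftrightarrow> ideal_set J \<and> 1 \<notin> J \<and> (\<forall>x y. x * y \<in> J \<longrightarrow> x \<in> J \<or> y \<in> J)"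

lemma ideal_setI:
  "0 \<in> J \<Longrightarrow> (\<And>x y. x \<in> J \<Longrightarrow> y \<in> J \<Longrightarrow> x + y \<in> J) \<Longrightarrow> (\<And>r x. x \<in> J \<Longrightarrow> r * x \<in> J) \<Longrightarrow> ideal_set J"
  by (simp add: ideal_set_def)

lemma
  assumes "ideal_set J"
  shows ideal_0: "0 \<in> J"
    and ideal_add: "x \<in> J \<Longrightarrow> y \<in> J \<Longrightarrow> x + y \<in> J"
    and ideal_multl: "x \<in> J \<Longrightarrow> r * x \<in> J"
    and ideal_multr: "x \<in> J \<Longrightarrow> x * r \<in> J"
  using assms by (auto simp: ideal_set_def mult.commute)

lemma ideal_minus: "ideal_set J \<Longrightarrow> x \<in> J \<Longrightarrow> - x \<in> J"
  using ideal_multl[of J x "- 1"] by simp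

lemma ideal_diff: "ideal_set J \<Longrightarrow> x \<in> J \<Longrightarrow> y \<in> J \<Longrightarrow> x - y \<in> J"
  unfolding diff_conv_add_uminus by (intro ideal_add ideal_minus)

lemma ideal_sum: "ideal_set J \<Longrightarrow> (\<And>x. x \<in> S \<Longrightarrow> f x \<in> J) \<Longrightarrow> sum f S \<in> J"
  by (induction S rule: infinite_finite_induct) (auto intro: ideal_0 ideal_add)

lemma ideal_cancel: "ideal_set J \<Longrightarrow> x + y \<in> J \<Longrightarrow> x \<in> J \<Longrightarrow> y \<in> J"
  using ideal_diff[of J "x + y" x] by simp

lemma prime_ideal: "prime_set J \<Longrightarrow> ideal_set J"
  and prime_1: "prime_set J \<Longrightarrow> 1 \<notin> J"
  and prime_mult: "prime_set J \<Longrightarrow> x * y \<in> J \<longleftrightarrow> x \<in> J \<or> y \<in> J"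
  by (auto simp: prime_set_def dest: ideal_multl ideal_multr)

lemma prime_power: "prime_set J \<Longrightarrow> x ^ n \<in> J \<Longrightarrow> x \<in> J"
  by (induction n) (auto simp: prime_1 prime_mult)

lemma prime_power_notin: "prime_set J \<Longrightarrow> x \<notin> J \<Longrightarrow> x ^ n \<notin> J"
  using prime_power by blast

lemma prime_prod_notin: "prime_set J \<Longrightarrow> (\<And>x. x \<in> S \<Longrightarrow> f x \<notin> J) \<Longrightarrow> prod f S \<notin> J"
  by (induction S rule: infinite_finite_induct) (auto simp: prime_1 prime_mult)

lemma prime_set_vimage:
  assumes "prime_set J" "ring_morphism h"
  shows "prime_set {x. h x \<in> J}"
  using assms unfolding prime_set_def ideal_set_def
  by (simp add: morphism_simps)

lemma lookup_mult_sum: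
  "lookup (F * G) m = (\<Sum>a \<in> keys F. \<Sum>b \<in> keys G.
     lookup F a * lookup G b when a + b = m)"
proof -
  have "F * G = (\<Sum>a \<in> keys F. \<Sum>b \<in> keys G.
      single (a + b) (lookup F a * lookup G b))"
    by (subst (1) mpoly_eq_sum[of F], subst (1) mpoly_eq_sum[of G]) (simp add: sum_product mult_single)
  then show ?thesis by (simp add: lookup_sum lookup_single)
qed

lemma lookup_mult_Const: "lookup (F * Const c) m = lookup F m * c"
proof (cases "c = 0")
  case False
  then have "lookup (F * Const c) m =
      (\<Sum>a \<in> keys F. lookup F a * c when a = m)"
    by (simp add: lookup_mult_sum Const_def)
  also have "\<dots> = lookup F m * c"
    by (auto simp: when_def in_keys_iff sum.delta)
  finally show ?thesis .
qed simp

lemma lookup_mult_Var: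
  fixes F :: "('x, 'b::comm_ring_1) mpoly"
  shows "lookup (F * Var x) m = 0 \<or>
    (\<exists>m'. lookup (F * Var x) m = lookup F m')"
proof (cases "\<exists>q. m = single x 1 + q")
  case True
  then show ?thesis by (metis lookup_Var_mult mult.commute)
next
  case False
  then show ?thesis using lookup_Var_mult_eq_0[of m x F] by (auto simp: mult.commute)
qed

lemma Var_power: "Var x ^ n = (single (single x n) 1 :: ('x, 'b::comm_ring_1) mpoly)"
  by (induction n) (simp_all add: Var_def mult_single single_add[symmetric])

text \<open>The constant term is evaluation at \<open>0\<close>, hence multiplicative.\<close>

lemma lookup_0_eq_eval:
  fixes F :: "('x, 'b::comm_ring_1) mpoly"
  shows "lookup F 0 = eval_mpoly (\<lambda>a. a) (\<lambda>_. 0) F"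
proof -
  have "(\<Prod>x\<in>keys m. 0 ^ lookup m x) = (0 :: 'b)" if "m \<noteq> 0" for m :: "'x \<Rightarrow>\<^sub>0 nat"
  proof -
    have "keys m \<noteq> {}" using that by auto
    then obtain x where "x \<in> keys m" by blast
    then show ?thesis by (intro prod_zero) (auto simp: in_keys_iff zero_power intro!: bexI[of _ x])
  qed
  then have "eval_mpoly (\<lambda>a. a) (\<lambda>_. 0) F =
      (\<Sum>m \<in> keys F. if m = 0 then lookup F m else 0)"
    unfolding eval_mpoly_def by (intro sum.cong) auto
  also have "\<dots> = lookup F 0"
    by (auto simp: in_keys_iff sum.delta)
  finally show ?thesis ..
qed

lemma lookup_0_morphism: "ring_morphism (\<lambda>F :: ('x, 'b::comm_ring_1) mpoly. lookup F 0)"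
  unfolding lookup_0_eq_eval by (rule eval_mpoly_morphism[OF ident_morphism])


subsection \<open>Taylor expansion\<close>

text \<open>Expansion of \<open>f\<close> at the point whose \<open>x\<close>-th coordinate is \<open>t\<^bsub>\<theta> x\<^esub>\<close>: the variable \<open>x\<close> is replaced
  by \<open>t\<^bsub>\<theta> x\<^esub> + \<epsilon>\<^sub>x\<close>.\<close>

definition taylor :: "('x \<Rightarrow> 'i) \<Rightarrow> ('x, 'a::comm_ring_1) mpoly \<Rightarrow> ('x, ('i, 'a) mpoly) mpoly" where
  "taylor \<theta> = eval_mpoly (\<lambda>a. Const (Const a)) (\<lambda>x. Const (Var (\<theta> x)) + Var x)"

lemma Const_Const_morphism: "ring_morphism (\<lambda>a. Const (Const a))"
  by (rule morphism_comp[OF Const_morphism Const_morphism])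

lemma taylor_morphism: "ring_morphism (taylor \<theta>)"
  unfolding taylor_def by (rule eval_mpoly_morphism[OF Const_Const_morphism])

lemma taylor_Const [simp]: "taylor \<theta> (Const a) = Const (Const a)"
  by (simp add: taylor_def eval_mpoly_Const Const_Const_morphism)

lemma taylor_Var [simp]: "taylor \<theta> (Var x) = Const (Var (\<theta> x)) + Var x"
  by (simp add: taylor_def eval_mpoly_Var Const_Const_morphism)

lemmas taylor_simps [simp] = morphism_simps[OF taylor_morphism]

lemma lookup_Var_0 [simp]: "lookup (Var x :: ('x, 'b::comm_ring_1) mpoly) 0 = 0"
proof -
  have "single x (1::nat) \<noteq> 0" by (metis lookup_single_eq lookup_zero zero_neq_one)
  then show ?thesis by (simp add: Var_def lookup_single)
qed

lemma lookup_Const: "lookup (Const c) m = (c when m = 0)"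
  by (simp add: Const_def lookup_single when_def)

lemma lookup_Const_0 [simp]: "lookup (Const c) 0 = c"
  by (simp add: Const_def)

lemma lookup_0_taylor: "lookup (taylor \<theta> f) 0 = rename \<theta> f"
  by (rule morphism_ext[where h = "\<lambda>f. lookup (taylor \<theta> f) 0" and D = UNIV])
    (simp_all add: morphism_comp[OF lookup_0_morphism taylor_morphism] lookup_add)

text \<open>Substituting \<open>t\<^sub>\<alpha> = \<xi>\<^bsub>b \<alpha>\<^esub>\<close> and \<open>\<epsilon>\<^sub>x = \<xi>\<^sub>x - \<xi>\<^bsub>b (\<theta> x)\<^esub>\<close> gives back \<open>f\<close>: the expansion of \<open>f\<close> around
  variables that represent the blocks.\<close>

lemma taylor_formula:
  "f = (\<Sum>m \<in> keys (taylor \<theta> f). rename b (lookup (taylor \<theta> f) m) *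
      (\<Prod>x \<in> keys m. (Var x - Var (b (\<theta> x))) ^ lookup m x))"
proof -
  have "eval_mpoly (rename b) (\<lambda>x. Var x - Var (b (\<theta> x))) (taylor \<theta> f) = f"
    by (rule morphism_ext[where k = "\<lambda>f. f" and D = UNIV])
      (simp_all add: morphism_comp[OF eval_mpoly_morphism taylor_morphism] ident_morphism
        eval_mpoly_Const eval_mpoly_Var morphism_add[OF eval_mpoly_morphism])
  then show ?thesis by (simp add: eval_mpoly_def)
qed

lemma taylor_in: "f \<in> mpolys_in D \<Longrightarrow> taylor \<theta> f \<in> mpolys_in D"
  by (induction rule: mpoly_induct) (auto intro: mpolys_in_closed)

lemma taylor_rename: "taylor \<pi> (rename \<sigma> f) = rename \<sigma> (taylor (\<lambda>x. \<pi> (\<sigma> x)) f)"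
  by (rule morphism_ext[where D = UNIV and h = "\<lambda>f. taylor \<pi> (rename \<sigma> f)"])
    (simp_all add: morphism_comp taylor_morphism)

lemma lookup_taylor_mult_Var:
  "lookup (taylor \<theta> (f * Var x)) m =
    lookup (taylor \<theta> f) m * Var (\<theta> x) + lookup (taylor \<theta> f * Var x) m"
  by (simp add: distrib_left lookup_add lookup_mult_Const)

lemma lookup_taylor_in: "lookup (taylor \<theta> f) m \<in> mpolys_in (range \<theta>)"
proof -
  have "f \<in> mpolys_in UNIV" by simp
  then show ?thesis
  proof (induction arbitrary: m rule: mpoly_induct)
    case (Const a)
    have "lookup (taylor \<theta> (Const a)) m \<in> {Const a, 0}"
      by (simp add: lookup_Const when_def)
    then show ?case by (auto simp: mpolys_in_closed)
  next
    case (add f g)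
    then show ?case by (simp add: lookup_add mpolys_in_closed)
  next
    case (mult f x)
    have "lookup (taylor \<theta> f * Var x) m \<in> mpolys_in (range \<theta>)"
      using lookup_mult_Var[of "taylor \<theta> f" x m] mult.IH by (auto simp: mpolys_in_closed)
    with mult.IH[of m] show ?case
      unfolding lookup_taylor_mult_Var by (intro mpolys_in_closed) auto
  qed
qed

text \<open>Over all permutations of the variables, only finitely many Taylor coefficients occur.\<close>

lemma finite_taylor_coefficients:
  fixes f :: "('x, 'a::comm_ring_1) mpoly" and \<pi> :: "'x \<Rightarrow> 'i"
  assumes "finite (range \<pi>)"
  shows "finite {lookup (taylor \<pi> (rename \<sigma> f)) m | \<sigma> m. True}"
proof -
  define C where "C f = insert 0 {lookup (taylor \<pi> (rename \<sigma> f)) m | \<sigma> m. True}"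
    for f :: "('x, 'a) mpoly"
  have "f \<in> mpolys_in UNIV" by simp
  then have "finite (C f)"
  proof (induction rule: mpoly_induct)
    case (Const a)
    have "C (Const a) \<subseteq> {0, Const a}"
      by (auto simp: C_def lookup_Const when_def)
    then show ?case by (rule finite_subset) simp
  next
    case (add f g)
    have "C (f + g) \<subseteq> (\<lambda>(x, y). x + y) ` (C f \<times> C g)"
    proof
      fix c assume "c \<in> C (f + g)"
      then consider "c = 0" | \<sigma> m where "c = lookup (taylor \<pi> (rename \<sigma> f)) m + lookup (taylor \<pi> (rename \<sigma> g)) m"
        by (auto simp: C_def lookup_add)
      then show "c \<in> (\<lambda>(x, y). x + y) ` (C f \<times> C g)"
      proof cases
        case 1
        then show ?thesis by (intro image_eqI[of _ _ "(0, 0)"]) (auto simp: C_def)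
      next
        case 2
        then show ?thesis
          by (intro image_eqI[of _ _ "(lookup (taylor \<pi> (rename \<sigma> f)) m,
            lookup (taylor \<pi> (rename \<sigma> g)) m)"]) (auto simp: C_def)
      qed
    qed
    then show ?case by (rule finite_subset) (use add.IH in auto)
  next
    case (mult f x)
    have "C (f * Var x) \<subseteq> (\<lambda>(u, v, w). u * v + w) ` (C f \<times> Var ` range \<pi> \<times> C f)"
    proof
      fix c assume "c \<in> C (f * Var x)"
      then consider "c = 0" | \<sigma> m where "c = lookup (taylor \<pi> (rename \<sigma> f * Var (\<sigma> x))) m"
        by (auto simp: C_def)
      then show "c \<in> (\<lambda>(u, v, w). u * v + w) ` (C f \<times> Var ` range \<pi> \<times> C f)"
      proof cases
        case 1
        then show ?thesis by (intro image_eqI[of _ _ "(0, Var (\<pi> x), 0)"]) (auto simp: C_def)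
      next
        case 2
        have "lookup (taylor \<pi> (rename \<sigma> f) * Var (\<sigma> x)) m \<in> C f"
          using lookup_mult_Var[of "taylor \<pi> (rename \<sigma> f)" "\<sigma> x" m] by (auto simp: C_def)
        with 2 show ?thesis
          unfolding lookup_taylor_mult_Var
          by (intro image_eqI[of _ _ "(lookup (taylor \<pi> (rename \<sigma> f)) m, Var (\<pi> (\<sigma> x)),
            lookup (taylor \<pi> (rename \<sigma> f) * Var (\<sigma> x)) m)"]) (auto simp: C_def)
      qed
    qed
    then show ?case by (rule finite_subset) (use mult.IH assms in auto)
  qed
  then show ?thesis by (auto simp: C_def)
qed


subsection \<open>The ideal generated by a prime and powers of the variables\<close>

text \<open>The ideal generated by the constants in \<open>q\<close> and the powers \<open>\<epsilon>\<^sub>x\<^bsup>E x\<^esup>\<close>, described by coefficients.\<close>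

definition Qset :: "('x \<Rightarrow> nat) \<Rightarrow> 'b::comm_ring_1 set \<Rightarrow> ('x, 'b) mpoly set" where
  "Qset E q = {F. \<forall>m. (\<forall>x. lookup m x < E x) \<longrightarrow> lookup F m \<in> q}"

lemma QsetD: "F \<in> Qset E q \<Longrightarrow> (\<And>x. lookup m x < E x) \<Longrightarrow> lookup F m \<in> q"
  by (simp add: Qset_def)

lemma Qset_ideal:
  assumes q: "ideal_set q"
  shows "ideal_set (Qset E q)"
proof (rule ideal_setI)
  show "0 \<in> Qset E q" using q by (simp add: Qset_def ideal_0)
  show "F + G \<in> Qset E q" if "F \<in> Qset E q" "G \<in> Qset E q" for F G
    using that q by (simp add: Qset_def lookup_add ideal_add)
  show "F * G \<in> Qset E q" if G: "G \<in> Qset E q" for F G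
    unfolding Qset_def
  proof safe
    fix m assume m: "\<forall>x. lookup m x < E x"
    have "lookup F a * lookup G b \<in> q" if "a + b = m" for a b
    proof (rule ideal_multl[OF q], rule QsetD[OF G])
      fix x show "lookup b x < E x"
        using m[rule_format, of x] that by (auto simp: lookup_add)
    qed
    then show "lookup (F * G) m \<in> q"
      unfolding lookup_mult_sum by (intro ideal_sum[OF q]) (auto simp: when_def ideal_0[OF q])
  qed
qed

lemma Const_in_Qset: "ideal_set q \<Longrightarrow> c \<in> q \<Longrightarrow> Const c \<in> Qset E q"
  by (auto simp: Qset_def Const_def lookup_single when_def ideal_0)

lemma Var_power_in_Qset:
  assumes "ideal_set q" "E x \<le> n"
  shows "Var x ^ n \<in> Qset E q"
  unfolding Qset_def
proof safe
  fix m assume m: "\<forall>y. lookup m y < E y"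
  have "m \<noteq> single x n"
    using m[rule_format, of x] assms(2) by auto
  then show "lookup (Var x ^ n) m \<in> q"
    using assms(1) by (simp add: Var_power lookup_single when_def ideal_0)
qed

lemma Qset_least:
  assumes J: "ideal_set J" and q: "\<And>c. c \<in> q \<Longrightarrow> Const c \<in> J" and E: "\<And>x. Var x ^ E x \<in> J"
    and F: "F \<in> Qset E q"
  shows "F \<in> J"
proof -
  have "F = eval_mpoly Const Var F" by (simp add: eval_mpoly_id)
  also have "\<dots> = (\<Sum>m \<in> keys F. Const (lookup F m) *
        (\<Prod>x \<in> keys m. Var x ^ lookup m x))"
    by (simp add: eval_mpoly_def)
  also have "\<dots> \<in> J"
  proof (rule ideal_sum[OF J])
    fix m
    show "Const (lookup F m) * (\<Prod>x \<in> keys m. Var x ^ lookup m x) \<in> J"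
    proof (cases "\<forall>x. lookup m x < E x")
      case True
      then show ?thesis using QsetD[OF F, of m] by (intro ideal_multr[OF J] q) auto
    next
      case False
      then obtain x where x: "E x \<le> lookup m x" by (meson not_le)
      have "Var x ^ lookup m x \<in> J"
        using ideal_multr[OF J E[of x], of "Var x ^ (lookup m x - E x)"] x
        by (simp add: power_add[symmetric])
      moreover have "(\<Prod>x \<in> keys m. Var x ^ lookup m x) =
          (\<Prod>y \<in> insert x (keys m). Var y ^ lookup m y :: ('a, 'b) mpoly)"
        by (rule prod.mono_neutral_left) (auto simp: in_keys_iff)
      ultimately have "(\<Prod>x \<in> keys m. Var x ^ lookup m x) \<in> J"
        by (simp add: prod.insert_remove ideal_multr[OF J])
      then show ?thesis by (rule ideal_multl[OF J])
    qed
  qed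
  finally show ?thesis .
qed

lemma Qset_rename:
  assumes q: "ideal_set q" and E: "\<And>x. E (\<theta> x) = E x" and F: "F \<in> Qset E q"
  shows "rename \<theta> F \<in> Qset E q"
proof -
  have "F \<in> {F. rename \<theta> F \<in> Qset E q}"
  proof (rule Qset_least[OF _ _ _ F])
    show "ideal_set {F. rename \<theta> F \<in> Qset E q}"
      using Qset_ideal[OF q, of E] by (simp add: ideal_set_def)
    show "Const c \<in> {F. rename \<theta> F \<in> Qset E q}" if "c \<in> q" for c
      using that by (simp add: Const_in_Qset[OF q])
    show "Var x ^ E x \<in> {F. rename \<theta> F \<in> Qset E q}" for x
      using E[of x] by (simp add: Var_power_in_Qset[OF q])
  qed
  then show ?thesis by simp
qed

text \<open>This ideal is primary when \<open>q\<close> is prime.\<close>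

lemma Qset_primary:
  assumes q: "prime_set q" and F: "lookup F 0 \<notin> q" and FG: "F * G \<in> Qset E q"
  shows "G \<in> Qset E q"
proof (rule ccontr)
  note iq = prime_ideal[OF q]
  define B where "B m \<longleftrightarrow> (\<forall>x. lookup m x < E x) \<and> lookup G m \<notin> q" for m
  assume "G \<notin> Qset E q"
  then have "\<exists>m. B m" by (auto simp: Qset_def B_def)
  then obtain m where m: "B m" and min: "\<And>m'. mdeg m' < mdeg m \<Longrightarrow> \<not> B m'"
    using ex_has_least_nat[of B _ mdeg] by (metis not_le)
  \<comment> \<open>modulo \<open>q\<close>, only the constant term of \<open>F\<close> contributes to the coefficient at \<open>m\<close>\<close>
  have "m \<in> keys G" "0 \<in> keys F"
    using m F ideal_0[OF iq] by (auto simp: B_def in_keys_iff)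
  have "lookup (F * G) m \<in> q" using m by (intro QsetD[OF FG]) (auto simp: B_def)
  moreover have "lookup (F * G) m =
      (\<Sum>b \<in> keys G. lookup F 0 * lookup G b when 0 + b = m) +
      (\<Sum>a \<in> keys F - {0}. \<Sum>b \<in> keys G.
        lookup F a * lookup G b when a + b = m)"
    unfolding lookup_mult_sum using \<open>0 \<in> keys F\<close> by (subst sum.remove[of _ 0]) auto
  moreover have "(\<Sum>b \<in> keys G. lookup F 0 * lookup G b when 0 + b = m)
      = lookup F 0 * lookup G m"
    using \<open>m \<in> keys G\<close> by (simp add: when_def sum.delta)
  moreover have "(\<Sum>a \<in> keys F - {0}. \<Sum>b \<in> keys G.
        lookup F a * lookup G b when a + b = m) \<in> q"
  proof (intro ideal_sum[OF iq])
    fix a b assume a: "a \<in> keys F - {0}"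
    have "lookup G b \<in> q" if "a + b = m"
    proof -
      have "mdeg b < mdeg m" using a by (simp add: that[symmetric] mdeg_add) (metis mdeg_eq_0 neq0_conv)
      then have "\<not> B b" by (rule min)
      moreover have "lookup b x < E x" for x
        using m that[symmetric] by (auto simp: B_def lookup_add dest: spec[of _ x])
      ultimately show ?thesis by (auto simp: B_def)
    qed
    then show "(lookup F a * lookup G b when a + b = m) \<in> q"
      by (auto simp: when_def ideal_0[OF iq] intro: ideal_multl[OF iq])
  qed
  ultimately have "lookup F 0 * lookup G m \<in> q"
    using ideal_diff[OF iq] by fastforce
  with F m show False by (auto simp: prime_mult[OF q] B_def)
qed

text \<open>The exponent depends on \<open>F\<close> only through the number of its variables, so it can be chosen uniformly
  for all translates of a polynomial.\<close>

lemma Qset_nilpotent: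
  fixes F :: "('a, 'b::comm_ring_1) mpoly"
  assumes q: "ideal_set q" and F: "F \<in> mpolys_in D" "lookup F 0 \<in> q"
    and D: "finite D" and E: "\<And>x. E x \<le> M"
  shows "F ^ Suc (card D * M) \<in> Qset E q"
proof -
  \<comment> \<open>\<open>O' k\<close>: modulo \<open>q\<close> there are no terms of degree less than \<open>k\<close>\<close>
  define O' where "O' k = {F :: ('a, 'b) mpoly. \<forall>m. mdeg m < k \<longrightarrow> lookup F m \<in> q}" for k
  have mult: "G * H \<in> O' (k + l)" if G: "G \<in> O' k" and H: "H \<in> O' l" for G H :: "('a, 'b) mpoly" and k l
    unfolding O'_def
  proof safe
    fix m :: "'a \<Rightarrow>\<^sub>0 nat" assume m: "mdeg m < k + l"
    have "lookup G a * lookup H b \<in> q" if "a + b = m" for a b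
    proof -
      have "mdeg a < k \<or> mdeg b < l" using m that[symmetric] by (auto simp: mdeg_add)
      then show ?thesis using G H by (auto simp: O'_def intro: ideal_multl[OF q] ideal_multr[OF q])
    qed
    then show "lookup (G * H) m \<in> q"
      unfolding lookup_mult_sum by (intro ideal_sum[OF q]) (auto simp: when_def ideal_0[OF q])
  qed
  have 1: "F \<in> O' 1" using F(2) by (auto simp: O'_def mdeg_eq_0)
  have pow: "F ^ n \<in> O' n" for n
  proof (induction n)
    case (Suc n)
    show ?case using mult[OF 1 Suc.IH] by simp
  qed (simp add: O'_def)
  show ?thesis
    unfolding Qset_def
  proof safe
    fix m assume m: "\<forall>x. lookup m x < E x"
    show "lookup (F ^ Suc (card D * M)) m \<in> q"
    proof (cases "m \<in> keys (F ^ Suc (card D * M))")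
      case True
      then have "keys m \<subseteq> D"
        using mpolys_in_power[OF F(1), of "Suc (card D * M)"] by (auto simp: mpolys_in_def)
      then have "mdeg m = (\<Sum>x\<in>D. lookup m x)" by (rule mdeg_superset[OF D])
      also have "\<dots> \<le> (\<Sum>x\<in>D. M)"
        by (rule sum_mono) (meson E m le_trans less_imp_le)
      finally have "mdeg m < Suc (card D * M)" by simp
      then show ?thesis using pow[of "Suc (card D * M)"] unfolding O'_def by blast
    next
      case False
      then show ?thesis by (simp add: in_keys_iff ideal_0[OF q])
    qed
  qed
qed

section \<open>Finitary permutations\<close>

lemma finitary_perms_iff: "\<sigma> \<in> finitary_perms \<longleftrightarrow> bij \<sigma> \<and> finite {i. \<sigma> i \<noteq> i}"
proof
  assume "\<sigma> \<in> finitary_perms"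
  then obtain n where n: "\<sigma> permutes {..<n}" by (auto simp: finitary_perms_def)
  have "{i. \<sigma> i \<noteq> i} \<subseteq> {..<n}" using n by (auto simp: permutes_def)
  then show "bij \<sigma> \<and> finite {i. \<sigma> i \<noteq> i}"
    using permutes_bij[OF n] by (auto intro: finite_subset)
next
  assume *: "bij \<sigma> \<and> finite {i. \<sigma> i \<noteq> i}"
  then obtain n where "{i. \<sigma> i \<noteq> i} \<subseteq> {..<n}" by (meson finite_nat_iff_bounded)
  then have "\<sigma> permutes {..<n}"
    using * unfolding permutes_def bij_iff by blast
  then show "\<sigma> \<in> finitary_perms" by (auto simp: finitary_perms_def)
qed

lemma finitary_bij: "\<sigma> \<in> finitary_perms \<Longrightarrow> bij \<sigma>"
  by (simp add: finitary_perms_iff)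

lemma finitary_inj: "\<sigma> \<in> finitary_perms \<Longrightarrow> inj \<sigma>"
  by (simp add: finitary_bij bij_is_inj)

lemma finitary_id [simp]: "(\<lambda>i. i) \<in> finitary_perms"
  by (simp add: finitary_perms_iff bij_id[unfolded id_def])

lemma finitary_comp:
  assumes "\<sigma> \<in> finitary_perms" "\<tau> \<in> finitary_perms"
  shows "(\<lambda>i. \<sigma> (\<tau> i)) \<in> finitary_perms"
proof -
  have "{i. \<sigma> (\<tau> i) \<noteq> i} \<subseteq> {i. \<sigma> i \<noteq> i} \<union> {i. \<tau> i \<noteq> i}" by auto
  then show ?thesis
    using assms bij_comp[of \<tau> \<sigma>] by (auto simp: finitary_perms_iff comp_def intro: finite_subset)
qed

lemma finitary_inv:
  assumes "\<sigma> \<in> finitary_perms"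
  shows "inv_into UNIV \<sigma> \<in> finitary_perms"
proof -
  have "{i. inv_into UNIV \<sigma> i \<noteq> i} \<subseteq> {i. \<sigma> i \<noteq> i}"
    using finitary_bij[OF assms] by (auto simp: bij_inv_eq_iff) (metis bij_inv_eq_iff)
  then show ?thesis
    using assms by (auto simp: finitary_perms_iff bij_imp_bij_inv intro: finite_subset)
qed

lemma finitary_inv_cancel:
  assumes "\<sigma> \<in> finitary_perms"
  shows "\<sigma> (inv_into UNIV \<sigma> i) = i" "inv_into UNIV \<sigma> (\<sigma> i) = i"
  using finitary_bij[OF assms] by (simp_all add: bij_is_surj surj_f_inv_f bij_is_inj)

lemma finitary_transpose: "transpose i j \<in> finitary_perms" for i j :: nat
proof -
  have "{k. transpose i j k \<noteq> k} \<subseteq> {i, j}" by (auto simp: transpose_def)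
  then show ?thesis by (auto simp: finitary_perms_iff intro: finite_subset)
qed

lemma finitary_extension:
  fixes kap :: "nat \<Rightarrow> nat"
  assumes W: "finite W" and kap: "inj_on kap W"
  obtains \<sigma> where "\<sigma> \<in> finitary_perms" "\<And>x. x \<in> W \<Longrightarrow> \<sigma> x = kap x"
proof -
  let ?Y = "W \<union> kap ` W"
  have "card (?Y - W) = card (?Y - kap ` W)"
    using W by (simp add: card_Diff_subset card_image[OF kap])
  then obtain h where h: "bij_betw h (?Y - W) (?Y - kap ` W)"
    using W finite_same_card_bij[of "?Y - W" "?Y - kap ` W"] by auto
  define \<sigma> where "\<sigma> = (\<lambda>x. if x \<in> W then kap x else if x \<in> ?Y then h x else x)"
  have "bij_betw \<sigma> W (kap ` W)"
    using kap by (auto simp: \<sigma>_def bij_betw_def inj_on_def)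
  moreover have "bij_betw \<sigma> (?Y - W) (?Y - kap ` W)"
    using h by (rule bij_betw_cong[THEN iffD1, rotated]) (auto simp: \<sigma>_def)
  ultimately have "bij_betw \<sigma> (W \<union> (?Y - W)) (kap ` W \<union> (?Y - kap ` W))"
    by (rule bij_betw_combine) auto
  moreover have "W \<union> (?Y - W) = ?Y" "kap ` W \<union> (?Y - kap ` W) = ?Y" by auto
  ultimately have "bij_betw \<sigma> ?Y ?Y" by simp
  then have "\<sigma> permutes ?Y" by (rule bij_imp_permutes) (auto simp: \<sigma>_def)
  moreover from this have "bij \<sigma>" by (rule permutes_bij)
  ultimately have "bij \<sigma>" "{i. \<sigma> i \<noteq> i} \<subseteq> ?Y" by (auto simp: permutes_def)
  then have "\<sigma> \<in> finitary_perms" using W by (auto simp: finitary_perms_iff intro: finite_subset)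
  then show ?thesis by (rule that) (simp add: \<sigma>_def)
qed

lemma permutes_funpow: "\<phi> permutes I \<Longrightarrow> \<phi> ^^ n permutes I"
  by (induction n) (auto simp: permutes_id intro: permutes_compose)

lemma permutes_finite_order:
  assumes \<phi>: "\<phi> permutes I" and I: "finite I"
  shows "\<exists>k>0. \<phi> ^^ k = id"
proof -
  have p: "\<phi> ^^ n permutes I" for n by (rule permutes_funpow[OF \<phi>])
  have "finite (range (\<lambda>n. \<phi> ^^ n))"
    by (rule finite_subset[OF _ finite_permutations[OF I]]) (use p in auto)
  then have "\<not> inj (\<lambda>n. \<phi> ^^ n)" using finite_imageD infinite_UNIV_nat by blast
  then obtain i j where ij: "i < j" "\<phi> ^^ i = \<phi> ^^ j"
    by (metis (mono_tags, lifting) injI linorder_neqE_nat)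
  have "\<phi> ^^ (i + (j - i)) = \<phi> ^^ i" using ij by simp
  then have "\<phi> ^^ i \<circ> \<phi> ^^ (j - i) = \<phi> ^^ i \<circ> id" by (simp add: funpow_add)
  then have "\<phi> ^^ (j - i) = id"
    using permutes_inj[OF p[of i]] by (metis fun.inj_map injD)
  then show ?thesis using ij(1) by (intro exI[of _ "j - i"]) auto
qed


section \<open>Generic points\<close>

text \<open>A partition of the variables into blocks, given by \<open>\<pi>\<close>, together with a prime \<open>q\<close> that does not
  contain the differences \<open>t\<^sub>\<alpha> - t\<^sub>\<beta>\<close>.\<close>

locale config =
  fixes I :: "'i set" and \<pi> :: "nat \<Rightarrow> 'i" and q :: "('i, 'a::comm_ring_1) mpoly set"
  assumes finite_I: "finite I" and range_pi: "range \<pi> = I" and prime_q: "prime_set q"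
    and diff_notin_q: "\<alpha> \<in> I \<Longrightarrow> \<beta> \<in> I \<Longrightarrow> \<alpha> \<noteq> \<beta> \<Longrightarrow> Var \<alpha> - Var \<beta> \<notin> q"
begin

lemma pi_in [simp]: "\<pi> j \<in> I"
  using range_pi by auto

text \<open>A variable chosen from each block.\<close>

definition base :: "'i \<Rightarrow> nat" where "base = inv_into UNIV \<pi>"

lemma pi_base [simp]: "\<alpha> \<in> I \<Longrightarrow> \<pi> (base \<alpha>) = \<alpha>"
  using range_pi by (simp add: base_def f_inv_into_f)

lemmas ideal_q = prime_ideal[OF prime_q]

lemma transpose_pi: "\<pi> i = \<pi> j \<Longrightarrow> \<pi> (transpose i j k) = \<pi> k"
  by (auto simp: transpose_def)

text \<open>The prime ideal of the generic point: the kernel of \<open>\<xi>\<^sub>i \<mapsto> t\<^bsub>\<pi> i\<^esub>\<close> modulo \<open>q\<close>.\<close>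

definition point :: "(nat, 'a) mpoly set" where
  "point = {f. rename \<pi> f \<in> q}"

lemma prime_point: "prime_set point"
  unfolding point_def by (rule prime_set_vimage[OF prime_q]) simp

lemmas ideal_point = prime_ideal[OF prime_point]

text \<open>The variables in finite blocks, and the infinite blocks.\<close>

definition fin_part :: "nat set" where
  "fin_part = {j. finite (\<pi> -` {\<pi> j})}"

definition inf_blocks :: "'i set" where
  "inf_blocks = {\<alpha> \<in> I. infinite (\<pi> -` {\<alpha>})}"

lemma finite_fin_part: "finite fin_part"
proof -
  have "fin_part = (\<Union>\<alpha> \<in> I - inf_blocks. \<pi> -` {\<alpha>})"
    by (auto simp: fin_part_def inf_blocks_def)
  then show ?thesis using finite_I by (auto simp: inf_blocks_def)
qed

lemma inf_blocks_subset: "inf_blocks \<subseteq> I" and finite_inf_blocks: "finite inf_blocks"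
  using finite_I by (auto simp: inf_blocks_def)

lemma notin_fin_part: "j \<notin> fin_part \<longleftrightarrow> \<pi> j \<in> inf_blocks"
  by (simp add: fin_part_def inf_blocks_def)

text \<open>The difference between a variable and the chosen variable of its block.\<close>

definition eps :: "nat \<Rightarrow> (nat, 'a) mpoly" where
  "eps j = Var j - Var (base (\<pi> j))"

lemma eps_in_point: "eps j \<in> point"
  by (simp add: eps_def point_def ideal_0[OF ideal_q])

lemma rename_base_in_point: "h \<in> mpolys_in I \<Longrightarrow> rename base h \<in> point \<longleftrightarrow> h \<in> q"
  by (simp add: point_def rename_rename rename_eq_self[of h I])

lemma Var_diff_in_point: "Var i - Var j \<in> point \<longleftrightarrow> \<pi> i = \<pi> j"
  using diff_notin_q[of "\<pi> i" "\<pi> j"] by (auto simp: point_def ideal_0[OF ideal_q])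

lemma rename_pi_in: "rename \<pi> f \<in> mpolys_in I"
  using rename_in[of f UNIV \<pi>] by (simp add: range_pi)

lemma point_stable: "(\<And>i. \<pi> (\<sigma> i) = \<pi> i) \<Longrightarrow> rename \<sigma> f \<in> point \<longleftrightarrow> f \<in> point"
  by (simp add: point_def rename_rename)

text \<open>An element outside \<open>q\<close> whose image under a permutation of the index set lies in \<open>q\<close> unless the
  permutation preserves \<open>q\<close>.\<close>

lemma separating_element:
  "\<exists>g \<in> mpolys_in I. g \<notin> q \<and> (\<forall>\<phi>. \<phi> permutes I \<longrightarrow> rename \<phi> g \<notin> q \<longrightarrow>
     (\<forall>h \<in> mpolys_in I. h \<in> q \<longrightarrow> rename \<phi> h \<in> q))"
proof -
  define bad where "bad = {\<phi>. \<phi> permutes I \<and> \<not> (\<forall>h \<in> mpolys_in I. h \<in> q \<longrightarrow> rename \<phi> h \<in> q)}"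
  \<comment> \<open>if \<open>h\<close> lies in \<open>q\<close> but \<open>\<phi>(h)\<close> does not, the orbit of \<open>h\<close> leaves and reenters \<open>q\<close>, as \<open>\<phi>\<close> has finite order\<close>
  have "\<exists>g. g \<in> mpolys_in I \<and> g \<notin> q \<and> rename \<phi> g \<in> q" if bad: "\<phi> \<in> bad" for \<phi>
  proof (rule ccontr)
    assume no: "\<not> ?thesis"
    from bad obtain h where h: "h \<in> mpolys_in I" "h \<in> q" "rename \<phi> h \<notin> q" and \<phi>: "\<phi> permutes I"
      by (auto simp: bad_def)
    from permutes_finite_order[OF \<phi> finite_I] obtain k where k: "k > 0" "\<phi> ^^ k = id" by auto
    have in_I: "rename (\<phi> ^^ n) h \<in> mpolys_in I" for n
      using rename_in[OF h(1), of "\<phi> ^^ n"] permutes_image[OF permutes_funpow[OF \<phi>]] by simp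
    have "rename (\<phi> ^^ Suc n) h \<notin> q" for n
    proof (induction n)
      case (Suc n)
      then have "rename \<phi> (rename (\<phi> ^^ Suc n) h) \<notin> q" using no in_I by blast
      then show ?case by (simp add: rename_rename comp_def)
    qed (use h in simp)
    from this[of "k - 1"] have "rename (\<phi> ^^ k) h \<notin> q" using k(1) by simp
    then show False using h(2) k(2) by (simp add: id_def)
  qed
  then obtain g where g: "\<And>\<phi>. \<phi> \<in> bad \<Longrightarrow> g \<phi> \<in> mpolys_in I \<and> g \<phi> \<notin> q \<and> rename \<phi> (g \<phi>) \<in> q"
    by metis
  have fin: "finite bad"
    by (rule finite_subset[OF _ finite_permutations[OF finite_I]]) (auto simp: bad_def)
  have "rename \<phi> (prod g bad) \<in> q" if "\<phi> \<in> bad" for \<phi>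
    using that fin g[OF that] by (simp add: prod.remove[OF fin that] ideal_multr[OF ideal_q])
  moreover have "prod g bad \<notin> q" using g by (intro prime_prod_notin[OF prime_q]) auto
  moreover have "prod g bad \<in> mpolys_in I" using g by (intro mpolys_in_prod) auto
  ultimately show ?thesis by (intro bexI[of _ "prod g bad"]) (auto simp: bad_def)
qed

text \<open>A finite set of variables is large if it contains the finite blocks and the chosen variables, and meets every
  infinite block in more elements than the finite blocks have together; a permutation that maps blocks to
  blocks on it then cannot mix finite and infinite blocks.\<close>

definition large :: "nat set \<Rightarrow> bool" where
  "large E \<longleftrightarrow> finite E \<and> fin_part \<subseteq> E \<and> base ` I \<subseteq> E \<and>
     (\<forall>\<beta> \<in> inf_blocks. card fin_part < card (E \<inter> \<pi> -` {\<beta>}))"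

lemma ex_large: "finite D \<Longrightarrow> \<exists>E. large E \<and> D \<subseteq> E"
proof -
  assume D: "finite D"
  have "\<exists>A. finite A \<and> card A = Suc (card fin_part) \<and> A \<subseteq> \<pi> -` {\<beta>}" if "\<beta> \<in> inf_blocks" for \<beta>
    using that infinite_arbitrarily_large[of "\<pi> -` {\<beta>}" "Suc (card fin_part)"] by (auto simp: inf_blocks_def)
  then obtain A where A: "\<And>\<beta>. \<beta> \<in> inf_blocks \<Longrightarrow>
      finite (A \<beta>) \<and> card (A \<beta>) = Suc (card fin_part) \<and> A \<beta> \<subseteq> \<pi> -` {\<beta>}" by metis
  define E where "E = D \<union> fin_part \<union> base ` I \<union> (\<Union>\<beta> \<in> inf_blocks. A \<beta>)"
  have fin: "finite E" using D finite_fin_part finite_I finite_inf_blocks A by (auto simp: E_def)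
  have "card fin_part < card (E \<inter> \<pi> -` {\<beta>})" if "\<beta> \<in> inf_blocks" for \<beta>
  proof -
    have "A \<beta> \<subseteq> E \<inter> \<pi> -` {\<beta>}" using A[OF that] that by (auto simp: E_def)
    then have "card (A \<beta>) \<le> card (E \<inter> \<pi> -` {\<beta>})" using fin by (intro card_mono) auto
    then show ?thesis using A[OF that] by simp
  qed
  then have "large E \<and> D \<subseteq> E" using fin by (auto simp: large_def E_def)
  then show ?thesis by blast
qed

text \<open>The element \<open>s\<close> has the following effect: a translate of it that does not vanish at the generic
  point is a translate by a permutation that, on \<open>E\<close>, permutes the blocks by a map preserving \<open>q\<close>, and that
  takes the other variables to the images of infinite blocks.\<close>

lemma rigidifying_element:
  assumes E: "large E"
  obtains s where "s \<in> mpolys_in E" "s \<notin> point"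
    "\<And>\<tau>. inj \<tau> \<Longrightarrow> rename \<tau> s \<notin> point \<Longrightarrow> \<exists>\<phi>. \<phi> permutes I \<and> (\<forall>j\<in>E. \<pi> (\<tau> j) = \<phi> (\<pi> j)) \<and>
        (\<forall>h \<in> mpolys_in I. h \<in> q \<longrightarrow> rename \<phi> h \<in> q) \<and>
        (\<forall>j. j \<notin> E \<longrightarrow> (\<exists>\<beta> \<in> inf_blocks. \<pi> (\<tau> j) = \<phi> \<beta>))"
proof -
  from separating_element obtain g where g: "g \<in> mpolys_in I" "g \<notin> q"
    "\<And>\<phi> h. \<phi> permutes I \<Longrightarrow> rename \<phi> g \<notin> q \<Longrightarrow> h \<in> mpolys_in I \<Longrightarrow> h \<in> q \<Longrightarrow> rename \<phi> h \<in> q"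
    by blast
  define W where "W = {(i, j). i \<in> E \<and> j \<in> E \<and> \<pi> i \<noteq> \<pi> j}"
  have finE: "finite E" and baseE: "base ` I \<subseteq> E" and FE: "fin_part \<subseteq> E"
    using E by (auto simp: large_def)
  have finX: "finite W" by (rule finite_subset[of _ "E \<times> E"]) (use finE in \<open>auto simp: W_def\<close>)
  define \<Delta> where "\<Delta> = (\<Prod>(i, j) \<in> W. Var i - Var j :: (nat, 'a) mpoly)"
  \<comment> \<open>\<open>\<Delta>\<close> keeps the blocks apart, \<open>g\<close> excludes permutations of the blocks that do not preserve \<open>q\<close>\<close>
  define s where "s = \<Delta> * rename base g"
  have "\<Delta> \<in> mpolys_in E"
    unfolding \<Delta>_def by (intro mpolys_in_prod) (auto simp: W_def intro!: mpolys_in_diff mpolys_in_closed)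
  moreover have "rename base g \<in> mpolys_in E" by (rule rename_in'[OF g(1) baseE])
  ultimately have "s \<in> mpolys_in E" unfolding s_def by (intro mpolys_in_closed)
  moreover have "\<Delta> \<notin> point"
    unfolding \<Delta>_def by (rule prime_prod_notin[OF prime_point]) (auto simp: W_def Var_diff_in_point)
  then have "s \<notin> point"
    using g by (simp add: s_def prime_mult[OF prime_point] rename_base_in_point)
  moreover have "\<exists>\<phi>. \<phi> permutes I \<and> (\<forall>j\<in>E. \<pi> (\<tau> j) = \<phi> (\<pi> j)) \<and>
        (\<forall>h \<in> mpolys_in I. h \<in> q \<longrightarrow> rename \<phi> h \<in> q) \<and>
        (\<forall>j. j \<notin> E \<longrightarrow> (\<exists>\<beta> \<in> inf_blocks. \<pi> (\<tau> j) = \<phi> \<beta>))"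
    if inj: "inj \<tau>" and \<tau>: "rename \<tau> s \<notin> point" for \<tau>
  proof -
    define \<phi> where "\<phi> \<alpha> = (if \<alpha> \<in> I then \<pi> (\<tau> (base \<alpha>)) else \<alpha>)" for \<alpha>
    have "rename \<tau> \<Delta> \<notin> point" and gn: "rename \<tau> (rename base g) \<notin> point"
      using \<tau> by (auto simp: s_def prime_mult[OF prime_point])
    have sep: "\<pi> (\<tau> i) \<noteq> \<pi> (\<tau> j)" if "i \<in> E" "j \<in> E" "\<pi> i \<noteq> \<pi> j" for i j
    proof
      assume eq: "\<pi> (\<tau> i) = \<pi> (\<tau> j)"
      have ij: "(i, j) \<in> W" using that by (simp add: W_def)
      have "rename \<tau> \<Delta> = (Var (\<tau> i) - Var (\<tau> j)) * rename \<tau> (\<Prod>(i, j) \<in> W - {(i, j)}. Var i - Var j)"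
        unfolding \<Delta>_def by (subst prod.remove[OF finX ij]) simp
      moreover have "Var (\<tau> i) - Var (\<tau> j) \<in> point" by (simp add: Var_diff_in_point eq)
      ultimately have "rename \<tau> \<Delta> \<in> point" by (simp add: ideal_multr[OF ideal_point])
      then show False using \<open>rename \<tau> \<Delta> \<notin> point\<close> by contradiction
    qed
    have inj\<phi>: "inj_on \<phi> I"
    proof (rule inj_onI, rule ccontr)
      fix \<alpha> \<beta> assume *: "\<alpha> \<in> I" "\<beta> \<in> I" "\<phi> \<alpha> = \<phi> \<beta>" "\<alpha> \<noteq> \<beta>"
      then have "base \<alpha> \<in> E" "base \<beta> \<in> E" using baseE by auto
      from sep[OF this] * show False by (simp add: \<phi>_def)
    qed
    have "\<phi> ` I \<subseteq> I" by (auto simp: \<phi>_def)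
    then have im: "\<phi> ` I = I" using inj\<phi> finite_I by (simp add: endo_inj_surj)
    then have perm: "\<phi> permutes I"
      using inj\<phi> by (intro bij_imp_permutes) (auto simp: bij_betw_def \<phi>_def)
    have E_blocks: "\<pi> (\<tau> j) = \<phi> (\<pi> j)" if "j \<in> E" for j
    proof -
      have "\<pi> (\<tau> j) \<in> \<phi> ` I" by (simp add: im)
      then obtain \<alpha> where \<alpha>: "\<alpha> \<in> I" "\<pi> (\<tau> j) = \<pi> (\<tau> (base \<alpha>))" by (auto simp: \<phi>_def)
      then have "\<pi> j = \<alpha>" using sep[OF that, of "base \<alpha>"] baseE by auto
      with \<alpha> show ?thesis by (simp add: \<phi>_def)
    qed
    have inf: "\<phi> \<beta> \<in> inf_blocks" if \<beta>: "\<beta> \<in> inf_blocks" for \<beta>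
    proof (rule ccontr)
      assume "\<phi> \<beta> \<notin> inf_blocks"
      then have "\<tau> j \<in> fin_part" if "j \<in> E \<inter> \<pi> -` {\<beta>}" for j
        using that E_blocks[of j] notin_fin_part[of "\<tau> j"] by auto
      then have "\<tau> ` (E \<inter> \<pi> -` {\<beta>}) \<subseteq> fin_part" by auto
      then have "card (E \<inter> \<pi> -` {\<beta>}) \<le> card fin_part"
        by (metis card_image card_mono finite_fin_part inj inj_on_subset subset_UNIV)
      then show False using E \<beta> by (auto simp: large_def)
    qed
    have "inj_on \<phi> inf_blocks" using inj\<phi> inf_blocks_subset by (rule inj_on_subset)
    then have im_inf: "\<phi> ` inf_blocks = inf_blocks"
      using inf finite_inf_blocks by (intro endo_inj_surj) auto
    have "\<tau> ` fin_part \<subseteq> fin_part"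
    proof
      fix i assume "i \<in> \<tau> ` fin_part"
      then obtain j where j: "j \<in> fin_part" "i = \<tau> j" by auto
      have "\<phi> (\<pi> j) \<notin> inf_blocks"
      proof
        assume "\<phi> (\<pi> j) \<in> inf_blocks"
        then have "\<phi> (\<pi> j) \<in> \<phi> ` inf_blocks" by (simp only: im_inf)
        then obtain \<beta> where \<beta>: "\<beta> \<in> inf_blocks" "\<phi> (\<pi> j) = \<phi> \<beta>" by auto
        then have "\<pi> j = \<beta>" using inj_onD[OF inj\<phi> \<beta>(2)] inf_blocks_subset by auto
        with \<beta>(1) j(1) show False using notin_fin_part[of j] by simp
      qed
      then have "\<pi> (\<tau> j) \<notin> inf_blocks" using E_blocks[of j] j FE by auto
      then show "i \<in> fin_part" using notin_fin_part j(2) by blast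
    qed
    then have im_fin: "\<tau> ` fin_part = fin_part"
      using inj finite_fin_part by (intro endo_inj_surj) (auto intro: inj_on_subset)
    have out: "\<exists>\<beta> \<in> inf_blocks. \<pi> (\<tau> j) = \<phi> \<beta>" if j: "j \<notin> E" for j
    proof -
      have "\<tau> j \<notin> fin_part"
      proof
        assume "\<tau> j \<in> fin_part"
        then have "\<tau> j \<in> \<tau> ` fin_part" by (simp only: im_fin)
        then have "j \<in> fin_part" using inj by (auto dest: injD)
        then show False using j FE by auto
      qed
      then have "\<pi> (\<tau> j) \<in> \<phi> ` inf_blocks" by (simp only: im_inf notin_fin_part)
      then show ?thesis by auto
    qed
    have "rename \<pi> (rename \<tau> (rename base g)) = rename \<phi> g"
      unfolding rename_rename by (rule rename_cong[OF g(1)]) (simp add: \<phi>_def)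
    then have "rename \<phi> g \<notin> q" using gn by (simp add: point_def)
    with g(3)[OF perm] perm E_blocks out show ?thesis by blast
  qed
  ultimately show ?thesis by (rule that)
qed

text \<open>The ideal of the orbit of the generic point.\<close>

definition orbit_ideal :: "(nat, 'a) mpoly set" where
  "orbit_ideal = {f. \<forall>\<sigma> \<in> finitary_perms. rename \<sigma> f \<in> point}"

text \<open>Where \<open>s\<close> does not vanish, the orbit closure of the generic point looks as expected: it lies in the
  closure of the point as far as the variables from \<open>E\<close> are concerned, and every other variable agrees with
  one from an infinite block.\<close>

lemma orbit_ideal_multiples:
  assumes "large E"
  obtains s where "s \<in> mpolys_in E" "s \<notin> point"
    "\<And>h. h \<in> mpolys_in E \<Longrightarrow> h \<in> point \<Longrightarrow> s * h \<in> orbit_ideal"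
    "\<And>j. j \<notin> E \<Longrightarrow> s * (\<Prod>\<beta> \<in> inf_blocks. Var j - Var (base \<beta>)) \<in> orbit_ideal"
proof -
  from rigidifying_element[OF assms] obtain s where s: "s \<in> mpolys_in E" "s \<notin> point"
    and rigid: "\<And>\<tau>. inj \<tau> \<Longrightarrow> rename \<tau> s \<notin> point \<Longrightarrow> \<exists>\<phi>. \<phi> permutes I \<and> (\<forall>j\<in>E. \<pi> (\<tau> j) = \<phi> (\<pi> j)) \<and>
        (\<forall>h \<in> mpolys_in I. h \<in> q \<longrightarrow> rename \<phi> h \<in> q) \<and>
        (\<forall>j. j \<notin> E \<longrightarrow> (\<exists>\<beta> \<in> inf_blocks. \<pi> (\<tau> j) = \<phi> \<beta>))" by metis
  have *: "s * f \<in> orbit_ideal"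
    if "\<And>\<tau> \<phi>. \<lbrakk>\<forall>j\<in>E. \<pi> (\<tau> j) = \<phi> (\<pi> j); \<forall>h \<in> mpolys_in I. h \<in> q \<longrightarrow> rename \<phi> h \<in> q;
        \<forall>j. j \<notin> E \<longrightarrow> (\<exists>\<beta> \<in> inf_blocks. \<pi> (\<tau> j) = \<phi> \<beta>)\<rbrakk> \<Longrightarrow> rename \<tau> f \<in> point" for f
    unfolding orbit_ideal_def
  proof safe
    fix \<tau> :: "nat \<Rightarrow> nat" assume "\<tau> \<in> finitary_perms"
    from rigid[OF finitary_inj[OF this]] that[of \<tau>]
    have "rename \<tau> s \<in> point \<or> rename \<tau> f \<in> point" by blast
    then show "rename \<tau> (s * f) \<in> point" by (simp add: prime_mult[OF prime_point])
  qed
  have "s * h \<in> orbit_ideal" if h: "h \<in> mpolys_in E" "h \<in> point" for h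
  proof (rule *)
    fix \<tau> \<phi> assume \<tau>: "\<forall>j\<in>E. \<pi> (\<tau> j) = \<phi> (\<pi> j)" and \<phi>: "\<forall>h \<in> mpolys_in I. h \<in> q \<longrightarrow> rename \<phi> h \<in> q"
    have "rename \<pi> (rename \<tau> h) = rename \<phi> (rename \<pi> h)"
      unfolding rename_rename by (rule rename_cong[OF h(1)]) (use \<tau> in auto)
    also have "\<dots> \<in> q" using h(2) \<phi> rename_pi_in by (auto simp: point_def)
    finally show "rename \<tau> h \<in> point" by (simp add: point_def)
  qed
  moreover have "s * (\<Prod>\<beta> \<in> inf_blocks. Var j - Var (base \<beta>)) \<in> orbit_ideal" if j: "j \<notin> E" for j
  proof (rule *)
    fix \<tau> \<phi> assume \<tau>: "\<forall>j\<in>E. \<pi> (\<tau> j) = \<phi> (\<pi> j)"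
      and out: "\<forall>j. j \<notin> E \<longrightarrow> (\<exists>\<beta> \<in> inf_blocks. \<pi> (\<tau> j) = \<phi> \<beta>)"
    from out j obtain \<beta> where \<beta>: "\<beta> \<in> inf_blocks" "\<pi> (\<tau> j) = \<phi> \<beta>" by auto
    have bI: "\<beta> \<in> I" using \<beta>(1) inf_blocks_subset by auto
    then have "base \<beta> \<in> E" using assms by (auto simp: large_def)
    then have "\<pi> (\<tau> (base \<beta>)) = \<phi> \<beta>" using \<tau> bI by simp
    then have "Var (\<tau> j) - Var (\<tau> (base \<beta>)) \<in> point" using \<beta>(2) by (simp add: Var_diff_in_point)
    then show "rename \<tau> (\<Prod>\<beta> \<in> inf_blocks. Var j - Var (base \<beta>)) \<in> point"
      using \<beta>(1) by (simp add: prod.remove[OF finite_inf_blocks \<beta>(1)] ideal_multr[OF ideal_point])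
  qed
  ultimately show ?thesis using s that by blast
qed

end

section \<open>Localization of a symmetric prime at a generic point\<close>

text \<open>If the elements of \<open>W\<close> act nilpotently on \<open>v\<close>, then multiplying \<open>v\<close> by maximal powers of them that do not
  kill it gives a nonzero multiple that is killed by all of them.\<close>

lemma annihilating_multiple:
  assumes J: "ideal_set J" and v: "v \<notin> J" and W: "finite W" "W \<subseteq> mpolys_in D"
    and nil: "\<And>x. x \<in> W \<Longrightarrow> \<exists>n. v * x ^ n \<in> J"
  shows "\<exists>y \<in> mpolys_in D. v * y \<notin> J \<and> (\<forall>x \<in> W. v * y * x \<in> J)"
  using W nil
proof (induction W rule: finite_induct)
  case empty
  then show ?case using v by (intro bexI[of _ 1]) (auto simp: mpolys_in_closed)
next
  case (insert x W)
  then obtain y where y: "y \<in> mpolys_in D" "v * y \<notin> J" "\<And>x. x \<in> W \<Longrightarrow> v * y * x \<in> J"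
    by auto
  obtain n where "v * x ^ n \<in> J" using insert.prems by blast
  then have "v * y * x ^ n \<in> J" using ideal_multr[OF J, of "v * x ^ n" y] by (simp add: ac_simps)
  then have "\<exists>n. v * y * x ^ n \<in> J" ..
  then obtain n where n: "v * y * x ^ n \<in> J" and least: "\<And>k. k < n \<Longrightarrow> v * y * x ^ k \<notin> J"
    using exists_least_iff[of "\<lambda>n. v * y * x ^ n \<in> J"] by blast
  from n y(2) obtain k where k: "n = Suc k" by (cases n) auto
  show ?case
  proof (intro bexI[of _ "y * x ^ k"] conjI ballI)
    show "y * x ^ k \<in> mpolys_in D"
      using y(1) insert.prems by (intro mpolys_in_closed mpolys_in_power) auto
    show "v * (y * x ^ k) \<notin> J" using least[of k] k by (simp add: ac_simps)
    fix z assume "z \<in> insert x W"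
    then show "v * (y * x ^ k) * z \<in> J"
    proof
      assume "z = x"
      then show ?thesis using n k by (simp add: ac_simps)
    next
      assume "z \<in> W"
      from ideal_multr[OF J y(3)[OF this], of "x ^ k"] show ?thesis by (simp add: ac_simps)
    qed
  qed
qed

lemma factor_choice:
  assumes J: "ideal_set J" and S: "finite S"
  shows "v \<notin> J \<Longrightarrow> v * (\<Prod>\<beta>\<in>S. a \<beta>) ^ n \<in> J \<Longrightarrow> \<exists>\<beta>\<in>S. \<exists>y. v * y \<notin> J \<and> v * y * a \<beta> ^ n \<in> J"
  using S
proof (induction S rule: finite_induct)
  case (insert \<beta> S)
  show ?case
  proof (cases "v * (\<Prod>\<beta>\<in>S. a \<beta>) ^ n \<in> J")
    case True
    with insert show ?thesis by auto
  next
    case False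
    moreover have "v * (\<Prod>\<beta>\<in>S. a \<beta>) ^ n * a \<beta> ^ n \<in> J"
      using insert by (simp add: power_mult_distrib ac_simps)
    ultimately show ?thesis by blast
  qed
qed simp

text \<open>Passing to a multiple of \<open>v\<close> isolates one of the local components of \<open>v\<close>.\<close>

lemma component_choice:
  assumes J: "ideal_set J" and S: "finite S" and v: "v \<notin> J" and L: "finite L"
    and nil: "\<And>j. j \<in> L \<Longrightarrow> \<exists>n. (\<Prod>\<beta>\<in>S. a j \<beta>) ^ n \<in> J"
  shows "\<exists>y \<theta>. v * y \<notin> J \<and> (\<forall>j\<in>L. \<theta> j \<in> S \<and> (\<exists>k. v * y * a j (\<theta> j) ^ k \<in> J))"
  using L nil
proof (induction L rule: finite_induct)
  case empty
  then show ?case using v by (intro exI[of _ 1]) auto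
next
  case (insert j L)
  then obtain y \<theta> where y: "v * y \<notin> J" "\<And>i. i \<in> L \<Longrightarrow> \<theta> i \<in> S \<and> (\<exists>k. v * y * a i (\<theta> i) ^ k \<in> J)"
    by blast
  obtain n where "(\<Prod>\<beta>\<in>S. a j \<beta>) ^ n \<in> J" using insert.prems by blast
  then have "v * y * (\<Prod>\<beta>\<in>S. a j \<beta>) ^ n \<in> J" by (rule ideal_multl[OF J])
  from factor_choice[OF J S y(1) this] obtain \<beta> z where
    \<beta>: "\<beta> \<in> S" "v * y * z \<notin> J" "v * y * z * a j \<beta> ^ n \<in> J" by blast
  show ?case
  proof (intro exI[of _ "y * z"] exI[of _ "\<theta>(j := \<beta>)"] conjI ballI)
    show "v * (y * z) \<notin> J" using \<beta>(2) by (simp add: ac_simps)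
    fix i assume i: "i \<in> insert j L"
    show "(\<theta>(j := \<beta>)) i \<in> S" using i \<beta>(1) y(2) by auto
    show "\<exists>k. v * (y * z) * a i ((\<theta>(j := \<beta>)) i) ^ k \<in> J"
    proof (cases "i = j")
      case True
      then show ?thesis using \<beta>(3) by (intro exI[of _ n]) (simp add: ac_simps)
    next
      case False
      then obtain k where "v * y * a i (\<theta> i) ^ k \<in> J" using y(2) i by blast
      from ideal_multr[OF J this, of z] False show ?thesis by (intro exI[of _ k]) (simp add: ac_simps)
    qed
  qed
qed

text \<open>An ideal stable under finitary permutations that satisfies the elementwise form of
  \<open>\<SS>\<close>-primality.\<close>

locale sym_prime_ideal =
  fixes p :: "(nat, 'a::comm_ring_1) mpoly set"
  assumes ideal_p: "ideal_set p"
    and stable_p: "\<sigma> \<in> finitary_perms \<Longrightarrow> f \<in> p \<Longrightarrow> rename \<sigma> f \<in> p"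
    and sprime: "(\<And>\<sigma>. \<sigma> \<in> finitary_perms \<Longrightarrow> f * rename \<sigma> g \<in> p) \<Longrightarrow> f \<in> p \<or> g \<in> p"

text \<open>An \<open>\<SS>\<close>-prime whose radical is the intersection of the translates of the generic point.\<close>

locale sprime_config = config I \<pi> q + sym_prime_ideal p
  for I :: "'i set" and \<pi> :: "nat \<Rightarrow> 'i" and q :: "('i, 'a::comm_ring_1) mpoly set"
    and p :: "(nat, 'a) mpoly set" +
  assumes p_subset: "p \<subseteq> orbit_ideal" and nilpotent_mod_p: "f \<in> orbit_ideal \<Longrightarrow> \<exists>n. f ^ n \<in> p"
begin

text \<open>The kernel of the localization of \<open>R / p\<close> at the generic point, and its approximation that only
  inverts polynomials in the variables from \<open>E\<close>.\<close>

definition pm :: "(nat, 'a) mpoly set" where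
  "pm = {f. \<exists>u. u \<notin> point \<and> u * f \<in> p}"

definition pE :: "nat set \<Rightarrow> (nat, 'a) mpoly set" where
  "pE E = {f. \<exists>u \<in> mpolys_in E. u \<notin> point \<and> u * f \<in> p}"

lemma pE_UNIV: "pE UNIV = pm"
  by (simp add: pE_def pm_def Bex_def)

lemma ideal_pE: "ideal_set (pE E)"
proof (rule ideal_setI)
  show "0 \<in> pE E"
    using prime_1[OF prime_point] by (auto simp: pE_def ideal_0[OF ideal_p] intro!: bexI[of _ 1] mpolys_in_closed)
next
  fix x y assume "x \<in> pE E" "y \<in> pE E"
  then obtain u v where u: "u \<in> mpolys_in E" "u \<notin> point" "u * x \<in> p"
    and v: "v \<in> mpolys_in E" "v \<notin> point" "v * y \<in> p" by (auto simp: pE_def)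
  have "u * v * (x + y) = v * (u * x) + u * (v * y)" by (simp add: algebra_simps)
  also have "\<dots> \<in> p"
    by (rule ideal_add[OF ideal_p ideal_multl[OF ideal_p u(3)] ideal_multl[OF ideal_p v(3)]])
  finally have "u * v * (x + y) \<in> p" .
  moreover have "u * v \<in> mpolys_in E" "u * v \<notin> point"
    using u v by (simp_all add: prime_mult[OF prime_point] mpolys_in_closed)
  ultimately show "x + y \<in> pE E" unfolding pE_def by blast
next
  fix r x assume "x \<in> pE E"
  then obtain u where u: "u \<in> mpolys_in E" "u \<notin> point" "u * x \<in> p" by (auto simp: pE_def)
  have "u * (r * x) \<in> p" using ideal_multl[OF ideal_p u(3), of r] by (simp add: ac_simps)
  with u show "r * x \<in> pE E" by (auto simp: pE_def)
qed

lemmas ideal_pm = ideal_pE[of UNIV, unfolded pE_UNIV]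

lemma pE_mono: "E \<subseteq> E' \<Longrightarrow> f \<in> pE E \<Longrightarrow> f \<in> pE E'"
  by (auto simp: pE_def intro: mpolys_in_mono)

lemma pE_subset_pm: "f \<in> pE E \<Longrightarrow> f \<in> pm"
  using pE_mono[of E UNIV] by (simp add: pE_UNIV)

lemma p_subset_pE: "f \<in> p \<Longrightarrow> f \<in> pE E"
  using prime_1[OF prime_point] by (auto simp: pE_def intro!: bexI[of _ 1] mpolys_in_closed)

lemma p_subset_pm: "f \<in> p \<Longrightarrow> f \<in> pm"
  using p_subset_pE[of f UNIV] by (simp add: pE_UNIV)

lemma pE_cancel:
  assumes u: "u \<in> mpolys_in E" "u \<notin> point" "u * f \<in> pE E"
  shows "f \<in> pE E"
proof -
  from u(3) obtain v where v: "v \<in> mpolys_in E" "v \<notin> point" "v * (u * f) \<in> p" by (auto simp: pE_def)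
  with u show ?thesis
    by (auto simp: pE_def prime_mult[OF prime_point] mult.assoc intro!: bexI[of _ "v * u"] mpolys_in_closed)
qed

lemma pm_cancel: "u \<notin> point \<Longrightarrow> u * f \<in> pm \<Longrightarrow> f \<in> pm"
  using pE_cancel[of u UNIV f] by (simp add: pE_UNIV)

lemma p_subset_point: "p \<subseteq> point"
proof
  fix f assume "f \<in> p"
  then have "f \<in> orbit_ideal" using p_subset by blast
  then have "rename (\<lambda>i. i) f \<in> point" using finitary_id unfolding orbit_ideal_def by blast
  then show "f \<in> point" by simp
qed

lemma pm_subset_point: "pm \<subseteq> point"
  using p_subset_point by (auto simp: pm_def prime_mult[OF prime_point] dest!: subsetD)

lemma one_notin_pm: "1 \<notin> pm"
  using pm_subset_point prime_1[OF prime_point] by auto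

lemma pm_stable:
  assumes \<sigma>: "\<sigma> \<in> finitary_perms" "\<And>i. \<pi> (\<sigma> i) = \<pi> i" and f: "f \<in> pm"
  shows "rename \<sigma> f \<in> pm"
proof -
  from f obtain u where u: "u \<notin> point" "u * f \<in> p" by (auto simp: pm_def)
  from stable_p[OF \<sigma>(1) u(2)] u(1) show ?thesis
    by (auto simp: pm_def point_stable[OF \<sigma>(2)] intro!: exI[of _ "rename \<sigma> u"])
qed

lemma pE_stable:
  assumes \<sigma>: "\<sigma> \<in> finitary_perms" "\<And>i. i \<in> E \<Longrightarrow> \<sigma> i = i" and f: "f \<in> pE E"
  shows "rename \<sigma> f \<in> pE E"
proof -
  from f obtain u where u: "u \<in> mpolys_in E" "u \<notin> point" "u * f \<in> p" by (auto simp: pE_def)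
  have "rename \<sigma> u = u" using u(1) \<sigma>(2) by (rule rename_eq_self)
  then have "u * rename \<sigma> f \<in> p" using stable_p[OF \<sigma>(1) u(3)] by simp
  with u show ?thesis by (auto simp: pE_def)
qed

lemma
  assumes E: "large E"
  shows pE_nilpotent: "h \<in> mpolys_in E \<Longrightarrow> h \<in> point \<Longrightarrow> \<exists>n. h ^ n \<in> pE E"
    and pE_nilpotent_prod: "j \<notin> E \<Longrightarrow> \<exists>n. (\<Prod>\<beta>\<in>inf_blocks. Var j - Var (base \<beta>)) ^ n \<in> pE E"
proof -
  from orbit_ideal_multiples[OF E] obtain s where s: "s \<in> mpolys_in E" "s \<notin> point"
    "\<And>h. h \<in> mpolys_in E \<Longrightarrow> h \<in> point \<Longrightarrow> s * h \<in> orbit_ideal"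
    "\<And>j. j \<notin> E \<Longrightarrow> s * (\<Prod>\<beta> \<in> inf_blocks. Var j - Var (base \<beta>)) \<in> orbit_ideal" by metis
  have *: "\<exists>n. h ^ n \<in> pE E" if "s * h \<in> orbit_ideal" for h
  proof -
    from nilpotent_mod_p[OF that] obtain n where "s ^ n * h ^ n \<in> p" by (auto simp: power_mult_distrib)
    then have "h ^ n \<in> pE E"
      using mpolys_in_power[OF s(1), of n] prime_power_notin[OF prime_point s(2), of n]
      unfolding pE_def by blast
    then show ?thesis ..
  qed
  show "h \<in> mpolys_in E \<Longrightarrow> h \<in> point \<Longrightarrow> \<exists>n. h ^ n \<in> pE E"
    "j \<notin> E \<Longrightarrow> \<exists>n. (\<Prod>\<beta>\<in>inf_blocks. Var j - Var (base \<beta>)) ^ n \<in> pE E"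
    using * s by blast+
qed

lemma pm_nilpotent:
  assumes h: "h \<in> point"
  shows "\<exists>n. h ^ n \<in> pm"
proof -
  obtain D where D: "finite D" "h \<in> mpolys_in D" using finite_support by blast
  then obtain E where E: "large E" "D \<subseteq> E" using ex_large by blast
  then have "h \<in> mpolys_in E" using D mpolys_in_mono by blast
  from pE_nilpotent[OF E(1) this h] show ?thesis using pE_subset_pm by blast
qed


subsection \<open>Adapted elements and their exponents\<close>

text \<open>An element with nonzero image in the localization that is killed by all differences of variables
  that it involves and that lie in the same block. The set \<open>D\<close> also contains the finite blocks, so that
  exponents only matter for infinite blocks, and the chosen variables.\<close>

definition adapted :: "nat set \<Rightarrow> (nat, 'a) mpoly \<Rightarrow> bool" where
  "adapted D w \<longleftrightarrow> finite D \<and> fin_part \<subseteq> D \<and> base ` I \<subseteq> D \<and> w \<in> mpolys_in D \<and> w \<notin> pm \<and>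
     (\<forall>j\<in>D. w * eps j \<in> pm)"

text \<open>The exponent at which a variable of the block \<open>\<alpha>\<close> becomes nilpotent on \<open>w\<close>.\<close>

definition expo :: "(nat, 'a) mpoly \<Rightarrow> 'i \<Rightarrow> nat" where
  "expo w \<alpha> = (LEAST k. 1 \<le> k \<and> (\<forall>j. \<pi> j = \<alpha> \<longrightarrow> w * eps j ^ k \<in> pm))"

lemma eps_in: "j \<in> D \<Longrightarrow> base ` I \<subseteq> D \<Longrightarrow> eps j \<in> mpolys_in D"
  unfolding eps_def by (intro mpolys_in_diff mpolys_in_closed) auto

lemma rename_eps:
  "\<sigma> (base (\<pi> j)) = base (\<pi> (\<sigma> j)) \<Longrightarrow> rename \<sigma> (eps j) = eps (\<sigma> j)"
  by (simp add: eps_def)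

text \<open>All variables of a block outside \<open>D\<close> have the same exponent, since a transposition exchanges them.\<close>

lemma expo_transfer:
  assumes w: "adapted D w" and ij: "i \<notin> D" "j \<notin> D" "\<pi> i = \<pi> j" and k: "w * eps i ^ k \<in> pm"
  shows "w * eps j ^ k \<in> pm"
proof -
  let ?t = "transpose i j"
  have "base (\<pi> i) \<in> D" using w by (auto simp: adapted_def)
  then have "base (\<pi> i) \<noteq> i" "base (\<pi> i) \<noteq> j" using ij by auto
  then have "rename ?t (eps i) = eps j" using ij by (subst rename_eps) (auto simp: transpose_def)
  moreover have "rename ?t w = w"
    using w ij by (intro rename_eq_self[of w D]) (auto simp: adapted_def transpose_def)
  ultimately show ?thesis
    using pm_stable[OF finitary_transpose transpose_pi[OF ij(3)] k] by simp
qed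

lemma expo_exists:
  assumes w: "adapted D w"
  shows "\<exists>k. 1 \<le> k \<and> (\<forall>j. \<pi> j = \<alpha> \<longrightarrow> w * eps j ^ k \<in> pm)"
proof (cases "\<exists>i. \<pi> i = \<alpha> \<and> i \<notin> D")
  case True
  then obtain i where i: "\<pi> i = \<alpha>" "i \<notin> D" by blast
  obtain n where n: "eps i ^ n \<in> pm" using pm_nilpotent[OF eps_in_point] by blast
  have "w * eps i ^ n \<in> pm" by (rule ideal_multl[OF ideal_pm n])
  have "w * eps j ^ Suc n \<in> pm" if "\<pi> j = \<alpha>" for j
  proof (cases "j \<in> D")
    case True
    then have "w * eps j \<in> pm" using w by (simp add: adapted_def)
    from ideal_multr[OF ideal_pm this, of "eps j ^ n"] show ?thesis by (simp add: ac_simps)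
  next
    case False
    have "w * eps j ^ n \<in> pm"
      by (rule expo_transfer[OF w i(2) False _ \<open>w * eps i ^ n \<in> pm\<close>]) (simp add: i that)
    from ideal_multr[OF ideal_pm this, of "eps j"] show ?thesis by (simp add: ac_simps)
  qed
  then show ?thesis by (intro exI[of _ "Suc n"]) auto
next
  case False
  then show ?thesis using w by (intro exI[of _ 1]) (auto simp: adapted_def)
qed

lemma expo_ge_1: "adapted D w \<Longrightarrow> 1 \<le> expo w \<alpha>"
  unfolding expo_def by (rule LeastI2_ex[OF expo_exists]) auto

lemma expo_kill: "adapted D w \<Longrightarrow> expo w (\<pi> j) \<le> k \<Longrightarrow> w * eps j ^ k \<in> pm"
proof -
  assume w: "adapted D w" and k: "expo w (\<pi> j) \<le> k"
  have "w * eps j ^ expo w (\<pi> j) \<in> pm"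
    unfolding expo_def by (rule LeastI2_ex[OF expo_exists[OF w, of "\<pi> j"]]) auto
  from ideal_multr[OF ideal_pm this, of "eps j ^ (k - expo w (\<pi> j))"] k
  show ?thesis by (simp add: mult.assoc power_add[symmetric])
qed

lemma expo_le:
  assumes w: "adapted D w" and j: "j \<notin> D" and k: "w * eps j ^ k \<in> pm"
  shows "expo w (\<pi> j) \<le> k"
proof -
  have "k \<noteq> 0" using w k by (cases k) (auto simp: adapted_def)
  have "w * eps i ^ k \<in> pm" if "\<pi> i = \<pi> j" for i
  proof (cases "i \<in> D")
    case True
    then have "w * eps i \<in> pm" using w by (simp add: adapted_def)
    from ideal_multr[OF ideal_pm this, of "eps i ^ (k - 1)"] \<open>k \<noteq> 0\<close> show ?thesis
      by (cases k) (simp_all add: ac_simps)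
  next
    case False
    show ?thesis by (rule expo_transfer[OF w j False _ k]) (simp add: that)
  qed
  then show ?thesis unfolding expo_def using \<open>k \<noteq> 0\<close> by (intro Least_le) auto
qed

lemma expo_mult_le:
  assumes w: "adapted D w"
  shows "expo (w * y) \<alpha> \<le> expo w \<alpha>"
proof -
  have "w * y * eps j ^ expo w \<alpha> \<in> pm" if "\<pi> j = \<alpha>" for j
    using ideal_multr[OF ideal_pm expo_kill[OF w, of j "expo w \<alpha>"], of y] that by (simp add: ac_simps)
  then show ?thesis unfolding expo_def[of "w * y"] using expo_ge_1[OF w, of \<alpha>] by (intro Least_le) auto
qed

lemma expo_fin: "adapted D w \<Longrightarrow> \<alpha> \<in> I \<Longrightarrow> \<alpha> \<notin> inf_blocks \<Longrightarrow> expo w \<alpha> = 1"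
  unfolding expo_def
proof (rule Least_equality)
  assume w: "adapted D w" and \<alpha>: "\<alpha> \<in> I" "\<alpha> \<notin> inf_blocks"
  have "j \<in> D" if "\<pi> j = \<alpha>" for j
    using \<alpha> that notin_fin_part[of j] w by (auto simp: adapted_def)
  then show "1 \<le> (1::nat) \<and> (\<forall>j. \<pi> j = \<alpha> \<longrightarrow> w * eps j ^ 1 \<in> pm)"
    using w by (auto simp: adapted_def)
qed simp

lemma adapted_mult:
  assumes "adapted D w" "y \<in> mpolys_in D" "w * y \<notin> pm"
  shows "adapted D (w * y)"
  using assms ideal_multr[OF ideal_pm, of "w * eps j" y for j]
  by (auto simp: adapted_def ac_simps intro: mpolys_in_closed)

text \<open>No multiple of \<open>w\<close> that is again adapted, possibly to a larger set of variables, has smaller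
  exponents.\<close>

definition minimal :: "nat set \<Rightarrow> (nat, 'a) mpoly \<Rightarrow> bool" where
  "minimal D w \<longleftrightarrow> adapted D w \<and>
     (\<forall>D' y. adapted D' (w * y) \<longrightarrow> (\<forall>\<alpha>\<in>I. expo (w * y) \<alpha> = expo w \<alpha>))"

lemma minimal_adapted: "minimal D w \<Longrightarrow> adapted D w"
  by (simp add: minimal_def)

lemma minimal_expo: "minimal D w \<Longrightarrow> adapted D' (w * y) \<Longrightarrow> \<alpha> \<in> I \<Longrightarrow> expo (w * y) \<alpha> = expo w \<alpha>"
  by (auto simp: minimal_def)

lemma minimal_mult:
  assumes "minimal D w" "adapted D' (w * y)"
  shows "minimal D' (w * y)"
  using assms minimal_expo[OF assms(1)] by (auto simp: minimal_def mult.assoc)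

lemma minimal_exists: "\<exists>D w. minimal D w"
proof -
  let ?D = "fin_part \<union> base ` I"
  have finD: "finite ?D" using finite_fin_part finite_I by simp
  have "\<exists>y \<in> mpolys_in ?D. 1 * y \<notin> pm \<and> (\<forall>x \<in> eps ` ?D. 1 * y * x \<in> pm)"
  proof (rule annihilating_multiple[OF ideal_pm one_notin_pm])
    show "\<exists>n. 1 * x ^ n \<in> pm" if "x \<in> eps ` ?D" for x
      using that pm_nilpotent[OF eps_in_point] by auto
  qed (use finD in \<open>auto intro!: eps_in\<close>)
  then obtain y where "adapted ?D y" using finD by (auto simp: adapted_def)
  then have "\<exists>w D. adapted D w" by blast
  then obtain w where w: "\<exists>D. adapted D w"
    and least: "\<And>w'. \<exists>D. adapted D w' \<Longrightarrow> (\<Sum>\<alpha>\<in>I. expo w \<alpha>) \<le> (\<Sum>\<alpha>\<in>I. expo w' \<alpha>)"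
    using ex_has_least_nat[of "\<lambda>w. \<exists>D. adapted D w" _ "\<lambda>w. \<Sum>\<alpha>\<in>I. expo w \<alpha>"] by metis
  from w obtain D where D: "adapted D w" ..
  have "expo (w * y) \<alpha> = expo w \<alpha>" if "adapted D' (w * y)" "\<alpha> \<in> I" for D' y \<alpha>
  proof (rule ccontr)
    assume "expo (w * y) \<alpha> \<noteq> expo w \<alpha>"
    then have "expo (w * y) \<alpha> < expo w \<alpha>" using expo_mult_le[OF D, of y \<alpha>] by simp
    then have "(\<Sum>\<alpha>\<in>I. expo (w * y) \<alpha>) < (\<Sum>\<alpha>\<in>I. expo w \<alpha>)"
      using that(2) finite_I expo_mult_le[OF D] by (intro sum_strict_mono_ex1) auto
    then show False using least[of "w * y"] that(1) by force
  qed
  with D have "minimal D w" by (auto simp: minimal_def)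
  then show ?thesis by blast
qed

text \<open>On a minimal element the variables outside its support behave independently of each other.\<close>

lemma minimal_top:
  assumes w: "minimal D w" and L: "finite L" "L \<inter> D = {}"
  shows "adapted (D \<union> L) (w * (\<Prod>j\<in>L. eps j ^ (expo w (\<pi> j) - 1)))"
  using L
proof (induction L rule: finite_induct)
  case empty
  then show ?case using w by (simp add: minimal_adapted)
next
  case (insert j L)
  define w' where "w' = w * (\<Prod>j\<in>L. eps j ^ (expo w (\<pi> j) - 1))"
  have a: "adapted (D \<union> L) w'" using insert by (simp add: w'_def)
  have j: "j \<notin> D \<union> L" using insert by auto
  have ex: "expo w' (\<pi> j) = expo w (\<pi> j)"
    unfolding w'_def by (rule minimal_expo[OF w]) (use a in \<open>auto simp: w'_def\<close>)
  define z where "z = w' * eps j ^ (expo w (\<pi> j) - 1)"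
  have "expo w (\<pi> j) \<ge> 1" by (rule expo_ge_1[OF minimal_adapted[OF w]])
  then have "z \<notin> pm" using expo_le[OF a j, of "expo w (\<pi> j) - 1"] ex by (auto simp: z_def)
  moreover have "z * eps i \<in> pm" if "i \<in> D \<union> L" for i
  proof -
    have "w' * eps i \<in> pm" using a that by (simp add: adapted_def)
    from ideal_multr[OF ideal_pm this, of "eps j ^ (expo w (\<pi> j) - 1)"] show ?thesis
      by (simp add: z_def ac_simps)
  qed
  moreover have "z * eps j \<in> pm"
  proof -
    have "w' * eps j ^ Suc (expo w (\<pi> j) - 1) \<in> pm"
      by (rule expo_kill[OF a]) (use ex in simp)
    then show ?thesis by (simp add: z_def ac_simps)
  qed
  moreover have "z \<in> mpolys_in (insert j (D \<union> L))"
    unfolding z_def using a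
    by (intro mpolys_in_closed mpolys_in_power eps_in)
      (auto simp: adapted_def elim: mpolys_in_mono)
  ultimately have "adapted (insert j (D \<union> L)) z"
    using a by (auto simp: adapted_def)
  moreover have "z = w * (\<Prod>j\<in>insert j L. eps j ^ (expo w (\<pi> j) - 1))"
    using insert.hyps by (simp add: z_def w'_def ac_simps)
  ultimately show ?case by simp
qed

end

section \<open>Existence of the weighting\<close>

lemma mdeg_le_imp_eq:
  assumes "\<And>x. lookup m' x \<le> lookup m x" "mdeg m \<le> mdeg m'"
  shows "m' = m"
proof -
  have m: "m = m' + (m - m')"
    using assms(1) by (intro poly_mapping_eqI) (simp add: lookup_add lookup_minus)
  then have "mdeg m = mdeg m' + mdeg (m - m')" by (metis mdeg_add)
  then have "m - m' = 0" using assms(2) by (simp add: mdeg_eq_0[symmetric])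
  then show ?thesis using m by simp
qed

lemma distinct_representatives:
  assumes "finite L" "finite E" "\<And>j. j \<in> L \<Longrightarrow> infinite (S j)"
  shows "\<exists>k. inj_on k L \<and> (\<forall>j\<in>L. k j \<in> S j \<and> k j \<notin> E)"
  using assms(1,3)
proof (induction L rule: finite_induct)
  case (insert j L)
  then obtain k where k: "inj_on k L" "\<And>i. i \<in> L \<Longrightarrow> k i \<in> S i \<and> k i \<notin> E" by auto
  have "finite (E \<union> k ` L)" using insert.hyps assms(2) by simp
  then have "infinite (S j - (E \<union> k ` L))" using insert.prems[of j] by simp
  then obtain z where "z \<in> S j - (E \<union> k ` L)" using infinite_imp_nonempty by blast
  with k insert.hyps show ?case
    by (intro exI[of _ "k(j := z)"]) (auto simp: inj_on_def)
qed simp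

context config
begin

text \<open>A permutation within the blocks makes finite sets of variables disjoint, apart from finite blocks.\<close>

lemma move_apart:
  assumes W: "finite W" and Y: "finite Y"
  shows "\<exists>g \<in> finitary_perms. (\<forall>i. \<pi> (g i) = \<pi> i) \<and> g ` W \<inter> Y \<subseteq> fin_part"
  using W
proof (induction W rule: finite_induct)
  case empty
  show ?case by (rule bexI[OF _ finitary_id]) auto
next
  case (insert x W)
  then obtain g where g: "g \<in> finitary_perms" "\<And>i. \<pi> (g i) = \<pi> i" "g ` W \<inter> Y \<subseteq> fin_part"
    by blast
  show ?case
  proof (cases "\<pi> x \<in> inf_blocks")
    case False
    then have "g x \<in> fin_part" using notin_fin_part[of "g x"] g(2) by simp
    then show ?thesis using g by (intro bexI[OF _ g(1)]) auto
  next
    case True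
    have "finite (Y \<union> g ` W \<union> {g x})" using Y insert.hyps by simp
    then have "infinite (\<pi> -` {\<pi> x} - (Y \<union> g ` W \<union> {g x}))"
      using True by (auto simp: inf_blocks_def)
    then obtain z where z: "z \<in> \<pi> -` {\<pi> x} - (Y \<union> g ` W \<union> {g x})"
      using infinite_imp_nonempty by blast
    let ?h = "\<lambda>i. transpose (g x) z (g i)"
    have "?h i = g i" if "i \<in> W" for i
    proof -
      have "g i \<noteq> g x" using that insert.hyps finitary_inj[OF g(1)] by (auto dest: injD)
      moreover have "g i \<noteq> z" using z that by auto
      ultimately show ?thesis by (simp add: transpose_def)
    qed
    then have "?h ` W = g ` W" by (intro image_cong) auto
    moreover have "?h x = z" by simp
    ultimately have 1: "?h ` insert x W \<inter> Y \<subseteq> fin_part" using g(3) z by auto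
    have 2: "?h \<in> finitary_perms" by (rule finitary_comp[OF finitary_transpose g(1)])
    have 3: "\<pi> (?h i) = \<pi> i" for i
    proof -
      have "\<pi> (transpose (g x) z (g i)) = \<pi> (g i)" by (rule transpose_pi) (use g(2) z in simp)
      then show ?thesis using g(2) by simp
    qed
    show ?thesis by (rule bexI[OF _ 2]) (use 1 3 in simp)
  qed
qed

lemma lookup_taylor_in_I: "lookup (taylor \<pi> f) m \<in> mpolys_in I"
  using lookup_taylor_in[of \<pi> f m] by (simp add: range_pi)

lemma taylor_eps:
  "f = (\<Sum>m \<in> keys (taylor \<pi> f). rename base (lookup (taylor \<pi> f) m) *
      (\<Prod>x \<in> keys m. eps x ^ lookup m x))"
  using taylor_formula[where f = f and \<theta> = \<pi> and b = base] by (simp add: eps_def)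

lemma prod_eps_split:
  assumes "x \<in> keys m"
  shows "(\<Prod>x \<in> keys m. eps x ^ lookup m x) =
    eps x ^ lookup m x * (\<Prod>x \<in> keys m - {x}. eps x ^ lookup m x)"
  using assms by (intro prod.remove) auto

end

context sprime_config
begin

text \<open>If some coefficient below the exponents were outside \<open>q\<close>, take such a coefficient at a monomial \<open>m\<close>
  of least degree. Multiplication by the complementary monomial \<open>Mo\<close> kills all other terms of the
  expansion of \<open>w' * f\<close>, and what is left contradicts \<open>minimal_top\<close>. The hypothesis on \<open>Df\<close> can be achieved
  by a permutation within the blocks.\<close>

lemma taylor_of_pm_aux:
  assumes w: "minimal D w" and f: "f \<in> pm" "f \<in> mpolys_in Df" and fin: "finite Df"
    and DfD: "Df \<inter> D \<subseteq> fin_part"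
  shows "taylor \<pi> f \<in> Qset (\<lambda>i. expo w (\<pi> i)) q"
proof (rule ccontr)
  assume notin: "taylor \<pi> f \<notin> Qset (\<lambda>i. expo w (\<pi> i)) q"
  let ?T = "taylor \<pi> f"
  note a = minimal_adapted[OF w]
  have D: "finite D" "fin_part \<subseteq> D" "base ` I \<subseteq> D" using a by (auto simp: adapted_def)
  define E where "E i = expo w (\<pi> i)" for i
  have E1: "1 \<le> E i" for i unfolding E_def by (rule expo_ge_1[OF a])
  have Efin: "E i = 1" if "i \<in> fin_part" for i
    unfolding E_def using that notin_fin_part[of i] by (intro expo_fin[OF a]) auto
  define B where "B m \<longleftrightarrow> (\<forall>x. lookup m x < E x) \<and> lookup ?T m \<notin> q" for m
  have "\<exists>m. B m" using notin by (auto simp: Qset_def B_def E_def)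
  then obtain m where m: "B m" and min: "\<And>m'. B m' \<Longrightarrow> mdeg m \<le> mdeg m'"
    using ex_has_least_nat[of B _ mdeg] by metis
  have keysT: "keys m' \<subseteq> Df" if "m' \<in> keys ?T" for m'
    using taylor_in[OF f(2), of \<pi>] that by (auto simp: mpolys_in_def)
  have mT: "m \<in> keys ?T"
    using m ideal_0[OF ideal_q] by (auto simp: B_def in_keys_iff)
  \<comment> \<open>a multiple of \<open>w\<close> that is killed by the coefficients of the expansion that vanish at the point\<close>
  define H where "H = (\<lambda>m'. rename base (lookup ?T m')) `
      {m' \<in> keys ?T. lookup ?T m' \<in> q}"
  have Hpoint: "H \<subseteq> point" by (auto simp: H_def rename_base_in_point lookup_taylor_in_I)
  have "\<exists>y \<in> mpolys_in D. w * y \<notin> pm \<and> (\<forall>x \<in> H. w * y * x \<in> pm)"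
  proof (rule annihilating_multiple[OF ideal_pm])
    show "w \<notin> pm" using a by (simp add: adapted_def)
    show "H \<subseteq> mpolys_in D"
      unfolding H_def using D(3) by (auto intro!: rename_in'[OF lookup_taylor_in_I])
    show "\<exists>n. w * x ^ n \<in> pm" if "x \<in> H" for x
      using pm_nilpotent[of x] that Hpoint ideal_multl[OF ideal_pm] by blast
  qed (simp add: H_def)
  then obtain y where y: "y \<in> mpolys_in D" "w * y \<notin> pm" "\<And>x. x \<in> H \<Longrightarrow> w * y * x \<in> pm" by blast
  define w' where "w' = w * y"
  have a': "adapted D w'" unfolding w'_def by (rule adapted_mult[OF a y(1,2)])
  then have w': "minimal D w'" unfolding w'_def by (rule minimal_mult[OF w])
  have ex: "expo w' (\<pi> i) = E i" for i
    using minimal_expo[OF w, of D y "\<pi> i"] a' by (simp add: E_def w'_def)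
  have kill: "w' * eps x ^ k \<in> pm" if "E x \<le> k" for x k
    using that by (intro expo_kill[OF a']) (simp add: ex)
  define L where "L = Df - D"
  define Mo where "Mo = (\<Prod>j\<in>L. eps j ^ (E j - 1 - lookup m j))"
  define t where "t m' = w' * Mo * (rename base (lookup ?T m') *
      (\<Prod>x \<in> keys m'. eps x ^ lookup m' x))" for m'
  have finL: "finite L" using fin by (simp add: L_def)
  have keysL: "x \<in> L" if "m' \<in> keys ?T" "x \<in> keys m'"
    "lookup m' x < E x" for m' x
  proof (rule ccontr)
    assume "x \<notin> L"
    then have "x \<in> fin_part" using keysT[OF that(1)] that(2) DfD by (auto simp: L_def)
    then have "E x = 1" by (rule Efin)
    then show False using that by (auto simp: in_keys_iff)
  qed
  have other: "t m' \<in> pm" if m': "m' \<in> keys ?T" "m' \<noteq> m" for m'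
  proof -
    consider (q) "lookup ?T m' \<in> q" | (big) x where "E x \<le> lookup m' x" | (B) "B m'"
      by (auto simp: B_def) (meson not_le)
    then show ?thesis
    proof cases
      case q
      then have "w' * rename base (lookup ?T m') \<in> pm"
        unfolding w'_def using m' by (intro y(3)) (auto simp: H_def)
      then have "w' * rename base (lookup ?T m') *
          (Mo * (\<Prod>x \<in> keys m'. eps x ^ lookup m' x)) \<in> pm"
        by (rule ideal_multr[OF ideal_pm])
      then show ?thesis by (simp add: t_def ac_simps)
    next
      case big
      then have x: "x \<in> keys m'" using E1[of x] by (auto simp: in_keys_iff)
      have "w' * eps x ^ lookup m' x * (Mo * rename base (lookup ?T m') *
          (\<Prod>x \<in> keys m' - {x}. eps x ^ lookup m' x)) \<in> pm"
        by (rule ideal_multr[OF ideal_pm kill[OF big]])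
      then show ?thesis by (simp add: t_def prod_eps_split[OF x] ac_simps)
    next
      case B
      have "\<exists>x. lookup m x < lookup m' x"
        using mdeg_le_imp_eq[of m' m] min[OF B] m'(2) by (meson not_le)
      then obtain x where x: "lookup m x < lookup m' x" ..
      then have xk: "x \<in> keys m'" by (auto simp: in_keys_iff)
      have "x \<in> L" using B by (intro keysL[OF m'(1) xk]) (auto simp: B_def)
      then have Mo: "Mo = eps x ^ (E x - 1 - lookup m x) *
          (\<Prod>j\<in>L - {x}. eps j ^ (E j - 1 - lookup m j))"
        unfolding Mo_def by (intro prod.remove finL)
      have "lookup m x < E x" using m by (simp add: B_def)
      then have "w' * eps x ^ ((E x - 1 - lookup m x) + lookup m' x) \<in> pm"
        using x by (intro kill) auto
      from ideal_multr[OF ideal_pm this, of "(\<Prod>j\<in>L - {x}. eps j ^ (E j - 1 - lookup m j)) *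
        rename base (lookup ?T m') * (\<Prod>x \<in> keys m' - {x}. eps x ^ lookup m' x)"]
      show ?thesis by (simp add: t_def prod_eps_split[OF xk] Mo power_add ac_simps)
    qed
  qed
  have "w' * Mo * f \<in> pm" by (rule ideal_multl[OF ideal_pm f(1)])
  also have "w' * Mo * f = (\<Sum>m' \<in> keys ?T. t m')"
    unfolding t_def sum_distrib_left[symmetric] by (simp add: taylor_eps[symmetric])
  also have "\<dots> = (\<Sum>m' \<in> keys ?T - {m}. t m') + t m"
    using mT by (simp add: sum.remove)
  finally have "(\<Sum>m' \<in> keys ?T - {m}. t m') + t m \<in> pm" .
  moreover have "(\<Sum>m' \<in> keys ?T - {m}. t m') \<in> pm"
    by (rule ideal_sum[OF ideal_pm]) (use other in auto)
  ultimately have "t m \<in> pm" by (rule ideal_cancel[OF ideal_pm])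
  have "(\<Prod>x \<in> keys m. eps x ^ lookup m x) =
      (\<Prod>x \<in> L. eps x ^ lookup m x)"
  proof (rule prod.mono_neutral_left[OF finL])
    show "keys m \<subseteq> L" using m by (auto simp: B_def intro!: keysL[OF mT])
  qed (auto simp: in_keys_iff)
  then have "Mo * (\<Prod>x \<in> keys m. eps x ^ lookup m x) =
      (\<Prod>x \<in> L. eps x ^ (E x - 1 - lookup m x + lookup m x))"
    by (simp add: Mo_def prod.distrib power_add)
  also have "\<dots> = (\<Prod>x \<in> L. eps x ^ (expo w' (\<pi> x) - 1))"
  proof (rule prod.cong[OF refl])
    fix x show "eps x ^ (E x - 1 - lookup m x + lookup m x) = eps x ^ (expo w' (\<pi> x) - 1)"
      using m by (auto simp: B_def ex dest: spec[of _ x])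
  qed
  finally have Mo: "Mo * (\<Prod>x \<in> keys m. eps x ^ lookup m x) =
      (\<Prod>x \<in> L. eps x ^ (expo w' (\<pi> x) - 1))" .
  have "t m = rename base (lookup ?T m) * (w' * (\<Prod>x \<in> L. eps x ^ (expo w' (\<pi> x) - 1)))"
    unfolding t_def Mo[symmetric] by (simp add: ac_simps)
  with \<open>t m \<in> pm\<close> have "w' * (\<Prod>x \<in> L. eps x ^ (expo w' (\<pi> x) - 1)) \<in> pm"
    using m pm_cancel[of "rename base (lookup ?T m)"]
    by (simp add: B_def rename_base_in_point lookup_taylor_in_I)
  moreover have "adapted (D \<union> L) (w' * (\<Prod>x \<in> L. eps x ^ (expo w' (\<pi> x) - 1)))"
    by (rule minimal_top[OF w' finL]) (auto simp: L_def)
  ultimately show False by (simp add: adapted_def)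
qed

lemma taylor_of_pm:
  assumes w: "minimal D w" and f: "f \<in> pm"
  shows "taylor \<pi> f \<in> Qset (\<lambda>i. expo w (\<pi> i)) q"
proof -
  obtain Df where Df: "finite Df" "f \<in> mpolys_in Df" using finite_support by blast
  have "finite D" using w by (auto simp: minimal_def adapted_def)
  from move_apart[OF Df(1) this] obtain g where g: "g \<in> finitary_perms" "\<And>i. \<pi> (g i) = \<pi> i"
    "g ` Df \<inter> D \<subseteq> fin_part" by blast
  have T: "taylor \<pi> (rename g f) \<in> Qset (\<lambda>i. expo w (\<pi> i)) q"
    by (rule taylor_of_pm_aux[OF w pm_stable[OF g(1,2) f] rename_in[OF Df(2)] _ g(3)]) (simp add: Df)
  let ?h = "inv_into UNIV g"
  have h: "\<pi> (?h i) = \<pi> i" for i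
    using g(2)[of "?h i"] finitary_inv_cancel[OF g(1)] by simp
  have "f = rename ?h (rename g f)"
    by (simp add: rename_rename finitary_inv_cancel[OF g(1)])
  then have "taylor \<pi> f = rename ?h (taylor \<pi> (rename g f))"
    using taylor_rename[of \<pi> ?h "rename g f"] h by simp
  also have "\<dots> \<in> Qset (\<lambda>i. expo w (\<pi> i)) q"
    by (rule Qset_rename[OF ideal_q _ T]) (simp add: h)
  finally show ?thesis .
qed

lemma finite_pm_subset:
  "finite K \<Longrightarrow> K \<subseteq> pm \<Longrightarrow> \<exists>D. finite D \<and> K \<subseteq> pE D"
proof (induction K rule: finite_induct)
  case (insert x K)
  then obtain D where D: "finite D" "K \<subseteq> pE D" by auto
  obtain u where u: "u \<notin> point" "u * x \<in> p" using insert.prems by (auto simp: pm_def)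
  obtain D' where D': "finite D'" "u \<in> mpolys_in D'" using finite_support by blast
  have "x \<in> pE D'" using u D'(2) by (auto simp: pE_def)
  then have "x \<in> pE (D \<union> D')" by (rule pE_mono[rotated]) simp
  moreover have "K \<subseteq> pE (D \<union> D')" using D(2) pE_mono[of D "D \<union> D'"] by auto
  ultimately show ?case using D D' by (intro exI[of _ "D \<union> D'"]) auto
qed auto

text \<open>On an element killed by the differences \<open>eps j\<close>, every variable acts like the chosen one of its block.\<close>

lemma collapse_congruence:
  assumes J: "ideal_set J" and eps: "\<And>j. j \<in> Y \<Longrightarrow> v * eps j \<in> J" and u: "u \<in> mpolys_in Y"
  shows "v * (u - rename (\<lambda>i. base (\<pi> i)) u) \<in> J"
  using u
proof (induction rule: mpoly_induct)
  case (add f g)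
  have "v * (f + g - rename (\<lambda>i. base (\<pi> i)) (f + g)) =
    v * (f - rename (\<lambda>i. base (\<pi> i)) f) + v * (g - rename (\<lambda>i. base (\<pi> i)) g)"
    by (simp add: algebra_simps)
  then show ?case using add ideal_add[OF J] by simp
next
  case (mult f x)
  have "v * (f * Var x - rename (\<lambda>i. base (\<pi> i)) (f * Var x)) =
    v * (f - rename (\<lambda>i. base (\<pi> i)) f) * Var x + v * eps x * rename (\<lambda>i. base (\<pi> i)) f"
    by (simp add: algebra_simps eps_def)
  then show ?case
    using mult ideal_add[OF J ideal_multr[OF J mult.IH] ideal_multr[OF J eps[OF mult.hyps]]]
    by simp
qed (simp add: ideal_0[OF J])

text \<open>If the differences act nilpotently on \<open>z\<close>, then denominators in further variables can be cancelled,
  because they may be replaced by denominators in the chosen variables.\<close>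

lemma local_cancel:
  assumes E: "large E" and Y: "finite Y"
    and nil: "\<And>j. j \<in> Y \<Longrightarrow> \<exists>k. z * eps j ^ k \<in> pE E"
    and U: "U \<in> mpolys_in Y" "U \<notin> point" "U * z \<in> pE E"
  shows "z \<in> pE E"
proof (rule ccontr)
  assume z: "z \<notin> pE E"
  have "\<exists>y \<in> mpolys_in UNIV. z * y \<notin> pE E \<and> (\<forall>x \<in> eps ` Y. z * y * x \<in> pE E)"
    by (rule annihilating_multiple[OF ideal_pE z]) (use Y nil in auto)
  then obtain y where y: "z * y \<notin> pE E" "\<And>j. j \<in> Y \<Longrightarrow> z * y * eps j \<in> pE E" by blast
  let ?U = "rename (\<lambda>i. base (\<pi> i)) U"
  have "z * y * (U - ?U) \<in> pE E" by (rule collapse_congruence[OF ideal_pE y(2) U(1)])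
  moreover have "z * y * U \<in> pE E"
    using ideal_multr[OF ideal_pE U(3), of y] by (simp add: ac_simps)
  ultimately have "z * y * U - z * y * (U - ?U) \<in> pE E" by (intro ideal_diff[OF ideal_pE])
  moreover have "z * y * U - z * y * (U - ?U) = ?U * (z * y)" by (simp add: algebra_simps)
  ultimately have *: "?U * (z * y) \<in> pE E" by simp
  have "?U \<in> mpolys_in E"
    using E by (intro rename_in'[of U UNIV]) (auto simp: large_def)
  moreover have "?U \<notin> point" using U(2) by (simp add: point_def rename_rename)
  ultimately have "z * y \<in> pE E" using * by (rule pE_cancel)
  with y(1) show False by contradiction
qed

text \<open>The translates of \<open>f\<close> fall into finitely many orbits under the permutations that fix \<open>E\<close>.\<close>

lemma uniform_denominator:
  assumes E: "finite E" and w: "w \<in> mpolys_in E"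
    and f: "\<And>\<tau>. \<tau> \<in> finitary_perms \<Longrightarrow> w * rename \<tau> f \<in> pE E"
  shows "\<exists>u. u \<notin> point \<and> (\<forall>\<tau> \<in> finitary_perms. u * (w * rename \<tau> f) \<in> p)"
proof -
  obtain Df where Df: "finite Df" "f \<in> mpolys_in Df" using finite_support by blast
  define pat where "pat \<tau> = {(j, \<tau> j) | j. j \<in> Df \<and> \<tau> j \<in> E}" for \<tau>
  have finP: "finite (pat ` finitary_perms)"
    by (rule finite_subset[of _ "Pow (Df \<times> E)"]) (use Df E in \<open>auto simp: pat_def\<close>)
  have "\<exists>u. u \<in> mpolys_in E \<and> u \<notin> point \<and> (\<forall>\<tau> \<in> finitary_perms. pat \<tau> = P \<longrightarrow> u * (w * rename \<tau> f) \<in> p)"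
    if "P \<in> pat ` finitary_perms" for P
  proof -
    from that obtain \<tau> where \<tau>: "\<tau> \<in> finitary_perms" "P = pat \<tau>" by auto
    from f[OF \<tau>(1)] obtain u where u: "u \<in> mpolys_in E" "u \<notin> point" "u * (w * rename \<tau> f) \<in> p"
      by (auto simp: pE_def)
    have "u * (w * rename \<tau>' f) \<in> p" if \<tau>': "\<tau>' \<in> finitary_perms" "pat \<tau>' = P" for \<tau>'
    proof -
      have same: "\<tau>' j = \<tau> j" if "j \<in> Df" "\<tau> j \<in> E \<or> \<tau>' j \<in> E" for j
      proof -
        have "(j, \<tau> j) \<in> pat \<tau> \<or> (j, \<tau>' j) \<in> pat \<tau>'" using that by (auto simp: pat_def)
        then have "(j, \<tau> j) \<in> pat \<tau>' \<or> (j, \<tau>' j) \<in> pat \<tau>" using \<tau>'(2) \<tau>(2) by simp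
        then show ?thesis by (auto simp: pat_def)
      qed
      \<comment> \<open>the permutation \<open>g\<close> extending \<open>k\<close> fixes \<open>E\<close> and takes \<open>\<tau>\<close> to \<open>\<tau>'\<close> on the variables of \<open>f\<close>\<close>
      define k where "k x = (if x \<in> E then x else \<tau>' (inv_into UNIV \<tau> x))" for x
      have k: "k (\<tau> j) = \<tau>' j" if "j \<in> Df" for j
        using same[OF that] by (auto simp: k_def finitary_inv_cancel[OF \<tau>(1)])
      have inj: "inj_on k (E \<union> \<tau> ` Df)"
      proof (rule inj_onI)
        have out: "k x \<notin> E" if "x \<in> \<tau> ` Df" "x \<notin> E" for x
        proof -
          from that(1) obtain j where "j \<in> Df" "x = \<tau> j" by auto
          then show ?thesis using same[of j] k[of j] that(2) by auto
        qed
        fix x y assume xy: "x \<in> E \<union> \<tau> ` Df" "y \<in> E \<union> \<tau> ` Df" "k x = k y"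
        show "x = y"
        proof (cases "x \<in> E \<or> y \<in> E")
          case True
          then show ?thesis using xy out by (auto simp: k_def split: if_splits)
        next
          case False
          then obtain i j where "x = \<tau> i" "y = \<tau> j" "i \<in> Df" "j \<in> Df" using xy by auto
          then have "\<tau>' i = \<tau>' j" using xy(3) k by simp
          then have "i = j" using finitary_inj[OF \<tau>'(1)] by (simp add: injD)
          then show ?thesis using \<open>x = \<tau> i\<close> \<open>y = \<tau> j\<close> by simp
        qed
      qed
      have "finite (E \<union> \<tau> ` Df)" using E Df by simp
      from finitary_extension[OF this inj] obtain g
        where g: "g \<in> finitary_perms" "\<And>x. x \<in> E \<union> \<tau> ` Df \<Longrightarrow> g x = k x" by metis
      have gE: "g x = x" if "x \<in> E" for x using g(2) that by (simp add: k_def)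
      have "rename g u = u" "rename g w = w"
        using rename_eq_self[OF u(1) gE] rename_eq_self[OF w gE] by simp_all
      moreover have "rename g (rename \<tau> f) = rename \<tau>' f"
        unfolding rename_rename by (rule rename_cong[OF Df(2)]) (simp add: g(2) k)
      ultimately show ?thesis using stable_p[OF g(1) u(3)] by simp
    qed
    with u show ?thesis by blast
  qed
  then obtain u where u: "\<And>P. P \<in> pat ` finitary_perms \<Longrightarrow> u P \<in> mpolys_in E \<and> u P \<notin> point \<and>
      (\<forall>\<tau> \<in> finitary_perms. pat \<tau> = P \<longrightarrow> u P * (w * rename \<tau> f) \<in> p)" by metis
  define v where "v = prod u (pat ` finitary_perms)"
  have "v \<notin> point" unfolding v_def using u by (intro prime_prod_notin[OF prime_point]) auto
  moreover have "v * (w * rename \<tau> f) \<in> p" if \<tau>: "\<tau> \<in> finitary_perms" for \<tau>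
  proof -
    have P: "pat \<tau> \<in> pat ` finitary_perms" using \<tau> by simp
    have "u (pat \<tau>) * (w * rename \<tau> f) \<in> p" using u[OF P] \<tau> by blast
    from ideal_multr[OF ideal_p this, of "prod u (pat ` finitary_perms - {pat \<tau>})"] show ?thesis
      unfolding v_def prod.remove[OF finP P] by (simp add: ac_simps)
  qed
  ultimately show ?thesis by blast
qed

text \<open>The converse of \<open>taylor_of_pm\<close>; this is where \<open>\<SS>\<close>-primality is used. The finite set \<open>E\<close> contains the
  variables of denominators for relations \<open>w' * eps j ^ e j \<in> pm\<close>, one for each infinite block; transpositions
  give the relation for any other \<open>j\<close>, with a denominator that involves only \<open>j\<close> besides \<open>E\<close>.\<close>

lemma in_p_if_taylor:
  assumes w: "minimal D w"
    and f: "\<And>\<tau>. \<tau> \<in> finitary_perms \<Longrightarrow> taylor \<pi> (rename \<tau> f) \<in> Qset (\<lambda>i. expo w (\<pi> i)) q"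
  shows "f \<in> p"
proof -
  note a = minimal_adapted[OF w]
  have D: "finite D" "fin_part \<subseteq> D" "base ` I \<subseteq> D" using a by (auto simp: adapted_def)
  define e where "e i = expo w (\<pi> i)" for i
  have e1: "1 \<le> e i" for i unfolding e_def by (rule expo_ge_1[OF a])
  define H where "H = {lookup (taylor \<pi> (rename \<tau> f)) m | \<tau> m. True} \<inter> q"
  have finH: "finite H" using finite_taylor_coefficients[of \<pi> f] finite_I by (simp add: H_def range_pi)
  have H_in: "h \<in> mpolys_in I" if "h \<in> H" for h
    using that lookup_taylor_in_I by (auto simp: H_def)
  have "\<exists>y \<in> mpolys_in D. w * y \<notin> pm \<and> (\<forall>x \<in> rename base ` H. w * y * x \<in> pm)"
  proof (rule annihilating_multiple[OF ideal_pm])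
    show "w \<notin> pm" using a by (simp add: adapted_def)
    show "rename base ` H \<subseteq> mpolys_in D" using D(3) by (auto intro!: rename_in'[OF H_in])
    show "\<exists>n. w * x ^ n \<in> pm" if x: "x \<in> rename base ` H" for x
    proof -
      have "x \<in> point" using x H_in rename_base_in_point by (auto simp: H_def)
      then show ?thesis using pm_nilpotent[of x] ideal_multl[OF ideal_pm] by blast
    qed
  qed (simp add: finH)
  then obtain y where y: "y \<in> mpolys_in D" "w * y \<notin> pm" "\<And>h. h \<in> H \<Longrightarrow> w * y * rename base h \<in> pm"
    by blast
  define w' where "w' = w * y"
  have a': "adapted D w'" unfolding w'_def by (rule adapted_mult[OF a y(1,2)])
  have kill: "w' * eps x ^ e x \<in> pm" for x
    using minimal_expo[OF w, of D y "\<pi> x"] a' by (intro expo_kill[OF a']) (simp add: e_def w'_def)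
  have w'D: "w' \<in> mpolys_in D" using a' by (simp add: adapted_def)
  \<comment> \<open>one variable outside \<open>D\<close> in each infinite block\<close>
  have "\<exists>j. \<pi> j = \<beta> \<and> j \<notin> D" if "\<beta> \<in> inf_blocks" for \<beta>
  proof -
    have "infinite (\<pi> -` {\<beta>} - D)" using that D(1) by (simp add: inf_blocks_def)
    then obtain j where "j \<in> \<pi> -` {\<beta>} - D" using infinite_imp_nonempty by blast
    then show ?thesis by auto
  qed
  then obtain jb where jb: "\<And>\<beta>. \<beta> \<in> inf_blocks \<Longrightarrow> \<pi> (jb \<beta>) = \<beta> \<and> jb \<beta> \<notin> D" by metis
  define K where "K = (\<lambda>h. w' * rename base h) ` H \<union> (\<lambda>j. w' * eps j) ` D \<union>
    (\<lambda>\<beta>. w' * eps (jb \<beta>) ^ e (jb \<beta>)) ` inf_blocks"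
  have "finite K" using finH D(1) finite_inf_blocks by (simp add: K_def)
  moreover have "K \<subseteq> pm" using y(3) kill a' by (auto simp: K_def w'_def adapted_def)
  ultimately obtain D1 where D1: "finite D1" "K \<subseteq> pE D1" using finite_pm_subset by blast
  have "finite (D \<union> D1 \<union> jb ` inf_blocks)" using D(1) D1 finite_inf_blocks by simp
  from ex_large[OF this] obtain E where E: "large E" "D \<union> D1 \<union> jb ` inf_blocks \<subseteq> E"
    by metis
  have finE: "finite E" and baseE: "base ` I \<subseteq> E" using E by (auto simp: large_def)
  have K: "K \<subseteq> pE E" using D1(2) E(2) pE_mono[of D1 E] by auto
  have killE: "w' * eps j ^ e j \<in> pE (insert j E)" for j
  proof (cases "j \<in> D")
    case True
    then have "w' * eps j \<in> pE E" using K by (auto simp: K_def)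
    from ideal_multr[OF ideal_pE this, of "eps j ^ (e j - 1)"] e1[of j]
    have "w' * eps j ^ e j \<in> pE E" by (cases "e j") (simp_all add: ac_simps)
    then show ?thesis by (rule pE_mono[rotated]) auto
  next
    case False
    then have inf: "\<pi> j \<in> inf_blocks" using D(2) notin_fin_part by blast
    define i where "i = jb (\<pi> j)"
    have i: "\<pi> i = \<pi> j" "i \<notin> D" "i \<in> E" using jb[OF inf] E(2) inf by (auto simp: i_def)
    have "w' * eps i ^ e i \<in> pE E" using K inf by (auto simp: K_def i_def)
    then obtain u where u: "u \<in> mpolys_in E" "u \<notin> point" "u * (w' * eps i ^ e i) \<in> p"
      by (auto simp: pE_def)
    let ?t = "transpose i j"
    have "base (\<pi> i) \<in> D" using D(3) by auto
    then have "rename ?t (eps i) = eps j"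
      using i False by (subst rename_eps) (auto simp: transpose_def)
    moreover have "rename ?t w' = w'"
      using w'D by (rule rename_eq_self) (use i False in \<open>auto simp: transpose_def\<close>)
    moreover have "e i = e j" by (simp add: e_def i)
    ultimately have "rename ?t u * (w' * eps j ^ e j) \<in> p"
      using stable_p[OF finitary_transpose[of i j] u(3)] by simp
    moreover have "rename ?t u \<in> mpolys_in (insert j E)"
      by (rule rename_in'[OF u(1)]) (use i in \<open>auto simp: transpose_def\<close>)
    moreover have "rename ?t u \<notin> point" using u(2) point_stable[OF transpose_pi[OF i(1)]] by simp
    ultimately show ?thesis by (auto simp: pE_def)
  qed
  have "w' * rename \<tau> f \<in> pE E" if \<tau>: "\<tau> \<in> finitary_perms" for \<tau>
  proof (rule ccontr)
    assume notin: "w' * rename \<tau> f \<notin> pE E"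
    obtain Dt where Dt: "finite Dt" "rename \<tau> f \<in> mpolys_in Dt" using finite_support by blast
    define L where "L = Dt - E"
    have finL: "finite L" using Dt by (simp add: L_def)
    have "\<exists>n. (\<Prod>\<beta>\<in>inf_blocks. Var j - Var (base \<beta>)) ^ n \<in> pE E" if "j \<in> L" for j
      using pE_nilpotent_prod[OF E(1)] that by (simp add: L_def)
    from component_choice[OF ideal_pE finite_inf_blocks notin finL, of "\<lambda>j \<beta>. Var j - Var (base \<beta>)", OF this]
    obtain y \<theta> where y: "w' * rename \<tau> f * y \<notin> pE E"
      and \<theta>: "\<And>j. j \<in> L \<Longrightarrow> \<theta> j \<in> inf_blocks"
        "\<And>j. j \<in> L \<Longrightarrow> \<exists>k. w' * rename \<tau> f * y * (Var j - Var (base (\<theta> j))) ^ k \<in> pE E"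
      by blast
    have "infinite (\<pi> -` {\<theta> j})" if "j \<in> L" for j using \<theta>(1)[OF that] by (simp add: inf_blocks_def)
    from distinct_representatives[OF finL finE, of "\<lambda>j. \<pi> -` {\<theta> j}", OF this]
    obtain k where k: "inj_on k L" "\<And>j. j \<in> L \<Longrightarrow> \<pi> (k j) = \<theta> j \<and> k j \<notin> E" by auto
    have inj: "inj_on (\<lambda>x. if x \<in> E then x else k x) (E \<union> L)"
      using k by (auto simp: inj_on_def)
    have "finite (E \<union> L)" using finE finL by simp
    from finitary_extension[OF this inj] obtain g where g: "g \<in> finitary_perms"
      "\<And>x. x \<in> E \<union> L \<Longrightarrow> g x = (if x \<in> E then x else k x)" by metis
    have gE: "g x = x" if "x \<in> E" for x using g(2) that by simp
    have gL: "\<pi> (g j) = \<theta> j" if "j \<in> L" for j using g(2)[of j] k(2)[OF that] that by (auto simp: L_def)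
    have g\<tau>: "(\<lambda>i. g (\<tau> i)) \<in> finitary_perms" by (rule finitary_comp[OF g(1) \<tau>])
    define f' where "f' = rename (\<lambda>i. g (\<tau> i)) f"
    have f'_eq: "f' = rename g (rename \<tau> f)" by (simp add: f'_def rename_rename)
    have gw: "rename g w' = w'" using w'D by (rule rename_eq_self) (use gE E(2) in auto)
    \<comment> \<open>the chosen component of \<open>w' * rename \<tau> f\<close>, moved to the generic point\<close>
    define z where "z = w' * f' * rename g y"
    have z_eq: "z = rename g (w' * rename \<tau> f * y)" by (simp add: z_def gw f'_eq)
    have "z \<notin> pE E"
    proof
      assume "z \<in> pE E"
      have "inv_into UNIV g x = x" if "x \<in> E" for x
        using gE[OF that] finitary_inv_cancel(2)[OF g(1), of x] by simp
      from pE_stable[OF finitary_inv[OF g(1)] this \<open>z \<in> pE E\<close>] y show False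
        by (simp add: z_eq rename_rename finitary_inv_cancel[OF g(1)] del: rename_simps)
    qed
    define Y where "Y = E \<union> g ` L"
    have finY: "finite Y" using finE finL by (simp add: Y_def)
    have "g ` Dt \<subseteq> Y" using gE by (auto simp: Y_def L_def)
    then have f'Y: "f' \<in> mpolys_in Y" unfolding f'_eq by (rule rename_in'[OF Dt(2)])
    have nil: "\<exists>k. z * eps j ^ k \<in> pE E" if jY: "j \<in> Y" for j
    proof (cases "j \<in> E")
      case True
      then show ?thesis
        using pE_nilpotent[OF E(1) eps_in[OF _ baseE] eps_in_point] ideal_multl[OF ideal_pE] by blast
    next
      case False
      then obtain i where i: "i \<in> L" "j = g i" using jY by (auto simp: Y_def)
      from \<theta>(2)[OF i(1)] obtain k where
        "w' * rename \<tau> f * y * (Var i - Var (base (\<theta> i))) ^ k \<in> pE E" by blast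
      from pE_stable[OF g(1) gE this]
      have "z * rename g ((Var i - Var (base (\<theta> i))) ^ k) \<in> pE E" by (simp add: z_eq)
      moreover have "g (base (\<theta> i)) = base (\<theta> i)"
        using \<theta>(1)[OF i(1)] inf_blocks_subset baseE by (intro gE) auto
      ultimately have "z * eps j ^ k \<in> pE E" by (simp add: eps_def i gL)
      then show ?thesis ..
    qed
    have T: "taylor \<pi> f' \<in> Qset e q" using f[OF g\<tau>] by (simp add: f'_def e_def[abs_def])
    have "w' * f' \<in> pE Y"
    proof -
      have "w' * f' = (\<Sum>m \<in> keys (taylor \<pi> f'). w' * (rename base (lookup (taylor \<pi> f') m) *
          (\<Prod>x \<in> keys m. eps x ^ lookup m x)))"
        by (subst taylor_eps) (simp add: sum_distrib_left)
      also have "\<dots> \<in> pE Y"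
      proof (rule ideal_sum[OF ideal_pE])
        fix m assume m: "m \<in> keys (taylor \<pi> f')"
        let ?c = "lookup (taylor \<pi> f') m"
        show "w' * (rename base ?c * (\<Prod>x \<in> keys m. eps x ^ lookup m x)) \<in> pE Y"
        proof (cases "\<forall>x. lookup m x < e x")
          case True
          then have "?c \<in> q" by (intro QsetD[OF T]) auto
          then have "?c \<in> H" unfolding H_def f'_def by blast
          then have "w' * rename base ?c \<in> pE E" using K by (auto simp: K_def)
          then have "w' * rename base ?c \<in> pE Y" by (rule pE_mono[rotated]) (simp add: Y_def)
          from ideal_multr[OF ideal_pE this] show ?thesis by (simp add: mult.assoc)
        next
          case False
          then obtain x where x: "e x \<le> lookup m x" by (meson not_le)
          then have xk: "x \<in> keys m" using e1[of x] by (auto simp: in_keys_iff)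
          then have "x \<in> Y" using m taylor_in[OF f'Y, of \<pi>] by (auto simp: mpolys_in_def)
          then have "w' * eps x ^ e x \<in> pE Y"
            using killE[of x] by (auto simp: Y_def intro: pE_mono[rotated])
          from ideal_multr[OF ideal_pE this, of "eps x ^ (lookup m x - e x) * rename base ?c *
            (\<Prod>x \<in> keys m - {x}. eps x ^ lookup m x)"]
          have "w' * eps x ^ (e x + (lookup m x - e x)) * (rename base ?c *
            (\<Prod>x \<in> keys m - {x}. eps x ^ lookup m x)) \<in> pE Y"
            by (simp only: power_add ac_simps)
          then show ?thesis using x by (simp add: prod_eps_split[OF xk] ac_simps)
        qed
      qed
      finally show ?thesis .
    qed
    then obtain U where U: "U \<in> mpolys_in Y" "U \<notin> point" "U * (w' * f') \<in> p" by (auto simp: pE_def)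
    have "U * z \<in> pE E"
      using ideal_multr[OF ideal_p U(3), of "rename g y"] by (intro p_subset_pE) (simp add: z_def ac_simps)
    from local_cancel[OF E(1) finY nil U(1,2) this] \<open>z \<notin> pE E\<close> show False by contradiction
  qed
  from uniform_denominator[OF finE _ this] w'D E(2) mpolys_in_mono
  obtain u where u: "u \<notin> point" "\<And>\<tau>. \<tau> \<in> finitary_perms \<Longrightarrow> u * (w' * rename \<tau> f) \<in> p" by blast
  have "u * w' \<in> p \<or> f \<in> p"
    by (rule sprime) (use u(2) in \<open>simp add: ac_simps\<close>)
  moreover have "u * w' \<notin> p"
    using pm_cancel[OF u(1), of w'] a' p_subset_pm by (auto simp: adapted_def)
  ultimately show ?thesis by blast
qed

theorem minimal_describes_p:
  assumes w: "minimal D w"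
  shows "p = {f. \<forall>\<sigma> \<in> finitary_perms. taylor \<pi> (rename \<sigma> f) \<in> Qset (\<lambda>i. expo w (\<pi> i)) q}"
  using taylor_of_pm[OF w p_subset_pm[OF stable_p]] in_p_if_taylor[OF w] by blast

end

section \<open>Comparison of two presentations\<close>

lemma lookup_Var_diff_power_mult_eq_0:
  fixes F :: "('x, 'b::comm_ring_1) mpoly"
  assumes F: "F \<in> mpolys_in S" and x: "x \<notin> S"
  shows "k < lookup m x \<Longrightarrow> lookup ((Var x - Var y) ^ k * F) m = 0"
proof (induction k arbitrary: m)
  case 0
  then have "x \<in> keys m" by (simp add: in_keys_iff)
  then have "\<not> keys m \<subseteq> S" using x by blast
  then show ?case using F by (auto simp: mpolys_in_def in_keys_iff)
next
  case (Suc k)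
  define G where "G = (Var x - Var y) ^ k * F"
  have "lookup (Var z * G) m = 0" for z
  proof (rule lookup_Var_mult_eq_0)
    fix r assume "m = single z 1 + r"
    then show "lookup G r = 0"
      using Suc unfolding G_def by (auto simp: lookup_add lookup_single when_def split: if_splits)
  qed
  moreover have "(Var x - Var y) ^ Suc k * F = Var x * G - Var y * G"
    by (simp add: G_def algebra_simps)
  ultimately show ?case by (simp add: lookup_minus)
qed

lemma lookup_Var_diff_power_mult:
  fixes F :: "('x, 'b::comm_ring_1) mpoly"
  assumes F: "F \<in> mpolys_in S" and x: "x \<notin> S" "x \<noteq> y" and m: "lookup m x = 0"
  shows "lookup ((Var x - Var y) ^ k * F) (m + single x k) = lookup F m"
proof (induction k)
  case (Suc k)
  define G where "G = (Var x - Var y) ^ k * F"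
  have "m + single x (Suc k) = single x 1 + (m + single x k)"
    by (simp add: single_add[symmetric] ac_simps)
  then have "lookup (Var x * G) (m + single x (Suc k)) =
      lookup G (m + single x k)"
    by (metis lookup_Var_mult)
  also have "\<dots> = lookup F m" using Suc by (simp add: G_def)
  finally have "lookup (Var x * G) (m + single x (Suc k)) = lookup F m" .
  moreover have "lookup (Var y * G) (m + single x (Suc k)) = 0"
  proof (rule lookup_Var_mult_eq_0)
    fix r assume "m + single x (Suc k) = single y 1 + r"
    then have "lookup (m + single x (Suc k)) x =
      lookup (single y 1 + r) x" by simp
    then show "lookup G r = 0" using x m unfolding G_def
      by (intro lookup_Var_diff_power_mult_eq_0[OF F x(1)]) (simp add: lookup_add lookup_single when_def)
  qed
  moreover have "(Var x - Var y) ^ Suc k * F = Var x * G - Var y * G"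
    by (simp add: G_def algebra_simps)
  ultimately show ?case by (simp add: lookup_minus)
qed simp

text \<open>If \<open>F\<close> does not involve \<open>x\<close>, the coefficient of \<open>(x - y)\<^sup>k F\<close> at \<open>x\<^sup>k\<close> is \<open>F\<close>, so the power must
  be at least \<open>E x\<close> to bring \<open>F\<close> into the ideal.\<close>

lemma Qset_free_variable:
  assumes q: "ideal_set q" and F: "F \<in> mpolys_in S" "F \<notin> Qset E q" and x: "x \<notin> S" "x \<noteq> y"
    and mem: "(Var x - Var y) ^ k * F \<in> Qset E q"
  shows "E x \<le> k"
proof (rule ccontr)
  assume k: "\<not> E x \<le> k"
  obtain m where m: "\<And>z. lookup m z < E z" "lookup F m \<notin> q"
    using F(2) by (auto simp: Qset_def)
  have m0: "lookup m x = 0"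
  proof (rule ccontr)
    assume "lookup m x \<noteq> 0"
    then have "lookup F m = 0"
      using lookup_Var_diff_power_mult_eq_0[OF F(1) x(1), of 0 m] by simp
    with m(2) ideal_0[OF q] show False by simp
  qed
  have "lookup ((Var x - Var y) ^ k * F) (m + single x k) \<in> q"
  proof (rule QsetD[OF mem])
    fix z show "lookup (m + single x k) z < E z"
      using m(1)[of z] k m0 by (cases "z = x") (auto simp: lookup_add lookup_single when_def)
  qed
  then show False
    using lookup_Var_diff_power_mult[OF F(1) x m0, of k] m(2) by simp
qed

lemma diff_power_mod:
  fixes x y :: "'b::comm_ring_1"
  shows "\<exists>r. (x - y) ^ k = x ^ k + y * r"
proof (induction k)
  case (Suc k)
  then obtain r where "(x - y) ^ k = x ^ k + y * r" ..
  then have "(x - y) ^ Suc k = x ^ Suc k + y * (x * r - x ^ k - y * r)"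
    by (simp add: algebra_simps)
  then show ?case ..
qed (auto intro: exI[of _ 0])

text \<open>Each factor is congruent to a multiple of \<open>y\<close>, so enough factors give a vanishing power of \<open>y\<close>.\<close>

lemma prod_diff_powers_in_Qset:
  fixes q :: "'b::comm_ring_1 set" and E :: "'x \<Rightarrow> nat"
  assumes q: "ideal_set q" and L: "finite L" and E: "\<And>j. j \<in> L \<Longrightarrow> E j \<le> k" and y: "E y \<le> card L"
  shows "(\<Prod>j\<in>L. (Var j - Var y) ^ k) \<in> Qset E q"
proof -
  note J = Qset_ideal[OF q, of E]
  have "\<exists>r. (\<Prod>j\<in>L. (Var j - Var y) ^ k) - Var y ^ card L * r \<in> Qset E q"
    using L E
  proof (induction L rule: finite_induct)
    case empty
    show ?case by (rule exI[of _ 1]) (simp add: ideal_0[OF J])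
  next
    case (insert j L)
    then obtain r where r: "(\<Prod>j\<in>L. (Var j - Var y) ^ k) - Var y ^ card L * r \<in> Qset E q" by auto
    obtain t :: "('x, 'b) mpoly" where t: "(Var j - Var y) ^ k = Var j ^ k + Var y * t"
      using diff_power_mod by blast
    have j: "Var j ^ k \<in> Qset E q" using insert.prems by (intro Var_power_in_Qset[OF q]) simp
    have "(\<Prod>j\<in>insert j L. (Var j - Var y) ^ k) - Var y ^ card (insert j L) * (t * r) =
        Var j ^ k * (\<Prod>j\<in>L. (Var j - Var y) ^ k) +
        Var y * t * ((\<Prod>j\<in>L. (Var j - Var y) ^ k) - Var y ^ card L * r)"
      using insert.hyps by (simp add: t algebra_simps)
    also have "\<dots> \<in> Qset E q" by (rule ideal_add[OF J ideal_multr[OF J j] ideal_multl[OF J r]])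
    finally show ?case by blast
  qed
  then obtain r where "(\<Prod>j\<in>L. (Var j - Var y) ^ k) - Var y ^ card L * r \<in> Qset E q" ..
  moreover have "Var y ^ card L * r \<in> Qset E q"
    by (rule ideal_multr[OF J Var_power_in_Qset[where E = E and x = y, OF q y]])
  ultimately have "(\<Prod>j\<in>L. (Var j - Var y) ^ k) - Var y ^ card L * r + Var y ^ card L * r \<in> Qset E q"
    by (rule ideal_add[OF J])
  then show ?thesis by simp
qed

text \<open>The ideal attached to a triple, in terms of Taylor coefficients.\<close>

definition sym_ideal_of :: "(nat \<Rightarrow> 'i) \<Rightarrow> ('i \<Rightarrow> nat) \<Rightarrow> ('i, 'a::comm_ring_1) mpoly set \<Rightarrow> (nat, 'a) mpoly set" where
  "sym_ideal_of \<pi> e q = {f. \<forall>\<sigma> \<in> finitary_perms. taylor \<pi> (rename \<sigma> f) \<in> Qset (\<lambda>i. e (\<pi> i)) q}"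

context config
begin

lemma exponent_bound: "\<exists>M. \<forall>i. e (\<pi> i) \<le> (M::nat)"
proof -
  have "finite ((\<lambda>i. e (\<pi> i)) ` UNIV)"
    by (rule finite_subset[of _ "e ` I"]) (use finite_I in auto)
  then have "e (\<pi> i) \<le> Max ((\<lambda>i. e (\<pi> i)) ` UNIV)" for i by (rule Max_ge) simp
  then show ?thesis by blast
qed

lemma uniform_nilpotency:
  "\<exists>n. \<forall>\<sigma> \<in> finitary_perms. rename \<sigma> f \<in> point \<longrightarrow> taylor \<pi> (rename \<sigma> f) ^ n \<in> Qset (\<lambda>i. e (\<pi> i)) q"
proof -
  obtain D where D: "finite D" "f \<in> mpolys_in D" using finite_support by blast
  obtain M where M: "\<And>i. e (\<pi> i) \<le> M" using exponent_bound by blast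
  have "taylor \<pi> (rename \<sigma> f) ^ Suc (card D * M) \<in> Qset (\<lambda>i. e (\<pi> i)) q"
    if \<sigma>: "\<sigma> \<in> finitary_perms" and f: "rename \<sigma> f \<in> point" for \<sigma>
  proof -
    have "card (\<sigma> ` D) = card D"
      by (rule card_image) (rule inj_on_subset[OF finitary_inj[OF \<sigma>]], simp)
    moreover have "taylor \<pi> (rename \<sigma> f) ^ Suc (card (\<sigma> ` D) * M) \<in> Qset (\<lambda>i. e (\<pi> i)) q"
      by (rule Qset_nilpotent[OF ideal_q taylor_in[OF rename_in[OF D(2)]]])
        (use f D(1) M in \<open>simp_all add: point_def lookup_0_taylor\<close>)
    ultimately show ?thesis by simp
  qed
  then show ?thesis by blast
qed

lemma taylor_primary:
  assumes "f \<notin> point" "taylor \<pi> f * G \<in> Qset E q"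
  shows "G \<in> Qset E q"
  by (rule Qset_primary[OF prime_q _ assms(2)]) (use assms(1) in \<open>simp add: lookup_0_taylor point_def\<close>)

end

lemma (in sprime_config) common_denominator:
  "finite K \<Longrightarrow> K \<subseteq> pm \<Longrightarrow> \<exists>u. u \<notin> point \<and> (\<forall>k\<in>K. u * k \<in> p)"
proof (induction K rule: finite_induct)
  case empty
  then show ?case using prime_1[OF prime_point] by auto
next
  case (insert x K)
  then obtain u where u: "u \<notin> point" "\<And>k. k \<in> K \<Longrightarrow> u * k \<in> p" by auto
  obtain v where v: "v \<notin> point" "v * x \<in> p" using insert.prems by (auto simp: pm_def)
  have "u * v * k \<in> p" if "k \<in> insert x K" for k
  proof (cases "k = x")
    case True
    then show ?thesis using ideal_multl[OF ideal_p v(2), of u] by (simp add: ac_simps)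
  next
    case False
    then have "u * k \<in> p" using u that by auto
    from ideal_multl[OF ideal_p this, of v] show ?thesis by (simp add: ac_simps)
  qed
  with u v show ?case by (intro exI[of _ "u * v"]) (auto simp: prime_mult[OF prime_point])
qed

text \<open>The element \<open>(u * \<Delta>) ^ n * (w' * top)\<close> is not in \<open>p\<close>, so some translate of it is nonzero for the second
  triple. The power \<open>n\<close> ensures that \<open>u\<close> and \<open>\<Delta>\<close> become units there, \<open>\<Delta>\<close> separates the blocks, and the
  relations in \<open>K\<close> determine where the variables go. They also bound the second weighting from above by the
  exponents of \<open>w\<close>; the factor \<open>top\<close> gives the bound from below.\<close>

lemma (in sprime_config) comparison_map:
  fixes I' :: "'j set"
  assumes w: "minimal D w" and B: "config I' \<pi>' q'" and p: "p = sym_ideal_of \<pi>' e' q'"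
  shows "\<exists>\<phi>. inj_on \<phi> I \<and> \<phi> ` I \<subseteq> I' \<and> (\<forall>\<alpha>\<in>inf_blocks. e' (\<phi> \<alpha>) = expo w \<alpha>) \<and>
    (\<forall>\<alpha>\<in>I. ecard (\<pi> -` {\<alpha>}) \<le> ecard (\<pi>' -` {\<phi> \<alpha>})) \<and>
    (\<forall>h\<in>mpolys_in I. h \<in> q \<longrightarrow> rename \<phi> h \<in> q')"
proof -
  interpret B: config I' \<pi>' q' by (rule B)
  note a = minimal_adapted[OF w]
  have D: "finite D" "fin_part \<subseteq> D" "base ` I \<subseteq> D" using a by (auto simp: adapted_def)
  obtain M where M: "\<And>i. e' (\<pi>' i) \<le> M" using B.exponent_bound by blast
  let ?Q = "Qset (\<lambda>i. e' (\<pi>' i)) q'"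
  note J = Qset_ideal[OF B.ideal_q, of "\<lambda>i. e' (\<pi>' i)"]
  \<comment> \<open>witnesses against the maps that do not send \<open>q\<close> into \<open>q'\<close>\<close>
  define bad where "bad = {\<phi> \<in> I \<rightarrow>\<^sub>E I'. \<exists>h\<in>mpolys_in I. h \<in> q \<and> rename \<phi> h \<notin> q'}"
  have finbad: "finite bad"
    by (rule finite_subset[of _ "I \<rightarrow>\<^sub>E I'"])
      (auto simp: bad_def intro!: finite_PiE finite_I B.finite_I)
  have "\<exists>h. h \<in> mpolys_in I \<and> h \<in> q \<and> rename \<phi> h \<notin> q'" if "\<phi> \<in> bad" for \<phi>
    using that by (auto simp: bad_def)
  then obtain hw where hw: "\<And>\<phi>. \<phi> \<in> bad \<Longrightarrow> hw \<phi> \<in> mpolys_in I \<and> hw \<phi> \<in> q \<and> rename \<phi> (hw \<phi>) \<notin> q'"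
    by metis
  define H where "H = (\<lambda>\<phi>. rename base (hw \<phi>)) ` bad"
  have "\<exists>y \<in> mpolys_in D. w * y \<notin> pm \<and> (\<forall>x \<in> H. w * y * x \<in> pm)"
  proof (rule annihilating_multiple[OF ideal_pm])
    show "w \<notin> pm" using a by (simp add: adapted_def)
    show "H \<subseteq> mpolys_in D" using D(3) hw by (auto simp: H_def intro!: rename_in'[of _ I])
    show "\<exists>n. w * x ^ n \<in> pm" if x: "x \<in> H" for x
    proof -
      have "x \<in> point" using x hw rename_base_in_point by (auto simp: H_def)
      then show ?thesis using pm_nilpotent[of x] ideal_multl[OF ideal_pm] by blast
    qed
  qed (simp add: H_def finbad)
  then obtain y where y: "y \<in> mpolys_in D" "w * y \<notin> pm" "\<And>h. h \<in> H \<Longrightarrow> w * y * h \<in> pm"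
    by blast
  define w' where "w' = w * y"
  have a': "adapted D w'" unfolding w'_def by (rule adapted_mult[OF a y(1,2)])
  then have mw': "minimal D w'" unfolding w'_def by (rule minimal_mult[OF w])
  define e where "e = expo w"
  have ex: "expo w' (\<pi> j) = e (\<pi> j)" for j
    using minimal_expo[OF w, of D y "\<pi> j"] a' by (simp add: e_def w'_def)
  have w'D: "w' \<in> mpolys_in D" using a' by (simp add: adapted_def)
  \<comment> \<open>many variables outside \<open>D\<close> in each infinite block\<close>
  define N where "N = Suc (M + card B.fin_part)"
  have "\<exists>L. finite L \<and> card L = N \<and> L \<subseteq> \<pi> -` {\<alpha>} - D" if "\<alpha> \<in> inf_blocks" for \<alpha>
    using that D(1) infinite_arbitrarily_large[of "\<pi> -` {\<alpha>} - D" N] by (auto simp: inf_blocks_def)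
  then obtain L where L: "\<And>\<alpha>. \<alpha> \<in> inf_blocks \<Longrightarrow> finite (L \<alpha>) \<and> card (L \<alpha>) = N \<and> L \<alpha> \<subseteq> \<pi> -` {\<alpha>} - D"
    by metis
  define LL where "LL = (\<Union>\<alpha>\<in>inf_blocks. L \<alpha>)"
  have finLL: "finite LL" using L finite_inf_blocks by (auto simp: LL_def)
  have LLD: "LL \<inter> D = {}" using L by (auto simp: LL_def)
  define Y where "Y = D \<union> LL"
  have finY: "finite Y" using D(1) finLL by (simp add: Y_def)
  define K where "K = (\<lambda>j. w' * eps j ^ e (\<pi> j)) ` Y \<union> (\<lambda>h. w' * h) ` H"
  have "K \<subseteq> pm"
    using y(3) expo_kill[OF a', of j "e (\<pi> j)" for j] ex by (auto simp: K_def w'_def)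
  moreover have "finite K" using finY finbad by (simp add: K_def H_def)
  ultimately obtain u where u: "u \<notin> point" "\<And>k. k \<in> K \<Longrightarrow> u * k \<in> p"
    using common_denominator[of K] by blast
  define W where "W = {(i, j). i \<in> Y \<and> j \<in> Y \<and> \<pi> i \<noteq> \<pi> j}"
  have finW: "finite W" by (rule finite_subset[of _ "Y \<times> Y"]) (use finY in \<open>auto simp: W_def\<close>)
  define \<Delta> where "\<Delta> = (\<Prod>(i, j) \<in> W. Var i - Var j :: (nat, 'a) mpoly)"
  have "\<Delta> \<notin> point"
    unfolding \<Delta>_def by (rule prime_prod_notin[OF prime_point]) (auto simp: W_def Var_diff_in_point)
  then have uD: "u * \<Delta> \<notin> point" using u(1) by (simp add: prime_mult[OF prime_point])
  obtain n where n: "\<And>\<sigma>. \<sigma> \<in> finitary_perms \<Longrightarrow> rename \<sigma> (u * \<Delta>) \<in> B.point \<Longrightarrow>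
      taylor \<pi>' (rename \<sigma> (u * \<Delta>)) ^ n \<in> ?Q"
    using B.uniform_nilpotency[of "u * \<Delta>" e'] by blast
  define top where "top = (\<Prod>j\<in>LL. eps j ^ (e (\<pi> j) - 1))"
  have "adapted (D \<union> LL) (w' * top)"
    using minimal_top[OF mw' finLL LLD] by (simp add: top_def ex)
  then have "w' * top \<notin> pm" by (simp add: adapted_def)
  then have "(u * \<Delta>) ^ n * (w' * top) \<notin> pm"
    using pm_cancel prime_power_notin[OF prime_point uD] by blast
  then have "(u * \<Delta>) ^ n * (w' * top) \<notin> p" using p_subset_pm by blast
  then obtain \<sigma> where \<sigma>: "\<sigma> \<in> finitary_perms"
    and notin: "taylor \<pi>' (rename \<sigma> ((u * \<Delta>) ^ n * (w' * top))) \<notin> ?Q"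
    unfolding p sym_ideal_of_def by blast
  define T where "T f = taylor \<pi>' (rename \<sigma> f)" for f :: "(nat, 'a) mpoly"
  have T_mult: "T (f * g) = T f * T g" and T_power: "T (f ^ k) = T f ^ k" for f g k
    by (simp_all add: T_def)
  have notin: "T (u * \<Delta>) ^ n * (T w' * T top) \<notin> ?Q"
    using notin by (simp add: T_def)
  have \<sigma>uD: "rename \<sigma> (u * \<Delta>) \<notin> B.point"
  proof
    assume "rename \<sigma> (u * \<Delta>) \<in> B.point"
    from n[OF \<sigma> this] have "T (u * \<Delta>) ^ n \<in> ?Q" by (simp add: T_def)
    then show False using notin ideal_multr[OF J] by blast
  qed
  then have \<sigma>u: "rename \<sigma> u \<notin> B.point" and \<sigma>D: "rename \<sigma> \<Delta> \<notin> B.point"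
    by (simp_all add: prime_mult[OF B.prime_point])
  have wtop: "T w' * T top \<notin> ?Q" using notin ideal_multl[OF J] by blast
  then have w'Q: "T w' \<notin> ?Q" using ideal_multr[OF J] by blast
  have K_Q: "T k \<in> ?Q" if "k \<in> K" for k
  proof -
    have "u * k \<in> sym_ideal_of \<pi>' e' q'" using u(2)[OF that] p by simp
    then have "T (u * k) \<in> ?Q" using \<sigma> by (simp add: sym_ideal_of_def T_def)
    then show ?thesis using B.taylor_primary[OF \<sigma>u] by (simp add: T_def)
  qed
  have unit: "f \<notin> B.point \<Longrightarrow> T w' * taylor \<pi>' f \<notin> ?Q" for f
    using B.taylor_primary[of f "T w'"] w'Q by (metis mult.commute)
  define \<phi> where "\<phi> \<alpha> = \<pi>' (\<sigma> (base \<alpha>))" for \<alpha>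
  have blocks: "\<pi>' (\<sigma> j) = \<phi> (\<pi> j)" if "j \<in> Y" for j
  proof (rule ccontr)
    assume "\<pi>' (\<sigma> j) \<noteq> \<phi> (\<pi> j)"
    then have "rename \<sigma> (eps j) \<notin> B.point"
      by (simp add: eps_def B.Var_diff_in_point \<phi>_def)
    then have "rename \<sigma> (eps j) ^ e (\<pi> j) \<notin> B.point" by (rule prime_power_notin[OF B.prime_point])
    from unit[OF this] have "T (w' * eps j ^ e (\<pi> j)) \<notin> ?Q" by (simp add: T_def)
    moreover have "w' * eps j ^ e (\<pi> j) \<in> K" using that by (simp add: K_def)
    ultimately show False using K_Q by blast
  qed
  have inj: "inj_on \<phi> I"
  proof (rule inj_onI, rule ccontr)
    fix \<alpha> \<beta> assume \<alpha>\<beta>: "\<alpha> \<in> I" "\<beta> \<in> I" "\<phi> \<alpha> = \<phi> \<beta>" "\<alpha> \<noteq> \<beta>"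
    let ?i = "base \<alpha>" and ?j = "base \<beta>"
    have ij: "(?i, ?j) \<in> W" using \<alpha>\<beta> D(3) by (auto simp: W_def Y_def)
    have "rename \<sigma> \<Delta> = (Var (\<sigma> ?i) - Var (\<sigma> ?j)) * rename \<sigma> (\<Prod>(i, j) \<in> W - {(?i, ?j)}. Var i - Var j)"
      unfolding \<Delta>_def by (subst prod.remove[OF finW ij]) simp
    moreover have "Var (\<sigma> ?i) - Var (\<sigma> ?j) \<in> B.point"
      using \<alpha>\<beta>(3) by (simp add: B.Var_diff_in_point \<phi>_def)
    ultimately show False using \<sigma>D ideal_multr[OF B.ideal_point] by simp
  qed
  have sub: "\<phi> ` I \<subseteq> I'" by (auto simp: \<phi>_def)
  have injs: "inj_on \<sigma> S" for S by (rule inj_on_subset[OF finitary_inj[OF \<sigma>]]) simp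
  have Lim: "\<sigma> ` L \<alpha> \<subseteq> \<pi>' -` {\<phi> \<alpha>}" if "\<alpha> \<in> inf_blocks" for \<alpha>
    using L[OF that] blocks that by (auto simp: Y_def LL_def)
  have inf: "\<phi> \<alpha> \<in> B.inf_blocks" if \<alpha>: "\<alpha> \<in> inf_blocks" for \<alpha>
  proof (rule ccontr)
    assume "\<phi> \<alpha> \<notin> B.inf_blocks"
    then have "j \<in> B.fin_part" if "\<pi>' j = \<phi> \<alpha>" for j
      using that B.notin_fin_part[of j] by auto
    then have "\<sigma> ` L \<alpha> \<subseteq> B.fin_part" using Lim[OF \<alpha>] by blast
    then have "card (\<sigma> ` L \<alpha>) \<le> card B.fin_part" by (rule card_mono[OF B.finite_fin_part])
    then show False using L[OF \<alpha>] by (simp add: card_image[OF injs] N_def)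
  qed
  have sizes: "ecard (\<pi> -` {\<alpha>}) \<le> ecard (\<pi>' -` {\<phi> \<alpha>})" if \<alpha>: "\<alpha> \<in> I" for \<alpha>
  proof (cases "\<alpha> \<in> inf_blocks \<or> infinite (\<pi>' -` {\<phi> \<alpha>})")
    case True
    then show ?thesis using inf by (auto simp: ecard_def B.inf_blocks_def)
  next
    case False
    then have "\<pi> -` {\<alpha>} \<subseteq> Y" using D(2) notin_fin_part by (auto simp: Y_def)
    then have "\<sigma> ` (\<pi> -` {\<alpha>}) \<subseteq> \<pi>' -` {\<phi> \<alpha>}" using blocks by auto
    then have "card (\<sigma> ` (\<pi> -` {\<alpha>})) \<le> card (\<pi>' -` {\<phi> \<alpha>})" using False by (intro card_mono) auto
    then show ?thesis using False \<alpha> by (simp add: ecard_def card_image[OF injs] inf_blocks_def)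
  qed
  have primes: "rename \<phi> h \<in> q'" if h: "h \<in> mpolys_in I" "h \<in> q" for h
  proof (rule ccontr)
    assume no: "rename \<phi> h \<notin> q'"
    let ?r = "restrict \<phi> I"
    have r: "rename ?r k = rename \<phi> k" if "k \<in> mpolys_in I" for k
      using that by (rule rename_cong) simp
    have "?r \<in> bad" using no h sub r[OF h(1)] by (auto simp: bad_def)
    then have k: "hw ?r \<in> mpolys_in I" "rename \<phi> (hw ?r) \<notin> q'" "w' * rename base (hw ?r) \<in> K"
      using hw[of ?r] r[of "hw ?r"] by (auto simp: K_def H_def)
    have "rename \<sigma> (rename base (hw ?r)) \<notin> B.point"
      using k(2) by (simp add: B.point_def rename_rename \<phi>_def[abs_def])
    from unit[OF this] K_Q[OF k(3)] show False by (simp add: T_def)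
  qed
  have expos: "e' (\<phi> \<alpha>) = e \<alpha>" if \<alpha>: "\<alpha> \<in> inf_blocks" for \<alpha>
  proof -
    have \<alpha>I: "\<alpha> \<in> I" using \<alpha> inf_blocks_subset by auto
    let ?y = "\<sigma> (base \<alpha>)"
    have Teps: "T (eps j) = Var (\<sigma> j) - Var ?y" if "j \<in> L \<alpha>" for j
    proof -
      have "\<pi> j = \<alpha>" "j \<in> Y" using that L[OF \<alpha>] \<alpha> by (auto simp: Y_def LL_def)
      then show ?thesis using blocks[of j] by (simp add: T_def eps_def \<phi>_def)
    qed
    have sup: "T w' \<in> mpolys_in (\<sigma> ` D)" unfolding T_def by (intro taylor_in rename_in w'D)
    have "L \<alpha> \<noteq> {}" using L[OF \<alpha>] by (auto simp: N_def)
    then obtain j where j: "j \<in> L \<alpha>" by blast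
    have jD: "j \<notin> D" "\<pi> j = \<alpha>" and jY: "j \<in> Y" using j L[OF \<alpha>] \<alpha> by (auto simp: Y_def LL_def)
    have "\<sigma> j \<notin> \<sigma> ` D" using jD(1) finitary_inj[OF \<sigma>] by (auto dest: injD)
    moreover have "\<sigma> j \<noteq> ?y" using jD(1) D(3) \<alpha>I finitary_inj[OF \<sigma>] by (auto dest: injD)
    moreover have "(Var (\<sigma> j) - Var ?y) ^ e \<alpha> * T w' \<in> ?Q"
    proof -
      have "w' * eps j ^ e \<alpha> \<in> K" using jY jD(2) by (auto simp: K_def)
      from K_Q[OF this] show ?thesis by (simp add: T_mult T_power Teps[OF j] mult.commute)
    qed
    ultimately have "e' (\<pi>' (\<sigma> j)) \<le> e \<alpha>" by (rule Qset_free_variable[OF B.ideal_q sup w'Q])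
    then have le: "e' (\<phi> \<alpha>) \<le> e \<alpha>" using blocks[OF jY] jD(2) by simp
    have "\<not> e' (\<phi> \<alpha>) < e \<alpha>"
    proof
      assume less: "e' (\<phi> \<alpha>) < e \<alpha>"
      have "(\<Prod>i\<in>\<sigma> ` L \<alpha>. (Var i - Var ?y) ^ (e \<alpha> - 1)) \<in> ?Q"
      proof (rule prod_diff_powers_in_Qset[OF B.ideal_q])
        show "e' (\<pi>' i) \<le> e \<alpha> - 1" if "i \<in> \<sigma> ` L \<alpha>" for i
          using that Lim[OF \<alpha>] less by auto
        show "e' (\<pi>' ?y) \<le> card (\<sigma> ` L \<alpha>)"
          using M[of ?y] L[OF \<alpha>] by (simp add: card_image[OF injs] N_def)
      qed (use L[OF \<alpha>] in simp)
      also have "(\<Prod>i\<in>\<sigma> ` L \<alpha>. (Var i - Var ?y) ^ (e \<alpha> - 1)) = (\<Prod>j\<in>L \<alpha>. T (eps j ^ (e (\<pi> j) - 1)))"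
        unfolding prod.reindex[OF injs] comp_def
        by (rule prod.cong) (use L[OF \<alpha>] in \<open>auto simp: T_power Teps\<close>)
      finally have 1: "(\<Prod>j\<in>L \<alpha>. T (eps j ^ (e (\<pi> j) - 1))) \<in> ?Q" .
      have "T top = (\<Prod>j\<in>LL. T (eps j ^ (e (\<pi> j) - 1)))" by (simp add: top_def T_def)
      also have "\<dots> = (\<Prod>j\<in>LL - L \<alpha>. T (eps j ^ (e (\<pi> j) - 1))) * (\<Prod>j\<in>L \<alpha>. T (eps j ^ (e (\<pi> j) - 1)))"
        by (rule prod.subset_diff) (use \<alpha> finLL in \<open>auto simp: LL_def\<close>)
      also have "\<dots> \<in> ?Q" by (rule ideal_multl[OF J 1])
      finally show False using wtop ideal_multl[OF J] by blast
    qed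
    with le show ?thesis by simp
  qed
  from inj sub expos sizes primes show ?thesis unfolding e_def by blast
qed


subsection \<open>Uniqueness up to isomorphism\<close>

text \<open>An \<open>\<SS>\<close>-prime together with a triple, whose weighting is reduced, that describes it.\<close>

locale presentation = config I \<pi> q + sym_prime_ideal p
  for I :: "'i set" and \<pi> :: "nat \<Rightarrow> 'i" and q :: "('i, 'a::comm_ring_1) mpoly set"
    and p :: "(nat, 'a) mpoly set" +
  fixes e :: "'i \<Rightarrow> nat"
  assumes e_ge_1: "\<alpha> \<in> I \<Longrightarrow> 1 \<le> e \<alpha>"
    and e_reduced: "\<alpha> \<in> I \<Longrightarrow> finite (\<pi> -` {\<alpha>}) \<Longrightarrow> e \<alpha> = 1"
    and p_eq: "p = sym_ideal_of \<pi> e q"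
begin

sublocale sprime_config I \<pi> q p
proof
  show "p \<subseteq> orbit_ideal"
  proof
    fix f assume f: "f \<in> p"
    have "rename \<pi> (rename \<sigma> f) \<in> q" if "\<sigma> \<in> finitary_perms" for \<sigma>
    proof -
      have "taylor \<pi> (rename \<sigma> f) \<in> Qset (\<lambda>i. e (\<pi> i)) q"
        using f that by (simp add: p_eq sym_ideal_of_def)
      moreover have "lookup 0 i < e (\<pi> i)" for i
        using e_ge_1[of "\<pi> i"] by simp
      ultimately have "lookup (taylor \<pi> (rename \<sigma> f)) 0 \<in> q" by (rule QsetD)
      then show ?thesis by (simp add: lookup_0_taylor)
    qed
    then show "f \<in> orbit_ideal" by (simp add: orbit_ideal_def point_def)
  qed
  show "\<exists>n. f ^ n \<in> p" if "f \<in> orbit_ideal" for f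
    using uniform_nilpotency[of f e] that by (auto simp: p_eq sym_ideal_of_def orbit_ideal_def)
qed

end

lemma permutes_monotone_eq:
  fixes F :: "'i \<Rightarrow> 'b::order"
  assumes \<phi>: "\<phi> permutes I" "finite I" and mono: "\<And>\<alpha>. \<alpha> \<in> I \<Longrightarrow> F \<alpha> \<le> F (\<phi> \<alpha>)" and \<alpha>: "\<alpha> \<in> I"
  shows "F (\<phi> \<alpha>) = F \<alpha>"
proof -
  obtain k where k: "k > 0" "\<phi> ^^ k = id" using permutes_finite_order[OF \<phi>] by blast
  have step: "\<beta> \<in> I \<Longrightarrow> F \<beta> \<le> F ((\<phi> ^^ n) \<beta>)" for \<beta> n
  proof (induction n)
    case (Suc n)
    have "(\<phi> ^^ n) \<beta> \<in> I" using Suc.prems permutes_in_image[OF permutes_funpow[OF \<phi>(1)]] by simp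
    from mono[OF this] Suc show ?case by (auto intro: order_trans)
  qed simp
  have "F (\<phi> \<alpha>) \<le> F ((\<phi> ^^ (k - 1)) (\<phi> \<alpha>))"
    using \<alpha> permutes_in_image[OF \<phi>(1)] by (intro step) simp
  also have "(\<phi> ^^ (k - 1)) (\<phi> \<alpha>) = (\<phi> ^^ k) \<alpha>"
    using k(1) by (metis Suc_diff_1 comp_apply funpow_Suc_right)
  finally have "F (\<phi> \<alpha>) \<le> F \<alpha>" using k(2) by simp
  with mono[OF \<alpha>] show ?thesis by simp
qed

lemma permutes_prime_reverse:
  assumes \<phi>: "\<phi> permutes I" "finite I" and q: "\<And>h. h \<in> mpolys_in I \<Longrightarrow> h \<in> q \<Longrightarrow> rename \<phi> h \<in> q"
    and h: "h \<in> mpolys_in I" "rename \<phi> h \<in> q"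
  shows "h \<in> q"
proof -
  obtain k where k: "k > 0" "\<phi> ^^ k = id" using permutes_finite_order[OF \<phi>] by blast
  have in_I: "rename (\<phi> ^^ n) h \<in> mpolys_in I" for n
    by (rule rename_in'[OF h(1)]) (simp add: permutes_image[OF permutes_funpow[OF \<phi>(1)]])
  have "rename (\<phi> ^^ Suc n) h \<in> q" for n
  proof (induction n)
    case (Suc n)
    from q[OF in_I Suc] show ?case by (simp add: rename_rename comp_def)
  qed (use h in simp)
  from this[of "k - 1"] k show ?thesis by (simp add: id_def)
qed

lemma extend_to_permutation:
  assumes "inj_on \<phi> I" "\<phi> ` I \<subseteq> I" "finite I"
  shows "(\<lambda>\<alpha>. if \<alpha> \<in> I then \<phi> \<alpha> else \<alpha>) permutes I"
proof (rule bij_imp_permutes)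
  have "\<phi> ` I = I" using assms by (intro endo_inj_surj) auto
  then show "bij_betw (\<lambda>\<alpha>. if \<alpha> \<in> I then \<phi> \<alpha> else \<alpha>) I I"
    using assms(1) by (auto simp: bij_betw_def inj_on_def)
qed auto

text \<open>The exponents of a minimal element for the first triple are compared with both weightings.\<close>

lemma presentation_map:
  fixes I :: "'i set" and I' :: "'j set"
  assumes A: "presentation I \<pi> q p e" and B: "presentation I' \<pi>' q' p e'"
  shows "\<exists>\<psi>. inj_on \<psi> I \<and> \<psi> ` I \<subseteq> I' \<and> (\<forall>\<alpha>\<in>I. infinite (\<pi> -` {\<alpha>}) \<longrightarrow> e' (\<psi> \<alpha>) = e \<alpha>) \<and>
    (\<forall>\<alpha>\<in>I. ecard (\<pi> -` {\<alpha>}) \<le> ecard (\<pi>' -` {\<psi> \<alpha>})) \<and>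
    (\<forall>h\<in>mpolys_in I. h \<in> q \<longrightarrow> rename \<psi> h \<in> q')"
proof -
  interpret A: presentation I \<pi> q p e by (rule A)
  interpret B: presentation I' \<pi>' q' p e' by (rule B)
  obtain D w where w: "A.minimal D w" using A.minimal_exists by blast
  from A.comparison_map[OF w A.config_axioms A.p_eq] obtain \<phi>0 where \<phi>0:
    "inj_on \<phi>0 I" "\<phi>0 ` I \<subseteq> I" "\<And>\<alpha>. \<alpha> \<in> A.inf_blocks \<Longrightarrow> e (\<phi>0 \<alpha>) = A.expo w \<alpha>"
    "\<And>\<alpha>. \<alpha> \<in> I \<Longrightarrow> ecard (\<pi> -` {\<alpha>}) \<le> ecard (\<pi> -` {\<phi>0 \<alpha>})"
    "\<And>h. h \<in> mpolys_in I \<Longrightarrow> h \<in> q \<Longrightarrow> rename \<phi>0 h \<in> q" by metis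
  from A.comparison_map[OF w B.config_axioms B.p_eq] obtain \<phi> where \<phi>:
    "inj_on \<phi> I" "\<phi> ` I \<subseteq> I'" "\<And>\<alpha>. \<alpha> \<in> A.inf_blocks \<Longrightarrow> e' (\<phi> \<alpha>) = A.expo w \<alpha>"
    "\<And>\<alpha>. \<alpha> \<in> I \<Longrightarrow> ecard (\<pi> -` {\<alpha>}) \<le> ecard (\<pi>' -` {\<phi> \<alpha>})"
    "\<And>h. h \<in> mpolys_in I \<Longrightarrow> h \<in> q \<Longrightarrow> rename \<phi> h \<in> q'" by metis
  define \<chi> where "\<chi> \<alpha> = (if \<alpha> \<in> I then \<phi>0 \<alpha> else \<alpha>)" for \<alpha>
  have \<chi>: "\<chi> permutes I"
    using extend_to_permutation[OF \<phi>0(1,2) A.finite_I] by (simp add: \<chi>_def[abs_def])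
  have \<chi>q: "rename \<chi> h \<in> q" if "h \<in> mpolys_in I" "h \<in> q" for h
    using \<phi>0(5)[OF that] rename_cong[OF that(1), of \<chi> \<phi>0] by (simp add: \<chi>_def)
  have size: "ecard (\<pi> -` {\<chi> \<alpha>}) = ecard (\<pi> -` {\<alpha>})" if "\<alpha> \<in> I" for \<alpha>
    by (rule permutes_monotone_eq[OF \<chi> A.finite_I _ that, of "\<lambda>\<alpha>. ecard (\<pi> -` {\<alpha>})"])
      (simp add: \<chi>_def \<phi>0(4))
  define \<eta> where "\<eta> = inv_into UNIV \<chi>"
  have \<eta>: "\<eta> permutes I" unfolding \<eta>_def by (rule permutes_inv[OF \<chi>])
  have \<chi>\<eta>: "\<chi> (\<eta> \<alpha>) = \<alpha>" for \<alpha> unfolding \<eta>_def by (rule permutes_inverses(1)[OF \<chi>])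
  have \<eta>I: "\<eta> \<alpha> \<in> I \<longleftrightarrow> \<alpha> \<in> I" for \<alpha> by (rule permutes_in_image[OF \<eta>])
  have \<eta>size: "ecard (\<pi> -` {\<eta> \<alpha>}) = ecard (\<pi> -` {\<alpha>})" if "\<alpha> \<in> I" for \<alpha>
    using size[of "\<eta> \<alpha>"] that by (simp add: \<chi>\<eta> \<eta>I)
  show ?thesis
  proof (intro exI[of _ "\<lambda>\<alpha>. \<phi> (\<eta> \<alpha>)"] conjI ballI impI)
    show "inj_on (\<lambda>\<alpha>. \<phi> (\<eta> \<alpha>)) I"
      using \<phi>(1) permutes_inj[OF \<eta>] by (auto simp: inj_on_def \<eta>I dest: injD)
    show "(\<lambda>\<alpha>. \<phi> (\<eta> \<alpha>)) ` I \<subseteq> I'" using \<phi>(2) by (auto simp: \<eta>I)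
    fix \<alpha> assume \<alpha>: "\<alpha> \<in> I"
    show "ecard (\<pi> -` {\<alpha>}) \<le> ecard (\<pi>' -` {\<phi> (\<eta> \<alpha>)})"
      using \<phi>(4)[of "\<eta> \<alpha>"] \<alpha> by (simp add: \<eta>I \<eta>size)
    assume "infinite (\<pi> -` {\<alpha>})"
    then have "infinite (\<pi> -` {\<eta> \<alpha>})" using \<eta>size[OF \<alpha>] by (auto simp: ecard_def split: if_splits)
    then have inf: "\<eta> \<alpha> \<in> A.inf_blocks" using \<alpha> by (simp add: A.inf_blocks_def \<eta>I)
    have "e (\<phi>0 (\<eta> \<alpha>)) = e \<alpha>" using \<chi>\<eta>[of \<alpha>] \<alpha> by (simp add: \<chi>_def \<eta>I)
    then show "e' (\<phi> (\<eta> \<alpha>)) = e \<alpha>" using \<phi>(3)[OF inf] \<phi>0(3)[OF inf] by simp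
  next
    fix h assume h: "h \<in> mpolys_in I" "h \<in> q"
    have \<eta>h: "rename \<eta> h \<in> mpolys_in I"
      by (rule rename_in'[OF h(1)]) (simp add: permutes_image[OF \<eta>])
    have "rename \<chi> (rename \<eta> h) = h" by (simp add: rename_rename \<chi>\<eta>)
    then have "rename \<eta> h \<in> q"
      using h(2) by (intro permutes_prime_reverse[OF \<chi> A.finite_I \<chi>q \<eta>h]) simp_all
    from \<phi>(5)[OF \<eta>h this] show "rename (\<lambda>\<alpha>. \<phi> (\<eta> \<alpha>)) h \<in> q'" by (simp add: rename_rename)
  qed
qed

theorem presentation_unique:
  fixes I :: "'i set" and I' :: "'j set"
  assumes A: "presentation I \<pi> q p e" and B: "presentation I' \<pi>' q' p e'"
  shows "\<exists>\<psi>. bij_betw \<psi> I I' \<and>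
    (\<forall>\<alpha>\<in>I. ecard (\<pi>' -` {\<psi> \<alpha>}) = ecard (\<pi> -` {\<alpha>}) \<and> e' (\<psi> \<alpha>) = e \<alpha>) \<and>
    (\<forall>h\<in>mpolys_in I. rename \<psi> h \<in> q' \<longleftrightarrow> h \<in> q)"
proof -
  interpret A: presentation I \<pi> q p e by (rule A)
  interpret B: presentation I' \<pi>' q' p e' by (rule B)
  from presentation_map[OF A B] obtain \<psi> where \<psi>:
    "inj_on \<psi> I" "\<psi> ` I \<subseteq> I'" "\<And>\<alpha>. \<alpha> \<in> I \<Longrightarrow> infinite (\<pi> -` {\<alpha>}) \<Longrightarrow> e' (\<psi> \<alpha>) = e \<alpha>"
    "\<And>\<alpha>. \<alpha> \<in> I \<Longrightarrow> ecard (\<pi> -` {\<alpha>}) \<le> ecard (\<pi>' -` {\<psi> \<alpha>})"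
    "\<And>h. h \<in> mpolys_in I \<Longrightarrow> h \<in> q \<Longrightarrow> rename \<psi> h \<in> q'" by metis
  from presentation_map[OF B A] obtain \<phi> where \<phi>:
    "inj_on \<phi> I'" "\<phi> ` I' \<subseteq> I"
    "\<And>\<alpha>. \<alpha> \<in> I' \<Longrightarrow> ecard (\<pi>' -` {\<alpha>}) \<le> ecard (\<pi> -` {\<phi> \<alpha>})"
    "\<And>h. h \<in> mpolys_in I' \<Longrightarrow> h \<in> q' \<Longrightarrow> rename \<phi> h \<in> q" by metis
  have "card I \<le> card I'" by (rule card_inj_on_le[OF \<psi>(1,2) B.finite_I])
  moreover have "card I' \<le> card I" by (rule card_inj_on_le[OF \<phi>(1,2) A.finite_I])
  ultimately have "\<psi> ` I = I'"
    using \<psi> B.finite_I by (intro card_subset_eq) (auto simp: card_image)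
  then have bij: "bij_betw \<psi> I I'" using \<psi>(1) by (simp add: bij_betw_def)
  define \<chi> where "\<chi> \<alpha> = (if \<alpha> \<in> I then \<phi> (\<psi> \<alpha>) else \<alpha>)" for \<alpha>
  have "inj_on (\<lambda>\<alpha>. \<phi> (\<psi> \<alpha>)) I"
    using comp_inj_on[OF \<psi>(1) inj_on_subset[OF \<phi>(1) \<psi>(2)]] by (simp add: comp_def)
  then have \<chi>: "\<chi> permutes I"
    unfolding \<chi>_def using \<psi>(2) \<phi>(2) A.finite_I by (intro extend_to_permutation) auto
  have sizes: "ecard (\<pi>' -` {\<psi> \<alpha>}) = ecard (\<pi> -` {\<alpha>})" if \<alpha>: "\<alpha> \<in> I" for \<alpha>
  proof -
    have le: "ecard (\<pi>' -` {\<psi> \<beta>}) \<le> ecard (\<pi> -` {\<chi> \<beta>})" if "\<beta> \<in> I" for \<beta>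
      using \<phi>(3)[of "\<psi> \<beta>"] \<psi>(2) that by (auto simp: \<chi>_def)
    have "ecard (\<pi> -` {\<chi> \<alpha>}) = ecard (\<pi> -` {\<alpha>})"
      by (rule permutes_monotone_eq[OF \<chi> A.finite_I _ \<alpha>, of "\<lambda>\<alpha>. ecard (\<pi> -` {\<alpha>})"])
        (use le \<psi>(4) order_trans in blast)
    then show ?thesis using le[OF \<alpha>] \<psi>(4)[OF \<alpha>] by simp
  qed
  have expos: "e' (\<psi> \<alpha>) = e \<alpha>" if \<alpha>: "\<alpha> \<in> I" for \<alpha>
  proof (cases "finite (\<pi> -` {\<alpha>})")
    case True
    then have "finite (\<pi>' -` {\<psi> \<alpha>})" using sizes[OF \<alpha>] by (auto simp: ecard_def split: if_splits)
    then show ?thesis using True A.e_reduced[OF \<alpha>] B.e_reduced[of "\<psi> \<alpha>"] \<psi>(2) \<alpha> by auto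
  qed (use \<psi>(3) \<alpha> in auto)
  have "h \<in> q" if h: "h \<in> mpolys_in I" "rename \<psi> h \<in> q'" for h
  proof (rule permutes_prime_reverse[OF \<chi> A.finite_I _ h(1)])
    have \<chi>q: "rename \<chi> k \<in> q" if k: "k \<in> mpolys_in I" "rename \<psi> k \<in> q'" for k
    proof -
      have "rename \<phi> (rename \<psi> k) \<in> q"
        by (rule \<phi>(4)[OF rename_in'[OF k(1) \<psi>(2)] k(2)])
      also have "rename \<phi> (rename \<psi> k) = rename \<chi> k"
        unfolding rename_rename by (rule rename_cong[OF k(1)]) (simp add: \<chi>_def)
      finally show ?thesis .
    qed
    show "rename \<chi> h \<in> q" by (rule \<chi>q[OF h])
    show "rename \<chi> k \<in> q" if "k \<in> mpolys_in I" "k \<in> q" for k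
      using \<chi>q \<psi>(5) that by blast
  qed
  then have "\<forall>h\<in>mpolys_in I. rename \<psi> h \<in> q' \<longleftrightarrow> h \<in> q" using \<psi>(5) by blast
  with bij sizes expos show ?thesis by (intro exI[of _ \<psi>]) simp
qed

section \<open>Ideals of subrings of a type\<close>

text \<open>A subset \<open>K\<close> of a type with the operations of the type; used when \<open>K\<close> is a subring.\<close>

abbreviation type_ring :: "'r::comm_ring_1 set \<Rightarrow> 'r ring" where
  "type_ring K \<equiv> ring_of_type_algebra\<lparr>carrier := K\<rparr>"

lemma type_ring_ops [simp]:
  "carrier (type_ring K) = K"
  "x \<otimes>\<^bsub>ring_of_type_algebra\<^esub> y = x * y" "x \<oplus>\<^bsub>ring_of_type_algebra\<^esub> y = x + y"
  "\<one>\<^bsub>ring_of_type_algebra\<^esub> = 1" "\<zero>\<^bsub>ring_of_type_algebra\<^esub> = 0"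
  by (simp_all add: ring_of_type_algebra_def)

lemma type_ring_closed:
  assumes "cring (type_ring K)"
  shows "0 \<in> K" "1 \<in> K" "x \<in> K \<Longrightarrow> y \<in> K \<Longrightarrow> x + y \<in> K" "x \<in> K \<Longrightarrow> y \<in> K \<Longrightarrow> x * y \<in> K"
    "x \<in> K \<Longrightarrow> - x \<in> K" "x \<in> K \<Longrightarrow> \<ominus>\<^bsub>type_ring K\<^esub> x = - x"
proof -
  interpret K: cring "type_ring K" by (rule assms)
  show "0 \<in> K" "1 \<in> K" using K.zero_closed K.one_closed by simp_all
  show "x \<in> K \<Longrightarrow> y \<in> K \<Longrightarrow> x + y \<in> K" "x \<in> K \<Longrightarrow> y \<in> K \<Longrightarrow> x * y \<in> K"
    using K.a_closed[of x y] K.m_closed[of x y] by simp_all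
  have *: "\<ominus>\<^bsub>type_ring K\<^esub> x = - x \<and> - x \<in> K" if "x \<in> K"
  proof -
    have "\<ominus>\<^bsub>type_ring K\<^esub> x + x = 0" using K.l_neg[of x] that by simp
    then have "\<ominus>\<^bsub>type_ring K\<^esub> x = - x" by (simp only: eq_neg_iff_add_eq_0)
    then show ?thesis using K.a_inv_closed[of x] that by simp
  qed
  then show "x \<in> K \<Longrightarrow> - x \<in> K" "x \<in> K \<Longrightarrow> \<ominus>\<^bsub>type_ring K\<^esub> x = - x" by simp_all
qed

lemma type_ring_ideal_iff:
  assumes K: "cring (type_ring K)"
  shows "ideal J (type_ring K) \<longleftrightarrow> J \<subseteq> K \<and> 0 \<in> J \<and> (\<forall>x\<in>J. \<forall>y\<in>J. x + y \<in> J) \<and> (\<forall>r\<in>K. \<forall>x\<in>J. r * x \<in> J)"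
proof
  assume "ideal J (type_ring K)"
  then interpret ideal J "type_ring K" .
  show "J \<subseteq> K \<and> 0 \<in> J \<and> (\<forall>x\<in>J. \<forall>y\<in>J. x + y \<in> J) \<and> (\<forall>r\<in>K. \<forall>x\<in>J. r * x \<in> J)"
    using a_subset additive_subgroup.zero_closed[OF is_additive_subgroup]
      additive_subgroup.a_closed[OF is_additive_subgroup] I_l_closed by auto
next
  assume J: "J \<subseteq> K \<and> 0 \<in> J \<and> (\<forall>x\<in>J. \<forall>y\<in>J. x + y \<in> J) \<and> (\<forall>r\<in>K. \<forall>x\<in>J. r * x \<in> J)"
  interpret K: cring "type_ring K" by (rule K)
  have minus: "- x \<in> J" if "x \<in> J" for x
  proof -
    have "- 1 * x \<in> J" using J that type_ring_closed[OF K] by blast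
    then show ?thesis by simp
  qed
  show "ideal J (type_ring K)"
  proof (rule idealI)
    show "subgroup J (add_monoid (type_ring K))"
    proof (rule subgroup.intro)
      fix x assume x: "x \<in> J"
      then have "\<ominus>\<^bsub>type_ring K\<^esub> x = - x" using J type_ring_closed(6)[OF K] by blast
      then show "inv\<^bsub>add_monoid (type_ring K)\<^esub> x \<in> J"
        using minus[OF x] by (simp add: a_inv_def)
    qed (use J in \<open>auto simp: ring_of_type_algebra_def\<close>)
    show "x \<otimes>\<^bsub>type_ring K\<^esub> a \<in> J" "a \<otimes>\<^bsub>type_ring K\<^esub> x \<in> J"
      if "a \<in> J" "x \<in> carrier (type_ring K)" for a x
      using J that by (auto simp: mult.commute[of a x])
  qed (rule K.ring_axioms)
qed

lemma type_ring_prime_iff: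
  assumes K: "cring (type_ring K)"
  shows "primeideal P (type_ring K) \<longleftrightarrow> ideal P (type_ring K) \<and> 1 \<notin> P \<and>
    (\<forall>a\<in>K. \<forall>b\<in>K. a * b \<in> P \<longrightarrow> a \<in> P \<or> b \<in> P)"
proof
  assume "primeideal P (type_ring K)"
  then interpret primeideal P "type_ring K" .
  have "1 \<notin> P" using one_imp_carrier I_notcarr by auto
  then show "ideal P (type_ring K) \<and> 1 \<notin> P \<and> (\<forall>a\<in>K. \<forall>b\<in>K. a * b \<in> P \<longrightarrow> a \<in> P \<or> b \<in> P)"
    using I_prime is_ideal by simp
next
  assume P: "ideal P (type_ring K) \<and> 1 \<notin> P \<and> (\<forall>a\<in>K. \<forall>b\<in>K. a * b \<in> P \<longrightarrow> a \<in> P \<or> b \<in> P)"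
  then have "P \<noteq> K" using type_ring_closed(2)[OF K] by auto
  then show "primeideal P (type_ring K)"
    by (intro primeidealI) (use P K in auto)
qed

lemma poly_ring_eq: "(ring_of_type_algebra :: 'r::comm_ring_1 ring) = type_ring UNIV"
  by (simp add: ring_of_type_algebra_def)

lemma ideal_UNIV_iff: "ideal J (ring_of_type_algebra :: 'r::comm_ring_1 ring) \<longleftrightarrow> ideal_set J"
proof -
  have "cring (type_ring (UNIV :: 'r set))" unfolding poly_ring_eq[symmetric] ..
  from type_ring_ideal_iff[OF this] show ?thesis
    by (subst poly_ring_eq) (simp add: ideal_set_def)
qed

lemma pow_type_ring: "(x :: 'r::comm_ring_1) [^]\<^bsub>ring_of_type_algebra\<^esub> (n::nat) = x ^ n"
  by (induction n) (simp_all add: nat_pow_def ring_of_type_algebra_def mult.commute)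

text \<open>An irreducible closed set is determined by its radical ideal, which is prime.\<close>

lemma irreducible_closed_prime:
  assumes K: "cring (type_ring K)" and Z: "irreducible_closed (type_ring K) Z"
  shows "primeideal (radical_ideal_of (type_ring K) Z) (type_ring K)"
    and "Z = {P \<in> Spec (type_ring K). radical_ideal_of (type_ring K) Z \<subseteq> P}"
proof -
  let ?S = "type_ring K" and ?R = "radical_ideal_of (type_ring K) Z"
  interpret S: cring ?S by (rule K)
  obtain J where J: "J \<subseteq> K" "Z = {P \<in> Spec ?S. J \<subseteq> P}" and ne: "Z \<noteq> {}"
    using Z by (auto simp: irreducible_closed_def zariski_closed_def)
  have prime: "primeideal P ?S" if "P \<in> Z" for P using that unfolding J(2) Spec_def by blast
  have ideals: "ideal P ?S" if "P \<in> Z" for P using prime[OF that] type_ring_prime_iff[OF K] by blast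
  have sub: "P \<subseteq> K" if "P \<in> Z" for P
    using ideals[OF that] by (simp add: type_ring_ideal_iff[OF K])
  have "\<Inter>Z \<subseteq> K" using ne sub by blast
  then have R: "?R = \<Inter>Z" by (simp add: radical_ideal_of_def Int_absorb1)
  show "primeideal ?R ?S"
    unfolding type_ring_prime_iff[OF K]
  proof (intro conjI ballI impI)
    show "ideal ?R ?S" unfolding R using ideals ne by (rule S.i_Intersect)
    show "1 \<notin> ?R" using ne prime type_ring_prime_iff[OF K] by (auto simp: R)
    fix a b assume ab: "a \<in> K" "b \<in> K" "a * b \<in> ?R"
    define V where "V c = {P \<in> Spec ?S. {c} \<subseteq> P}" for c
    have "zariski_closed ?S (V c)" if "c \<in> K" for c
      unfolding zariski_closed_def V_def using that by (intro exI[of _ "{c}"]) simp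
    then have "zariski_closed ?S (V a)" "zariski_closed ?S (V b)" using ab by simp_all
    moreover have "Z \<subseteq> V a \<union> V b"
    proof
      fix P assume P: "P \<in> Z"
      then have "a * b \<in> P" using ab(3) by (auto simp: R)
      then have "a \<in> P \<or> b \<in> P" using prime[OF P] ab type_ring_prime_iff[OF K] by blast
      then show "P \<in> V a \<union> V b" using P J by (auto simp: V_def)
    qed
    ultimately have "Z \<subseteq> V a \<or> Z \<subseteq> V b"
      using Z by (auto simp: irreducible_closed_def)
    then show "a \<in> ?R \<or> b \<in> ?R" unfolding R V_def by blast
  qed
  show "Z = {P \<in> Spec ?S. ?R \<subseteq> P}"
  proof -
    have mem: "P \<in> Z \<longleftrightarrow> P \<in> Spec ?S \<and> J \<subseteq> P" for P by (subst J(2)) simp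
    then have "J \<subseteq> \<Inter>Z" by blast
    then show ?thesis unfolding R using mem by blast
  qed
qed


section \<open>Polynomial description of the rings attached to an index set\<close>

lemma conf_ring_type_ring: "conf_ring I = type_ring (carrier (conf_ring I))"
  and eps_ring_type_ring: "eps_ring I = type_ring (carrier (eps_ring I))"
  by (simp_all add: conf_ring_def eps_ring_def)

lemma cring_conf: "cring (type_ring (carrier (conf_ring I)))"
  using cring_conf_ring[of I] by (simp only: conf_ring_type_ring[symmetric])

lemma cring_eps: "cring (type_ring (carrier (eps_ring I)))"
  using cring_eps_ring[of I] by (simp only: eps_ring_type_ring[symmetric])

lemma TFrac_morphism: "ring_morphism (\<lambda>f. TFrac f 1)"
  by (rule ring_morphismI) (simp_all add: TFrac_1 TFrac_add TFrac_mult)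

lemma conf_ring_TFrac: "f \<in> mpolys_in I \<Longrightarrow> TFrac f 1 \<in> carrier (conf_ring I)"
  by (rule conf_ringI[OF _ var_diffs.one])

text \<open>The contraction of the ideal \<open>\<II>\<^sub>0(Z)\<close> to polynomials. It is extended to polynomials in all
  variables of the index type by means of a retraction of that type onto \<open>I\<close>, so that it becomes an
  ideal of the whole polynomial ring.\<close>

definition retract :: "'i set \<Rightarrow> 'i \<Rightarrow> 'i" where
  "retract I \<alpha> = (if \<alpha> \<in> I then \<alpha> else (SOME \<alpha>. \<alpha> \<in> I))"

definition contraction :: "'i set \<Rightarrow> ('i, 'a::comm_ring_1) mpoly tfrac set set \<Rightarrow> ('i, 'a) mpoly set" where
  "contraction I Z = {f. TFrac (rename (retract I) f) 1 \<in> radical_ideal_of (conf_ring I) Z}"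

lemma retract_in: "I \<noteq> {} \<Longrightarrow> retract I \<alpha> \<in> I"
  by (auto simp: retract_def some_in_eq)

lemma contraction_iff:
  "f \<in> mpolys_in I \<Longrightarrow> f \<in> contraction I Z \<longleftrightarrow> TFrac f 1 \<in> radical_ideal_of (conf_ring I) Z"
  by (simp add: contraction_def rename_eq_self[of f I] retract_def)

context
  fixes I :: "'i set" and Z :: "('i, 'a::comm_ring_1) mpoly tfrac set set"
  assumes I: "I \<noteq> {}" and Z: "irreducible_closed (conf_ring I) Z"
begin

private abbreviation "Rad \<equiv> radical_ideal_of (conf_ring I) Z"
private abbreviation "K \<equiv> carrier (conf_ring I :: ('i, 'a) mpoly tfrac ring)"

lemma Rad_prime: "primeideal Rad (type_ring K)"
  and Z_eq: "Z = {P \<in> Spec (conf_ring I). Rad \<subseteq> P}"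
  using irreducible_closed_prime[OF cring_conf, of I Z] Z
  by (simp_all add: conf_ring_type_ring[symmetric])

lemma Rad_facts:
  "Rad \<subseteq> K" "0 \<in> Rad" "x \<in> Rad \<Longrightarrow> y \<in> Rad \<Longrightarrow> x + y \<in> Rad" "r \<in> K \<Longrightarrow> x \<in> Rad \<Longrightarrow> r * x \<in> Rad"
  "1 \<notin> Rad" "a \<in> K \<Longrightarrow> b \<in> K \<Longrightarrow> a * b \<in> Rad \<Longrightarrow> a \<in> Rad \<or> b \<in> Rad"
  using Rad_prime
  by (auto simp: type_ring_prime_iff[OF cring_conf] type_ring_ideal_iff[OF cring_conf])

lemma contraction_prime: "prime_set (contraction I Z)"
proof -
  define h where "h f = TFrac (rename (retract I) f) 1" for f :: "('i, 'a) mpoly"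
  have h: "ring_morphism h" unfolding h_def by (rule morphism_comp[OF TFrac_morphism rename_morphism])
  have hK: "h f \<in> K" for f
    unfolding h_def using retract_in[OF I] by (intro conf_ring_TFrac rename_in'[of f UNIV]) auto
  have c: "contraction I Z = {f. h f \<in> Rad}" by (simp add: contraction_def h_def)
  show ?thesis
    unfolding prime_set_def ideal_set_def c using hK Rad_facts
    by (auto simp: morphism_simps[OF h])
qed

lemma contraction_diff:
  assumes "\<alpha> \<in> I" "\<beta> \<in> I" "\<alpha> \<noteq> \<beta>"
  shows "Var \<alpha> - Var \<beta> \<notin> contraction I Z"
proof
  assume "Var \<alpha> - Var \<beta> \<in> contraction I Z"
  then have "TFrac (Var \<alpha> - Var \<beta>) 1 \<in> Rad"
    using assms by (subst (asm) contraction_iff) (auto intro!: mpolys_in_diff mpolys_in_closed)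
  then have "tvar \<alpha> - tvar \<beta> \<in> Rad" by (simp add: tvar_def morphism_diff[OF TFrac_morphism])
  moreover obtain u where "u \<in> K" "(tvar \<alpha> - tvar \<beta>) * u = 1"
    using conf_ring_elements(3)[OF assms] by blast
  ultimately have "1 \<in> Rad" using Rad_facts(4) by (metis mult.commute)
  then show False using Rad_facts(5) by simp
qed

lemma TFrac_in_Rad:
  assumes f: "f \<in> mpolys_in I" and s: "s \<in> var_diffs I"
  shows "TFrac f s \<in> Rad \<longleftrightarrow> f \<in> contraction I Z"
proof -
  have ns: "nonzerodiv s" by (rule nonzerodiv_var_diffs[OF s])
  have "TFrac f 1 = TFrac s 1 * TFrac f s" "TFrac f s = TFrac 1 s * TFrac f 1"
    using ns by (simp_all add: TFrac_mult TFrac_eq_iff ac_simps)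
  moreover have "TFrac s 1 \<in> K" "TFrac 1 s \<in> K"
    using s by (auto intro!: conf_ring_TFrac conf_ringI var_diffs_subset mpolys_in_closed)
  ultimately show ?thesis
    unfolding contraction_iff[OF f] using Rad_facts(4) by metis
qed

end


subsection \<open>The ideal of a triple in terms of Taylor coefficients\<close>

lemma prod_Var_power: "(\<Prod>x \<in> keys m. Var x ^ lookup m x) =
    (single m 1 :: ('x, 'b::comm_ring_1) mpoly)"
  using eval_mpoly_id[of "single m (1::'b)"] by (simp add: eval_mpoly_def)

lemma lookup_map_coefficients:
  assumes h: "ring_morphism h"
  shows "lookup (eval_mpoly (\<lambda>c. Const (h c)) Var F) m = h (lookup F m)"
proof -
  have "eval_mpoly (\<lambda>c. Const (h c)) Var F =
      (\<Sum>n \<in> keys F. single n (h (lookup F n)))"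
    unfolding eval_mpoly_def prod_Var_power by (simp add: Const_def mult_single)
  then have "lookup (eval_mpoly (\<lambda>c. Const (h c)) Var F) m =
      (\<Sum>n \<in> keys F. h (lookup F n) when n = m)"
    by (simp add: lookup_sum lookup_single)
  also have "\<dots> = h (lookup F m)"
    by (auto simp: when_def in_keys_iff sum.delta morphism_0[OF h])
  finally show ?thesis .
qed

lemma lookup_iota:
  "lookup (iota I U f) m = TFrac (lookup (taylor (block_index I U) f) m) 1"
proof -
  let ?h = "\<lambda>f. TFrac f 1" and ?\<pi> = "block_index I U"
  have c: "ring_morphism (\<lambda>c. Const (TFrac c 1))"
    by (rule morphism_comp[OF Const_morphism TFrac_morphism])
  have t: "ring_morphism (\<lambda>a. Const (tconst a))"
    unfolding tconst_def by (rule morphism_comp[OF c Const_morphism])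
  have "iota I U f = eval_mpoly (\<lambda>c. Const (TFrac c 1)) Var (taylor ?\<pi> f)"
    unfolding iota_def
    by (rule morphism_ext[where D = UNIV and k = "\<lambda>f. eval_mpoly (\<lambda>c. Const (TFrac c 1)) Var (taylor ?\<pi> f)"])
      (simp_all add: eval_mpoly_morphism c t[unfolded tconst_def] morphism_comp[OF eval_mpoly_morphism taylor_morphism]
        eval_mpoly_Const eval_mpoly_Var morphism_add[OF eval_mpoly_morphism] tconst_def tvar_def)
  then show ?thesis by (simp add: lookup_map_coefficients[OF TFrac_morphism])
qed

text \<open>The ideal in the definition of a triple consists of the elements all of whose coefficients below the
  weighting lie in the radical ideal of \<open>Z\<close>.\<close>

lemma Q_ideal_iff:
  fixes I :: "'i set" and Z :: "('i, 'a::comm_ring_1) mpoly tfrac set set"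
  assumes I: "I \<noteq> {}" and Z: "irreducible_closed (conf_ring I) Z" and g: "g \<in> carrier (eps_ring I)"
  shows "g \<in> Q_ideal I U e Z \<longleftrightarrow>
    (\<forall>m. (\<forall>i. lookup m i < e (block_index I U i)) \<longrightarrow>
      lookup g m \<in> radical_ideal_of (conf_ring I) Z)"
proof -
  let ?Rad = "radical_ideal_of (conf_ring I) Z" and ?C = "carrier (conf_ring I :: ('i, 'a) mpoly tfrac ring)"
  let ?E = "carrier (eps_ring I :: (nat, ('i, 'a) mpoly tfrac) mpoly ring)"
  define E where "E i = e (block_index I U i)" for i
  note Rad = Rad_facts[OF I Z]
  have "cring (type_ring ?C)" by (rule cring_conf)
  note C = type_ring_closed[OF this]
  interpret eps: cring "type_ring ?E" by (rule cring_eps)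
  have E_iff: "g \<in> ?E \<longleftrightarrow> (\<forall>m. lookup g m \<in> ?C)" for g
    by (simp add: eps_ring_def)
  define Q where "Q = {g \<in> ?E. \<forall>m. (\<forall>i. lookup m i < E i) \<longrightarrow> lookup g m \<in> ?Rad}"
  define G where "G = Const ` ?Rad \<union> range (\<lambda>i. Var i ^ E i :: (nat, ('i, 'a) mpoly tfrac) mpoly)"
  have Q_def': "Q_ideal I U e Z = genideal (type_ring ?E) G"
    by (simp add: Q_ideal_def G_def E_def eps_ring_type_ring[of I, symmetric])
  have single_E: "single m c \<in> ?E" if "c \<in> ?C" for m c
    using that C by (auto simp: E_iff lookup_single when_def)
  have G_E: "G \<subseteq> ?E"
    using Rad(1) C by (auto simp: G_def Const_def Var_power intro!: single_E)
  have "ideal Q (type_ring ?E)"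
    unfolding type_ring_ideal_iff[OF cring_eps]
  proof (intro conjI ballI)
    show "Q \<subseteq> ?E" by (auto simp: Q_def)
    show "0 \<in> Q" using Rad C by (auto simp: Q_def E_iff)
    show "x + y \<in> Q" if "x \<in> Q" "y \<in> Q" for x y
      using that Rad C by (auto simp: Q_def E_iff lookup_add)
    fix r x assume r: "r \<in> ?E" and x: "x \<in> Q"
    have xE: "x \<in> ?E" using x by (simp add: Q_def)
    have "lookup (r * x) m \<in> ?Rad" if m: "\<forall>i. lookup m i < E i" for m
    proof -
      have sumR: "sum f A \<in> ?Rad" if "\<And>a. a \<in> A \<Longrightarrow> f a \<in> ?Rad" for f :: "(nat \<Rightarrow>\<^sub>0 nat) \<Rightarrow> _" and A
        using that by (induction A rule: infinite_finite_induct) (auto intro: Rad)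
      have "(lookup r a * lookup x b when a + b = m) \<in> ?Rad" for a b
      proof (cases "a + b = m")
        case True
        then have "lookup b i < E i" for i
          using m[rule_format, of i] by (auto simp: lookup_add)
        then have "lookup x b \<in> ?Rad" using x by (simp add: Q_def)
        then show ?thesis using True r Rad(4) by (simp add: E_iff)
      qed (simp add: Rad(2))
      then show ?thesis unfolding lookup_mult_sum by (intro sumR)
    qed
    moreover have "r * x \<in> ?E" using eps.m_closed[of r x] r xE by simp
    ultimately show "r * x \<in> Q" by (simp add: Q_def)
  qed
  moreover have "G \<subseteq> Q"
  proof
    fix g assume g: "g \<in> G"
    show "g \<in> Q"
    proof (cases "g \<in> Const ` ?Rad")
      case True
      then show ?thesis using g G_E Rad(2) by (auto simp: Q_def lookup_Const when_def)
    next
      case False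
      then obtain i where i: "g = Var i ^ E i" using g by (auto simp: G_def)
      have "m \<noteq> single i (E i)" if "\<forall>j. lookup m j < E j" for m
        using that[rule_format, of i] by auto
      then show ?thesis using g G_E Rad(2) by (auto simp: Q_def i Var_power lookup_single when_def)
    qed
  qed
  ultimately have "genideal (type_ring ?E) G \<subseteq> Q" by (rule eps.genideal_minimal)
  moreover have "g \<in> genideal (type_ring ?E) G" if gQ: "g \<in> Q" for g
  proof -
    let ?J = "genideal (type_ring ?E) G"
    have "ideal ?J (type_ring ?E)" using G_E by (intro eps.genideal_ideal) simp
    then have J: "0 \<in> ?J" "\<And>x y. x \<in> ?J \<Longrightarrow> y \<in> ?J \<Longrightarrow> x + y \<in> ?J"
      "\<And>r x. r \<in> ?E \<Longrightarrow> x \<in> ?J \<Longrightarrow> r * x \<in> ?J"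
      by (simp_all add: type_ring_ideal_iff[OF cring_eps])
    have GJ: "G \<subseteq> ?J" using G_E by (intro eps.genideal_self) simp
    have gE: "g \<in> ?E" using gQ by (simp add: Q_def)
    have monomial: "single m (lookup g m) \<in> ?J" for m
    proof (cases "\<forall>i. lookup m i < E i")
      case True
      then have "Const (lookup g m) \<in> ?J" using gQ GJ by (auto simp: Q_def G_def)
      moreover have "single m 1 \<in> ?E" using C by (intro single_E)
      ultimately have "single m 1 * Const (lookup g m) \<in> ?J" by (intro J)
      then show ?thesis by (simp add: Const_def mult_single)
    next
      case False
      then obtain i where i: "E i \<le> lookup m i" by (meson not_le)
      let ?m = "m - single i (E i)"
      have m: "m = ?m + single i (E i)"
        using i by (intro poly_mapping_eqI) (auto simp: lookup_add lookup_minus lookup_single when_def)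
      have "Var i ^ E i \<in> ?J" using GJ by (auto simp: G_def)
      moreover have "single ?m (lookup g m) \<in> ?E"
        using gE by (intro single_E) (simp add: E_iff)
      ultimately have "single ?m (lookup g m) * Var i ^ E i \<in> ?J" by (intro J)
      moreover have "single ?m (lookup g m) * Var i ^ E i =
          single (?m + single i (E i)) (lookup g m)"
        by (simp add: Var_power mult_single)
      ultimately show ?thesis using m by simp
    qed
    have "(\<Sum>m \<in> A. single m (lookup g m)) \<in> ?J" for A
      by (induction A rule: infinite_finite_induct) (auto intro: J monomial)
    then show ?thesis by (subst mpoly_eq_sum[of g])
  qed
  ultimately have "Q_ideal I U e Z = Q" unfolding Q_def' by blast
  then show ?thesis using g by (simp add: Q_def E_def)
qed

lemma P_ideal_part_eq:
  fixes I :: "'i set" and Z :: "('i, 'a::comm_ring_1) mpoly tfrac set set"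
  assumes I: "I \<noteq> {}" and Z: "irreducible_closed (conf_ring I) Z"
    and range: "range (block_index I U) \<subseteq> I"
  shows "P_ideal_part I U e Z = sym_ideal_of (block_index I U) e (contraction I Z)"
proof -
  have "iota I U f \<in> Q_ideal I U e Z \<longleftrightarrow>
      taylor (block_index I U) f \<in> Qset (\<lambda>i. e (block_index I U i)) (contraction I Z)"
    for f :: "(nat, 'a) mpoly"
  proof -
    have c: "lookup (taylor (block_index I U) f) m \<in> mpolys_in I" for m
      using lookup_taylor_in range by (rule mpolys_in_mono)
    then have "iota I U f \<in> carrier (eps_ring I)"
      by (simp add: eps_ring_def lookup_iota conf_ring_TFrac)
    from Q_ideal_iff[OF I Z this] show ?thesis
      by (simp add: Qset_def lookup_iota contraction_iff[OF c])
  qed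
  then show ?thesis by (simp add: P_ideal_part_def sym_ideal_of_def perm_act_eq_rename)
qed


subsection \<open>Partitions\<close>

lemma infinite_split:
  fixes A :: "nat set"
  assumes "infinite A"
  shows "\<exists>B \<subseteq> A. infinite B \<and> infinite (A - B)"
proof -
  let ?B = "enumerate A ` {n. even n}"
  have inj: "inj (enumerate A)"
    by (rule strict_mono_imp_inj_on) (simp add: assms strict_mono_enumerate)
  have "infinite (range (\<lambda>n::nat. 2 * n))" "infinite (range (\<lambda>n::nat. Suc (2 * n)))"
    by (rule range_inj_infinite, simp add: inj_on_def)+
  moreover have "range (\<lambda>n::nat. 2 * n) \<subseteq> {n. even n}" "range (\<lambda>n::nat. Suc (2 * n)) \<subseteq> {n. odd n}"
    by auto
  ultimately have ev: "infinite {n::nat. even n}" "infinite {n::nat. odd n}"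
    by (blast dest: infinite_super)+
  have im: "infinite (enumerate A ` S)" if "infinite S" for S
    using that finite_image_iff[OF inj_on_subset[OF inj, of S]] by simp
  have "infinite ?B" by (rule im[OF ev(1)])
  moreover have "enumerate A ` {n. odd n} \<subseteq> A - ?B"
    by (auto simp: enumerate_in_set[OF assms] inj_eq[OF inj])
  then have "infinite (A - ?B)" using im[OF ev(2)] by (rule infinite_super)
  moreover have "?B \<subseteq> A" by (auto simp: enumerate_in_set[OF assms])
  ultimately show ?thesis by blast
qed

lemma partition_exists:
  assumes "inf_composition I lam"
  shows "\<exists>U. partition_of_type I lam U"
proof -
  obtain \<alpha>0 where \<alpha>0: "\<alpha>0 \<in> I" "lam \<alpha>0 = \<infinity>" and fin: "finite I" and ge: "\<And>\<alpha>. \<alpha> \<in> I \<Longrightarrow> 1 \<le> lam \<alpha>"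
    using assms by (auto simp: inf_composition_def)
  have "\<exists>U. disjoint_family_on U (insert \<alpha>0 F) \<and> (\<Union>\<alpha>\<in>insert \<alpha>0 F. U \<alpha>) = A \<and>
      (\<forall>\<alpha>\<in>insert \<alpha>0 F. U \<alpha> \<noteq> {} \<and> ecard (U \<alpha>) = lam \<alpha>)"
    if "finite F" "F \<subseteq> I - {\<alpha>0}" "infinite A" for F and A :: "nat set"
    using that
  proof (induction F arbitrary: A rule: finite_induct)
    case empty
    then show ?case
      by (intro exI[of _ "\<lambda>_. A"]) (auto simp: disjoint_family_on_def ecard_def \<alpha>0)
  next
    case (insert \<beta> F)
    have "\<exists>B\<subseteq>A. B \<noteq> {} \<and> ecard B = lam \<beta> \<and> infinite (A - B)"
    proof (cases "lam \<beta>")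
      case (enat n)
      then have "n \<ge> 1" using ge[of \<beta>] insert.prems by (auto simp: one_enat_def)
      moreover obtain B where B: "finite B" "card B = n" "B \<subseteq> A"
        using infinite_arbitrarily_large[OF insert.prems(2)] by blast
      ultimately show ?thesis
        using enat insert.prems(2) by (intro exI[of _ B]) (auto simp: ecard_def)
    next
      case infinity
      from infinite_split[OF insert.prems(2)] obtain B where "B \<subseteq> A" "infinite B" "infinite (A - B)" by blast
      then show ?thesis using infinity by (intro exI[of _ B]) (auto simp: ecard_def)
    qed
    then obtain B where B: "B \<subseteq> A" "B \<noteq> {}" "ecard B = lam \<beta>" "infinite (A - B)" by blast
    from insert.IH[of "A - B"] B insert.prems obtain U where
      U: "disjoint_family_on U (insert \<alpha>0 F)" "(\<Union>\<alpha>\<in>insert \<alpha>0 F. U \<alpha>) = A - B"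
        "\<forall>\<alpha>\<in>insert \<alpha>0 F. U \<alpha> \<noteq> {} \<and> ecard (U \<alpha>) = lam \<alpha>" by auto
    have \<beta>: "\<beta> \<notin> insert \<alpha>0 F" using insert.hyps insert.prems by auto
    have same: "(U(\<beta> := B)) \<alpha> = U \<alpha>" if "\<alpha> \<in> insert \<alpha>0 F" for \<alpha> using that \<beta> by auto
    have "disjoint_family_on (U(\<beta> := B)) (insert \<beta> (insert \<alpha>0 F))"
      using U(1,2) \<beta> unfolding disjoint_family_on_def by (auto simp: fun_upd_def)
    moreover have "(\<Union>\<alpha>\<in>insert \<alpha>0 F. (U(\<beta> := B)) \<alpha>) = A - B"
      unfolding U(2)[symmetric] by (rule SUP_cong[OF refl same])
    then have "(\<Union>\<alpha>\<in>insert \<beta> (insert \<alpha>0 F). (U(\<beta> := B)) \<alpha>) = A"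
      using B(1) by (subst UN_insert) auto
    moreover have "\<forall>\<alpha>\<in>insert \<beta> (insert \<alpha>0 F). (U(\<beta> := B)) \<alpha> \<noteq> {} \<and> ecard ((U(\<beta> := B)) \<alpha>) = lam \<alpha>"
      using U(3) B \<beta> by auto
    ultimately show ?case
      unfolding insert_commute[of \<alpha>0 \<beta> F] by (intro exI[of _ "U(\<beta> := B)"] conjI)
  qed
  from this[of "I - {\<alpha>0}" UNIV] have "\<exists>U. disjoint_family_on U I \<and> (\<Union>\<alpha>\<in>I. U \<alpha>) = (UNIV :: nat set) \<and>
      (\<forall>\<alpha>\<in>I. U \<alpha> \<noteq> {} \<and> ecard (U \<alpha>) = lam \<alpha>)"
    using fin \<alpha>0(1) by (simp add: insert_absorb)
  then show ?thesis by (simp add: partition_of_type_def)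
qed

lemma block_index:
  assumes U: "partition_of_type I lam U"
  shows "range (block_index I U) = I" "\<alpha> \<in> I \<Longrightarrow> block_index I U -` {\<alpha>} = U \<alpha>"
proof -
  have uniq: "\<exists>!\<alpha>. \<alpha> \<in> I \<and> i \<in> U \<alpha>" for i
  proof -
    have "i \<in> (\<Union>\<alpha>\<in>I. U \<alpha>)" using U by (simp add: partition_of_type_def)
    then show ?thesis using U by (auto simp: partition_of_type_def disjoint_family_on_def)
  qed
  have mem: "block_index I U i \<in> I \<and> i \<in> U (block_index I U i)" for i
    unfolding block_index_def by (rule theI'[OF uniq])
  have eq: "block_index I U i = \<alpha>" if "\<alpha> \<in> I" "i \<in> U \<alpha>" for i \<alpha>
    using uniq[of i] mem[of i] that by blast
  show pre: "block_index I U -` {\<alpha>} = U \<alpha>" if "\<alpha> \<in> I" for \<alpha>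
    using eq[OF that] mem by auto
  show "range (block_index I U) = I"
  proof
    show "I \<subseteq> range (block_index I U)"
    proof
      fix \<alpha> assume \<alpha>: "\<alpha> \<in> I"
      then obtain i where "i \<in> U \<alpha>" using U by (auto simp: partition_of_type_def)
      then show "\<alpha> \<in> range (block_index I U)" using eq[OF \<alpha>] by blast
    qed
  qed (use mem in auto)
qed

section \<open>Transport along a bijection of index sets\<close>

lemma var_diffs_rename:
  assumes "s \<in> var_diffs I" "inj_on \<phi> I" "\<phi> ` I \<subseteq> I'"
  shows "rename \<phi> s \<in> var_diffs I'"
  using assms(1)
proof (induction rule: var_diffs.induct)
  case (mult s \<alpha> \<beta>)
  have "rename \<phi> s * (Var (\<phi> \<alpha>) - Var (\<phi> \<beta>)) \<in> var_diffs I'"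
    by (rule var_diffs.mult[OF mult.IH]) (use mult assms(2,3) in \<open>auto dest: inj_onD\<close>)
  then show ?case by simp
qed (simp add: var_diffs.one)

text \<open>The map \<open>f / s \<mapsto> \<phi>(f) / \<phi>(s)\<close>.\<close>

definition frac_map :: "'i set \<Rightarrow> ('i \<Rightarrow> 'j) \<Rightarrow> ('i, 'a::comm_ring_1) mpoly tfrac \<Rightarrow> ('j, 'a) mpoly tfrac" where
  "frac_map I \<phi> x = (SOME y. \<exists>f \<in> mpolys_in I. \<exists>s \<in> var_diffs I.
     x = TFrac f s \<and> y = TFrac (rename \<phi> f) (rename \<phi> s))"

lemma frac_map_TFrac:
  assumes \<phi>: "inj_on \<phi> I" and f: "f \<in> mpolys_in I" "s \<in> var_diffs I"
  shows "frac_map I \<phi> (TFrac f s) = TFrac (rename \<phi> f) (rename \<phi> s)"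
  unfolding frac_map_def
proof (rule someI2)
  show "\<exists>g\<in>mpolys_in I. \<exists>t\<in>var_diffs I. TFrac f s = TFrac g t \<and>
      TFrac (rename \<phi> f) (rename \<phi> s) = TFrac (rename \<phi> g) (rename \<phi> t)"
    using f by blast
  fix y assume "\<exists>g\<in>mpolys_in I. \<exists>t\<in>var_diffs I. TFrac f s = TFrac g t \<and> y = TFrac (rename \<phi> g) (rename \<phi> t)"
  then obtain g t where g: "t \<in> var_diffs I" "TFrac f s = TFrac g t" and y: "y = TFrac (rename \<phi> g) (rename \<phi> t)"
    by blast
  have "f * t = g * s" using g f by (simp add: TFrac_eq_iff nonzerodiv_var_diffs)
  then have "rename \<phi> (f * t) = rename \<phi> (g * s)" by simp
  moreover have "nonzerodiv (rename \<phi> s)" "nonzerodiv (rename \<phi> t)"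
    using var_diffs_rename[OF _ \<phi> subset_refl] f g nonzerodiv_var_diffs by blast+
  ultimately show "y = TFrac (rename \<phi> f) (rename \<phi> s)"
    unfolding y by (simp add: TFrac_eq_iff)
qed

lemma conf_ring_ops:
  "x \<otimes>\<^bsub>conf_ring I\<^esub> y = x * y" "x \<oplus>\<^bsub>conf_ring I\<^esub> y = x + y" "\<one>\<^bsub>conf_ring I\<^esub> = 1"
  by (simp_all add: conf_ring_def)

lemma conf_ring_cases:
  assumes "x \<in> carrier (conf_ring I)"
  obtains f s where "x = TFrac f s" "f \<in> mpolys_in I" "s \<in> var_diffs I"
  using assms by (auto simp: conf_ring_def)

text \<open>Mutually inverse bijections, given by total functions that are arbitrary outside the index sets.\<close>

locale index_bijection =
  fixes I :: "'i set" and I' :: "'j set" and \<phi> :: "'i \<Rightarrow> 'j" and \<phi>' :: "'j \<Rightarrow> 'i"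
  assumes maps: "\<phi> ` I \<subseteq> I'" "\<phi>' ` I' \<subseteq> I"
    and inverse: "\<And>\<alpha>. \<alpha> \<in> I \<Longrightarrow> \<phi>' (\<phi> \<alpha>) = \<alpha>" "\<And>\<beta>. \<beta> \<in> I' \<Longrightarrow> \<phi> (\<phi>' \<beta>) = \<beta>"
begin

lemma inj: "inj_on \<phi> I"
  by (rule inj_on_inverseI[of _ \<phi>']) (rule inverse)

lemma swap: "index_bijection I' I \<phi>' \<phi>"
  by (unfold_locales) (use maps inverse in auto)

lemma frac_map_closed: "x \<in> carrier (conf_ring I) \<Longrightarrow> frac_map I \<phi> x \<in> carrier (conf_ring I')"
  by (erule conf_ring_cases)
    (simp add: frac_map_TFrac[OF inj] conf_ringI rename_in'[OF _ maps(1)] var_diffs_rename[OF _ inj maps(1)])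

lemma frac_map_inverse:
  fixes x :: "('i, 'a::comm_ring_1) mpoly tfrac"
  shows "x \<in> carrier (conf_ring I) \<Longrightarrow> frac_map I' \<phi>' (frac_map I \<phi> x) = x"
proof (erule conf_ring_cases)
  fix f s assume x: "x = TFrac f s" and f: "f \<in> mpolys_in I" and s: "s \<in> var_diffs I"
  have "rename \<phi>' (rename \<phi> g) = g" if "g \<in> mpolys_in I" for g :: "('i, 'a) mpoly"
    unfolding rename_rename by (rule rename_eq_self[OF that]) (rule inverse)
  then show ?thesis
    unfolding x frac_map_TFrac[OF inj f s]
    using index_bijection.inj[OF swap] f s
    by (simp add: frac_map_TFrac rename_in'[OF f maps(1)] var_diffs_rename[OF s inj maps(1)] var_diffs_subset)
qed

lemma frac_map_add:
  assumes "x \<in> carrier (conf_ring I)" "y \<in> carrier (conf_ring I)"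
  shows "frac_map I \<phi> (x + y) = frac_map I \<phi> x + frac_map I \<phi> y"
    and "frac_map I \<phi> (x * y) = frac_map I \<phi> x * frac_map I \<phi> y"
proof -
  obtain f s where f: "x = TFrac f s" "f \<in> mpolys_in I" "s \<in> var_diffs I" using assms(1) by (rule conf_ring_cases)
  obtain g t where g: "y = TFrac g t" "g \<in> mpolys_in I" "t \<in> var_diffs I" using assms(2) by (rule conf_ring_cases)
  have st: "s * t \<in> var_diffs I" using f g by (intro var_diffs_mult)
  have ns: "nonzerodiv s" "nonzerodiv t" using f g by (auto intro: nonzerodiv_var_diffs)
  have nr: "nonzerodiv (rename \<phi> s)" "nonzerodiv (rename \<phi> t)"
    using var_diffs_rename[OF f(3) inj maps(1)] var_diffs_rename[OF g(3) inj maps(1)]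
    by (auto intro: nonzerodiv_var_diffs)
  have sums: "f * t + g * s \<in> mpolys_in I" "f * g \<in> mpolys_in I"
    using f g by (simp_all add: mpolys_in_closed var_diffs_subset)
  show "frac_map I \<phi> (x + y) = frac_map I \<phi> x + frac_map I \<phi> y"
    "frac_map I \<phi> (x * y) = frac_map I \<phi> x * frac_map I \<phi> y"
    using sums ns nr
    by (simp_all add: frac_map_TFrac[OF inj _ st] f(1) g(1) frac_map_TFrac[OF inj f(2,3)]
        frac_map_TFrac[OF inj g(2,3)] TFrac_add TFrac_mult)
qed

lemma frac_map_Const: "frac_map I \<phi> (TFrac (Const a) 1) = TFrac (Const a) 1"
  by (simp add: frac_map_TFrac[OF inj] mpolys_in_closed var_diffs.one)

lemma frac_map_0: "frac_map I \<phi> 0 = 0" and frac_map_1: "frac_map I \<phi> 1 = 1"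
  using frac_map_Const[of 0] frac_map_Const[of 1] by (simp_all add: TFrac_0 TFrac_1)

lemma frac_map_bij: "bij_betw (frac_map I \<phi>) (carrier (conf_ring I)) (carrier (conf_ring I'))"
  by (rule bij_betw_byWitness[where f' = "frac_map I' \<phi>'"])
    (auto simp: frac_map_inverse frac_map_closed index_bijection.frac_map_inverse[OF swap]
      index_bijection.frac_map_closed[OF swap])

lemma frac_map_iso: "frac_map I \<phi> \<in> ring_iso (conf_ring I) (conf_ring I')"
proof (rule ring_iso_memI)
  show "bij_betw (frac_map I \<phi>) (carrier (conf_ring I)) (carrier (conf_ring I'))" by (rule frac_map_bij)
qed (simp_all add: conf_ring_ops frac_map_closed frac_map_add frac_map_1)

lemma frac_map_primeideal:
  fixes P :: "('i, 'a::comm_ring_1) mpoly tfrac set"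
  assumes P: "primeideal P (conf_ring I)"
  shows "primeideal (frac_map I \<phi> ` P) (conf_ring I')"
proof -
  let ?K = "carrier (conf_ring I :: ('i, 'a) mpoly tfrac ring)"
  let ?K' = "carrier (conf_ring I' :: ('j, 'a) mpoly tfrac ring)"
  let ?h = "frac_map I \<phi> :: ('i, 'a) mpoly tfrac \<Rightarrow> ('j, 'a) mpoly tfrac"
  have "primeideal P (type_ring ?K)" using P by (simp add: conf_ring_type_ring[symmetric])
  then have P: "P \<subseteq> ?K" "0 \<in> P" "\<And>x y. x \<in> P \<Longrightarrow> y \<in> P \<Longrightarrow> x + y \<in> P"
    "\<And>r x. r \<in> ?K \<Longrightarrow> x \<in> P \<Longrightarrow> r * x \<in> P" "1 \<notin> P"
    "\<And>a b. a \<in> ?K \<Longrightarrow> b \<in> ?K \<Longrightarrow> a * b \<in> P \<Longrightarrow> a \<in> P \<or> b \<in> P"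
    by (auto simp: type_ring_prime_iff[OF cring_conf] type_ring_ideal_iff[OF cring_conf])
  have K: "0 \<in> ?K" "1 \<in> ?K" "\<And>x y. x \<in> ?K \<Longrightarrow> y \<in> ?K \<Longrightarrow> x * y \<in> ?K"
    by (rule type_ring_closed[OF cring_conf]; assumption)+
  have im: "?h ` ?K = ?K'" by (rule bij_betw_imp_surj_on[OF frac_map_bij])
  have mem: "?h x \<in> ?h ` P \<longleftrightarrow> x \<in> P" if "x \<in> ?K" for x
    using inj_on_image_mem_iff[OF bij_betw_imp_inj_on[OF frac_map_bij] that P(1)] .
  have "primeideal (?h ` P) (type_ring ?K')"
    unfolding type_ring_prime_iff[OF cring_conf] type_ring_ideal_iff[OF cring_conf]
  proof (intro conjI ballI impI)
    show "?h ` P \<subseteq> ?K'" using P(1) frac_map_closed by blast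
    show "0 \<in> ?h ` P" using mem[OF K(1)] P(2) by (simp add: frac_map_0)
    show "1 \<notin> ?h ` P" using mem[OF K(2)] P(5) by (simp add: frac_map_1)
    show "x + y \<in> ?h ` P" if "x \<in> ?h ` P" "y \<in> ?h ` P" for x y
    proof -
      from that obtain u v where uv: "u \<in> P" "v \<in> P" "x = ?h u" "y = ?h v" by blast
      then have "u \<in> ?K" "v \<in> ?K" using P(1) by auto
      then have "x + y = ?h (u + v)" using uv by (simp add: frac_map_add(1))
      then show ?thesis using P(3)[OF uv(1,2)] by simp
    qed
    show "r * x \<in> ?h ` P" if "r \<in> ?K'" "x \<in> ?h ` P" for r x
    proof -
      from that im obtain u v where uv: "u \<in> ?K" "v \<in> P" "r = ?h u" "x = ?h v" by blast
      then have "v \<in> ?K" using P(1) by auto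
      then have "r * x = ?h (u * v)" using uv by (simp add: frac_map_add(2))
      then show ?thesis using P(4)[OF uv(1,2)] by simp
    qed
    show "a \<in> ?h ` P \<or> b \<in> ?h ` P" if "a \<in> ?K'" "b \<in> ?K'" "a * b \<in> ?h ` P" for a b
    proof -
      from that im obtain u v where uv: "u \<in> ?K" "v \<in> ?K" "a = ?h u" "b = ?h v" by blast
      then have "u * v \<in> P" using that(3) mem[OF K(3)[OF uv(1,2)]] by (simp add: frac_map_add(2))
      then show ?thesis using P(6) uv by blast
    qed
  qed
  then show ?thesis by (simp add: conf_ring_type_ring[symmetric])
qed

lemma frac_map_Rad:
  fixes Z :: "('i, 'a::comm_ring_1) mpoly tfrac set set"
  assumes I: "I \<noteq> {}" "irreducible_closed (conf_ring I) Z"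
    and I': "I' \<noteq> {}" "irreducible_closed (conf_ring I') Z'"
    and q: "\<And>h. h \<in> mpolys_in I \<Longrightarrow> rename \<phi> h \<in> contraction I' Z' \<longleftrightarrow> h \<in> contraction I Z"
    and x: "x \<in> carrier (conf_ring I)"
  shows "frac_map I \<phi> x \<in> radical_ideal_of (conf_ring I') Z' \<longleftrightarrow> x \<in> radical_ideal_of (conf_ring I) Z"
proof -
  obtain f s where f: "x = TFrac f s" "f \<in> mpolys_in I" "s \<in> var_diffs I" using x by (rule conf_ring_cases)
  show ?thesis
    unfolding f(1) frac_map_TFrac[OF inj f(2,3)] TFrac_in_Rad[OF I f(2,3)]
      TFrac_in_Rad[OF I' rename_in'[OF f(2) maps(1)] var_diffs_rename[OF f(3) inj maps(1)]]
    by (rule q[OF f(2)])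
qed

lemma frac_map_closed_set:
  fixes Z :: "('i, 'a::comm_ring_1) mpoly tfrac set set"
  assumes I: "I \<noteq> {}" "irreducible_closed (conf_ring I) Z"
    and I': "I' \<noteq> {}" "irreducible_closed (conf_ring I') Z'"
    and q: "\<And>h. h \<in> mpolys_in I \<Longrightarrow> rename \<phi> h \<in> contraction I' Z' \<longleftrightarrow> h \<in> contraction I Z"
    and P: "P \<in> Z"
  shows "frac_map I \<phi> ` P \<in> Z'"
proof -
  have P: "primeideal P (conf_ring I)" "radical_ideal_of (conf_ring I) Z \<subseteq> P"
    using P Z_eq[OF I] by (auto simp: Spec_def)
  have "y \<in> frac_map I \<phi> ` P" if y: "y \<in> radical_ideal_of (conf_ring I') Z'" for y
  proof -
    have yK: "y \<in> carrier (conf_ring I')" using y by (simp add: radical_ideal_of_def)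
    let ?x = "frac_map I' \<phi>' y"
    have x: "?x \<in> carrier (conf_ring I)" "frac_map I \<phi> ?x = y"
      using yK by (simp_all add: index_bijection.frac_map_closed[OF swap] index_bijection.frac_map_inverse[OF swap])
    then have "?x \<in> radical_ideal_of (conf_ring I) Z"
      using frac_map_Rad[OF I I' q x(1)] y by simp
    then show ?thesis using P(2) x(2) by (metis image_eqI subsetD)
  qed
  then show ?thesis
    using frac_map_primeideal[OF P(1)] Z_eq[OF I'] by (auto simp: Spec_def)
qed

end

lemma triple_iso_if_primes_correspond:
  fixes Z :: "('i, 'a::comm_ring_1) mpoly tfrac set set" and Z' :: "('j, 'a) mpoly tfrac set set"
  assumes bij: "bij_betw \<phi> I I'"
    and I: "I \<noteq> {}" "irreducible_closed (conf_ring I) Z"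
    and I': "I' \<noteq> {}" "irreducible_closed (conf_ring I') Z'"
    and q: "\<And>h. h \<in> mpolys_in I \<Longrightarrow> rename \<phi> h \<in> contraction I' Z' \<longleftrightarrow> h \<in> contraction I Z"
    and lam: "\<And>\<alpha>. \<alpha> \<in> I \<Longrightarrow> lam' (\<phi> \<alpha>) = lam \<alpha> \<and> e' (\<phi> \<alpha>) = e \<alpha>"
  shows "triple_iso I lam e Z I' lam' e' Z'"
proof -
  let ?\<phi>' = "inv_into I \<phi>"
  interpret B: index_bijection I I' \<phi> ?\<phi>'
    using bij by unfold_locales
      (auto simp: bij_betw_def inv_into_into f_inv_into_f)
  interpret B': index_bijection I' I ?\<phi>' \<phi> by (rule B.swap)
  have q': "rename ?\<phi>' h \<in> contraction I Z \<longleftrightarrow> h \<in> contraction I' Z'" if h: "h \<in> mpolys_in I'" for h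
  proof -
    have "rename \<phi> (rename ?\<phi>' h) = h"
      unfolding rename_rename by (rule rename_eq_self[OF h]) (rule B.inverse)
    then show ?thesis using q[OF rename_in'[OF h B.maps(2)]] by simp
  qed
  have "Z' = (\<lambda>P. frac_map I \<phi> ` P) ` Z"
  proof (intro equalityI subsetI)
    fix P assume P: "P \<in> Z'"
    have P': "frac_map I' ?\<phi>' ` P \<in> Z" by (rule B'.frac_map_closed_set[OF I' I q' P])
    have "P \<subseteq> carrier (conf_ring I')"
    proof -
      have "primeideal P (conf_ring I')" using P Z_eq[OF I'] by (auto simp: Spec_def)
      then interpret primeideal P "conf_ring I'" .
      show ?thesis by (rule a_subset)
    qed
    then have "frac_map I \<phi> ` (frac_map I' ?\<phi>' ` P) = P"
      by (force simp: image_image B'.frac_map_inverse subset_iff)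
    then show "P \<in> (\<lambda>P. frac_map I \<phi> ` P) ` Z" using P' by (metis image_eqI)
  next
    fix P assume "P \<in> (\<lambda>P. frac_map I \<phi> ` P) ` Z"
    then show "P \<in> Z'" using B.frac_map_closed_set[OF I I' q] by auto
  qed
  moreover have "frac_map I \<phi> (tvar \<alpha>) = tvar (\<phi> \<alpha>)" if "\<alpha> \<in> I" for \<alpha>
    unfolding tvar_def by (simp add: frac_map_TFrac[OF B.inj] mpolys_in_closed var_diffs.one that)
  ultimately show ?thesis
    unfolding triple_iso_def using bij lam B.frac_map_iso
    by (intro exI[of _ \<phi>] exI[of _ "frac_map I \<phi>"]) (auto simp: tconst_def B.frac_map_Const)
qed


section \<open>The classification\<close>

text \<open>If \<open>f\<close> times every translate of \<open>g\<close> lies in \<open>p\<close>, then so does the product of two symmetric ideals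
  that contain \<open>f\<close> and \<open>g\<close>: the colon ideal \<open>a\<close> of the orbit of \<open>g\<close>, and the colon ideal \<open>b\<close> of \<open>a\<close>.\<close>

lemma sym_prime_elementwise:
  assumes "sym_prime p"
  shows "sym_prime_ideal p"
proof
  have "sym_ideal p" using assms by (simp add: sym_prime_def)
  then show p: "ideal_set p" and stable: "\<And>\<sigma> f. \<sigma> \<in> finitary_perms \<Longrightarrow> f \<in> p \<Longrightarrow> rename \<sigma> f \<in> p"
    by (auto simp: sym_ideal_def ideal_UNIV_iff perm_act_eq_rename)
  fix f g assume fg: "\<And>\<sigma>. \<sigma> \<in> finitary_perms \<Longrightarrow> f * rename \<sigma> g \<in> p"
  define a where "a = {x. \<forall>\<tau> \<in> finitary_perms. x * rename \<tau> g \<in> p}"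
  define b where "b = {y. \<forall>x \<in> a. x * y \<in> p}"
  have "ideal_set a" "ideal_set b"
    unfolding a_def b_def ideal_set_def
    by (auto simp: distrib_left distrib_right ideal_0[OF p] ideal_add[OF p] mult.assoc ideal_multl[OF p]
        mult.left_commute)
  have a_stable: "rename \<sigma> x \<in> a" if \<sigma>: "\<sigma> \<in> finitary_perms" and x: "x \<in> a" for \<sigma> x
    unfolding a_def
  proof safe
    fix \<tau> :: "nat \<Rightarrow> nat" assume \<tau>: "\<tau> \<in> finitary_perms"
    have "x * rename (\<lambda>i. inv_into UNIV \<sigma> (\<tau> i)) g \<in> p"
      using x finitary_comp[OF finitary_inv[OF \<sigma>] \<tau>] by (simp add: a_def)
    from stable[OF \<sigma> this] show "rename \<sigma> x * rename \<tau> g \<in> p"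
      by (simp add: rename_rename finitary_inv_cancel[OF \<sigma>])
  qed
  have b_stable: "rename \<sigma> y \<in> b" if \<sigma>: "\<sigma> \<in> finitary_perms" and y: "y \<in> b" for \<sigma> y
    unfolding b_def
  proof safe
    fix x assume "x \<in> a"
    then have "rename (inv_into UNIV \<sigma>) x * y \<in> p"
      using y a_stable[OF finitary_inv[OF \<sigma>]] by (simp add: b_def)
    from stable[OF \<sigma> this] show "x * rename \<sigma> y \<in> p"
      by (simp add: rename_rename finitary_inv_cancel[OF \<sigma>])
  qed
  have "sym_ideal a" "sym_ideal b"
    using \<open>ideal_set a\<close> \<open>ideal_set b\<close> a_stable b_stable
    by (auto simp: sym_ideal_def ideal_UNIV_iff perm_act_eq_rename)
  moreover have "ideal_prod poly_ring a b \<subseteq> p"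
  proof
    fix x assume "x \<in> ideal_prod poly_ring a b"
    then show "x \<in> p"
      by (induction rule: ideal_prod.induct) (auto simp: b_def ideal_add[OF p])
  qed
  ultimately have "a \<subseteq> p \<or> b \<subseteq> p" using assms unfolding sym_prime_def by blast
  moreover have "f \<in> a" using fg by (simp add: a_def)
  moreover have "g \<in> b"
  proof -
    have "x * rename (\<lambda>i. i) g \<in> p" if "x \<in> a" for x
      using that finitary_id unfolding a_def by blast
    then show ?thesis by (simp add: b_def)
  qed
  ultimately show "f \<in> p \<or> g \<in> p" by blast
qed

text \<open>The map \<open>\<pi>\<close> of the partition that enters the definition of the ideal of a triple.\<close>

definition chosen_blocks :: "'i set \<Rightarrow> ('i \<Rightarrow> enat) \<Rightarrow> nat \<Rightarrow> 'i" where
  "chosen_blocks I lam = block_index I (SOME U. partition_of_type I lam U)"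

context
  fixes I :: "'i set" and lam :: "'i \<Rightarrow> enat"
  assumes comp: "inf_composition I lam"
begin

lemma chosen_blocks: "range (chosen_blocks I lam) = I"
  "\<alpha> \<in> I \<Longrightarrow> ecard (chosen_blocks I lam -` {\<alpha>}) = lam \<alpha>"
proof -
  have U: "partition_of_type I lam (SOME U. partition_of_type I lam U)"
    using partition_exists[OF comp] by (rule someI_ex)
  show "range (chosen_blocks I lam) = I"
    "\<alpha> \<in> I \<Longrightarrow> ecard (chosen_blocks I lam -` {\<alpha>}) = lam \<alpha>"
    using block_index[OF U] U by (simp_all add: chosen_blocks_def partition_of_type_def)
qed

lemma composition_nonempty: "I \<noteq> {}"
  using comp by (auto simp: inf_composition_def)

lemma config_of_triple:
  assumes "irreducible_closed (conf_ring I) Z"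
  shows "config I (chosen_blocks I lam) (contraction I Z)"
  using comp chosen_blocks(1) contraction_prime[OF composition_nonempty assms]
    contraction_diff[OF composition_nonempty assms]
  by (intro config.intro) (auto simp: inf_composition_def)

lemma P_ideal_eq:
  assumes "irreducible_closed (conf_ring I) Z"
  shows "P_ideal I lam e Z = sym_ideal_of (chosen_blocks I lam) e (contraction I Z)"
  unfolding P_ideal_def chosen_blocks_def
  by (rule P_ideal_part_eq[OF composition_nonempty assms])
    (simp add: chosen_blocks(1)[unfolded chosen_blocks_def])

end

lemma presentation_of_triple:
  assumes t: "reduced_triple I lam e Z" and p: "p = P_ideal I lam e Z" "sym_prime_ideal p"
  shows "presentation I (chosen_blocks I lam) (contraction I Z) p e"
proof -
  have comp: "inf_composition I lam" and Z: "irreducible_closed (conf_ring I) Z"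
    and red: "reduced_weighting I lam e" using t by (simp_all add: reduced_triple_def)
  show ?thesis
  proof (intro presentation.intro presentation_axioms.intro config_of_triple[OF comp Z] p(2))
    show "1 \<le> e \<alpha>" if "\<alpha> \<in> I" for \<alpha>
      using red that by (simp add: reduced_weighting_def weighting_def)
    show "e \<alpha> = 1" if "\<alpha> \<in> I" "finite (chosen_blocks I lam -` {\<alpha>})" for \<alpha>
    proof -
      have "lam \<alpha> = enat (card (chosen_blocks I lam -` {\<alpha>}))"
        using chosen_blocks(2)[OF comp that(1)] that(2) by (simp add: ecard_def)
      then have "lam \<alpha> < \<infinity>" by simp
      then show ?thesis using red that by (simp add: reduced_weighting_def)
    qed
    show "p = sym_ideal_of (chosen_blocks I lam) e (contraction I Z)"
      unfolding p(1) by (rule P_ideal_eq[OF comp Z])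
  qed
qed

lemma (in config) sym_ideal_of_1: "sym_ideal_of \<pi> (\<lambda>_. 1) q = orbit_ideal"
proof -
  have "F \<in> Qset (\<lambda>i. 1) q \<longleftrightarrow> lookup F 0 \<in> q" for F :: "(nat, ('i, 'a) mpoly) mpoly"
  proof -
    have "(\<forall>x. lookup m x < 1) \<longleftrightarrow> m = 0" for m :: "nat \<Rightarrow>\<^sub>0 nat"
      by (metis less_one lookup_zero poly_mapping_eqI)
    then show ?thesis by (simp add: Qset_def)
  qed
  then show ?thesis by (simp add: sym_ideal_of_def orbit_ideal_def point_def lookup_0_taylor)
qed

lemma carrier_poly_ring: "carrier ring_of_type_algebra = UNIV"
  by (simp add: ring_of_type_algebra_def)

lemma finitary_sym_prime_exists:
  assumes p: "sym_prime \<pp>" and fin: "finitary \<pp>"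
  shows "\<exists>(I :: nat set) lam e Z. reduced_triple I lam e Z \<and> \<pp> = P_ideal I lam e Z"
proof -
  obtain I :: "nat set" and lam Z where comp: "inf_composition I lam"
    and Z: "irreducible_closed (conf_ring I) Z" and rad: "ideal_radical poly_ring \<pp> = P_ideal I lam (\<lambda>_. 1) Z"
    using fin by (auto simp: finitary_def)
  interpret C: config I "chosen_blocks I lam" "contraction I Z" by (rule config_of_triple[OF comp Z])
  have orbit: "C.orbit_ideal = {x. \<exists>n. x ^ n \<in> \<pp>}"
    using rad unfolding P_ideal_eq[OF comp Z] C.sym_ideal_of_1
    by (simp add: ideal_radical_def pow_type_ring carrier_poly_ring)
  interpret S: sprime_config I "chosen_blocks I lam" "contraction I Z" \<pp>
  proof (intro sprime_config.intro sprime_config_axioms.intro C.config_axioms sym_prime_elementwise[OF p])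
    show "\<pp> \<subseteq> C.orbit_ideal" unfolding orbit by (auto intro: exI[of _ 1])
  qed (simp add: orbit)
  obtain D w where w: "S.minimal D w" using S.minimal_exists by blast
  note a = S.minimal_adapted[OF w]
  have "\<pp> = P_ideal I lam (S.expo w) Z"
    unfolding P_ideal_eq[OF comp Z] sym_ideal_of_def by (rule S.minimal_describes_p[OF w])
  moreover have "S.expo w \<alpha> = 1" if "\<alpha> \<in> I" "lam \<alpha> < \<infinity>" for \<alpha>
  proof -
    have "finite (chosen_blocks I lam -` {\<alpha>})"
      using chosen_blocks(2)[OF comp that(1)] that(2) by (auto simp: ecard_def split: if_splits)
    then show ?thesis using S.expo_fin[OF a that(1)] by (simp add: C.inf_blocks_def)
  qed
  then have "reduced_triple I lam (S.expo w) Z"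
    using comp Z S.expo_ge_1[OF a] by (auto simp: reduced_triple_def reduced_weighting_def weighting_def)
  ultimately show ?thesis by blast
qed

lemma reduced_triple_unique:
  fixes I :: "'i set" and I' :: "'j set"
  assumes p: "sym_prime \<pp>"
    and t: "reduced_triple I lam e Z" "\<pp> = P_ideal I lam e Z"
    and t': "reduced_triple I' lam' e' Z'" "\<pp> = P_ideal I' lam' e' Z'"
  shows "triple_iso I lam e Z I' lam' e' Z'"
proof -
  have comp: "inf_composition I lam" and Z: "irreducible_closed (conf_ring I) Z"
    using t(1) by (simp_all add: reduced_triple_def)
  have comp': "inf_composition I' lam'" and Z': "irreducible_closed (conf_ring I') Z'"
    using t'(1) by (simp_all add: reduced_triple_def)
  from presentation_unique[OF presentation_of_triple[OF t sym_prime_elementwise[OF p]]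
      presentation_of_triple[OF t' sym_prime_elementwise[OF p]]]
  obtain \<psi> where \<psi>: "bij_betw \<psi> I I'"
    "\<And>\<alpha>. \<alpha> \<in> I \<Longrightarrow> ecard (chosen_blocks I' lam' -` {\<psi> \<alpha>}) = ecard (chosen_blocks I lam -` {\<alpha>}) \<and> e' (\<psi> \<alpha>) = e \<alpha>"
    "\<And>h. h \<in> mpolys_in I \<Longrightarrow> rename \<psi> h \<in> contraction I' Z' \<longleftrightarrow> h \<in> contraction I Z"
    by metis
  show ?thesis
  proof (rule triple_iso_if_primes_correspond[OF \<psi>(1) composition_nonempty[OF comp] Z
        composition_nonempty[OF comp'] Z' \<psi>(3)])
    fix \<alpha> assume \<alpha>: "\<alpha> \<in> I"
    then have "\<psi> \<alpha> \<in> I'" using \<psi>(1) by (auto simp: bij_betw_def)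
    then show "lam' (\<psi> \<alpha>) = lam \<alpha> \<and> e' (\<psi> \<alpha>) = e \<alpha>"
      using \<psi>(2)[OF \<alpha>] chosen_blocks(2)[OF comp \<alpha>] chosen_blocks(2)[OF comp'] by simp
  qed
qed

theorem theorem5p1:
  fixes \<pp> :: "(nat, 'a::comm_ring_1) mpoly set"
  assumes "sym_prime \<pp>" and "finitary \<pp>"
  shows "(\<exists>(I :: nat set) lam e Z. reduced_triple I lam e Z \<and> \<pp> = P_ideal I lam e Z) \<and>
    (\<forall>(I :: 'i set) lam e Z (I' :: 'j set) lam' e' Z'.
       reduced_triple I lam e Z \<and> \<pp> = P_ideal I lam e Z \<longrightarrow>
       reduced_triple I' lam' e' Z' \<and> \<pp> = P_ideal I' lam' e' Z' \<longrightarrow>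
       triple_iso I lam e Z I' lam' e' Z')"
proof (intro conjI allI impI)
  show "\<exists>(I :: nat set) lam e Z. reduced_triple I lam e Z \<and> \<pp> = P_ideal I lam e Z"
    by (rule finitary_sym_prime_exists[OF assms])
qed (rule reduced_triple_unique[OF assms(1)]; simp)

end
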